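(* Let $\Phi$ be a root system of affine type and $c$ a Coxeter element. A set $C\subseteq\Phi_c$ is a real $c$-cluster (a $c$-cluster not containing $\delta$) if and only if it is a maximal set of pairwise $c$-compatible roots in $\Phi_c\setminus\{\delta\}$.
   Context: $A=[a_{ij}]$ is an $n\times n$ symmetrizable Cartan matrix of affine type with symmetrizing constants $d_i$; $V$ has basis of simple roots $\Pi=\{\alpha_1,\dots,\alpha_n\}$, co-roots $\alpha_i^\vee=d_i^{-1}\alpha_i$, symmetric form $K(\alpha_i^\vee,\alpha_j)=a_{ij}$, reflections $s_i(v)=v-K(\alpha_i^\vee,v)\alpha_i$. $\Phi$ is the root system, $\Phi^+$ the positive roots; $[v:\alpha_i]$, $[v:\alpha_i^\vee]$ coordinates in root and co-root bases; $[x]_+=\max(x,0)$; $\beta^\vee=\frac2{K(\beta,\beta)}\beta$ for real roots, $(-\alpha_i)^\vee=-\alpha_i^\vee$; $\delta$ is the positive imaginary root closest to $0$ and $\delta^\vee$ the positive imaginary root closest to $0$ of the dual root system (Cartan matrix $A^T$). The Coxeter element is indexed $c=s_1\cdots s_n$. With $\alpha_{\mathrm{aff}}$ the affine simple root, $V_{\mathrm{fin}}$ the span of the others, $\Phi_{\mathrm{fin}}=\Phi\cap V_{\mathrm{fin}}$: $\gamma_c\in V_{\mathrm{fin}}$ unique with $c\gamma_c=\gamma_c+\delta$, $U_c=\{v:K(\gamma_c,v)=0\}$, $\Upsilon_c=\Phi\cap U_c$, $\Upsilon^{\mathrm{re}}_c$ the positive real roots in $U_c$ whose $c$-orbit contains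 a root of $\Phi_{\mathrm{fin}}$, $\Phi_c=-\Pi\cup(\Phi^+\setminus U_c)\cup\Upsilon^{\mathrm{re}}_c\cup\{\delta\}$. Real roots of $\Upsilon_c$ form a root system with irreducible components of affine type A; $\Pi_c$ is the unique minimal subset of $\Upsilon_c\cap\Phi^+$ whose nonnegative span contains $\Upsilon_c\cap\Phi^+$. Tube support $\mathrm{Supp}_{\Pi_c}(\beta)$: elements of $\Pi_c$ with nonzero coefficient in the unique expansion of $\beta$ in simple roots of its component; union for sets; component-full: containing all simple roots of some component. $\beta_j\in\Pi_c$ is adjacent to $\alpha$ if $\beta_j\in\mathrm{Supp}_{\Pi_c}(c\alpha)\cup\mathrm{Supp}_{\Pi_c}(c^{-1}\alpha)$, $\beta_j\notin\mathrm{Supp}_{\Pi_c}(\alpha)$; $\mathrm{adj}(\alpha,\beta)$ counts adjacent-to-$\alpha$ elements of $\mathrm{Supp}_{\Pi_c}(\beta)$. $(\alpha\|\beta)_c^{\to}=-\sum_{i}[\alpha^\vee:\alpha_i^\vee][\beta:\alpha_i]-\sum_{j<i}a_{ij}[\alpha^\vee:\alpha_i^\vee]_+[\beta:\alpha_j]_+$, $(\alpha\|\beta)_c^{\leftarrow}=-\sum_{i}[\alpha^\vee:\alpha_i^\vee][\beta:\alpha_i]-\sum_{i<j}a_{ij}[\alpha^\vee:\alpha_i^\vee]_+[\beta:\alpha_j]_+$; $(\alpha\|\beta)_c=\mathrm{adj}(\alpha,\beta)$ if $\alpha,\beta\in\Upsilon^{\mathrm{re}}_c$ and $\{\alpha,\beta\}$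 is component-full, otherwise the maximum of these two. Distinct $\alpha,\beta\in\Phi_c$ are $c$-compatible if $(\alpha\|\beta)_c=0$ (a symmetric relation). The $c$-cluster complex has vertex set $\Phi_c$ and faces the sets of pairwise $c$-compatible roots; $c$-clusters are its maximal faces (maximal sets of pairwise $c$-compatible roots in $\Phi_c$); a real $c$-cluster is one not containing $\delta$. *)

theory Defs
  imports Complex_Main
begin

text \<open>Vectors of V are represented by their coordinates in the basis of simple
roots: v i = [v : alpha_i] for i < n (coordinates i >= n are irrelevant and
kept 0).  Indices run over 0..<n (paper: 1..n), so the Coxeter element
c = s_1 ... s_n becomes s_0 o s_1 o ... o s_(n-1).  A Cartan matrix is a
function nat => nat => int read on {0..<n} x {0..<n}.\<close>

type_synonym vec = "nat \<Rightarrow> real"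
type_synonym cmat = "nat \<Rightarrow> nat \<Rightarrow> int"

definition supported :: "nat \<Rightarrow> vec \<Rightarrow> bool" where
  "supported n v \<longleftrightarrow> (\<forall>j\<ge>n. v j = 0)"

definition simple :: "nat \<Rightarrow> vec" where
  "simple i = (\<lambda>j. if j = i then 1 else 0)"

definition vneg :: "vec \<Rightarrow> vec" where
  "vneg v = (\<lambda>j. - v j)"

definition vadd :: "vec \<Rightarrow> vec \<Rightarrow> vec" where
  "vadd u v = (\<lambda>j. u j + v j)"

definition vscale :: "real \<Rightarrow> vec \<Rightarrow> vec" where
  "vscale t v = (\<lambda>j. t * v j)"

definition transpose_cm :: "cmat \<Rightarrow> cmat" where
  "transpose_cm A = (\<lambda>i j. A j i)"

definition cpair :: "nat \<Rightarrow> cmat \<Rightarrow> nat \<Rightarrow> vec \<Rightarrow> real" where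
  "cpair n A i v = (\<Sum>j<n. of_int (A i j) * v j)"

definition refl :: "nat \<Rightarrow> cmat \<Rightarrow> nat \<Rightarrow> vec \<Rightarrow> vec" where
  "refl n A i v = (\<lambda>j. v j - cpair n A i v * simple i j)"

definition Kform :: "nat \<Rightarrow> cmat \<Rightarrow> (nat \<Rightarrow> real) \<Rightarrow> vec \<Rightarrow> vec \<Rightarrow> real" where
  "Kform n A d u v = (\<Sum>i<n. \<Sum>j<n. u i * d i * of_int (A i j) * v j)"

definition GCM :: "nat \<Rightarrow> cmat \<Rightarrow> bool" where
  "GCM n A \<longleftrightarrow> (\<forall>i<n. A i i = 2) \<and> (\<forall>i<n. \<forall>j<n. i \<noteq> j \<longrightarrow> A i j \<le> 0)
     \<and> (\<forall>i<n. \<forall>j<n. A i j = 0 \<longleftrightarrow> A j i = 0)"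

definition conn_nodes :: "cmat \<Rightarrow> nat set \<Rightarrow> bool" where
  "conn_nodes A S \<longleftrightarrow> (\<forall>S1 S2. S1 \<union> S2 = S \<and> S1 \<inter> S2 = {} \<and> S1 \<noteq> {} \<and> S2 \<noteq> {}
       \<longrightarrow> (\<exists>i\<in>S1. \<exists>j\<in>S2. A i j \<noteq> 0))"

definition indecomposable :: "nat \<Rightarrow> cmat \<Rightarrow> bool" where
  "indecomposable n A \<longleftrightarrow> n > 0 \<and> conn_nodes A {..<n}"

definition mat_app :: "nat \<Rightarrow> cmat \<Rightarrow> vec \<Rightarrow> vec" where
  "mat_app n A u = (\<lambda>i. if i < n then (\<Sum>j<n. of_int (A i j) * u j) else 0)"

definition affine_type :: "nat \<Rightarrow> cmat \<Rightarrow> bool" where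
  "affine_type n A \<longleftrightarrow> GCM n A \<and> indecomposable n A \<and>
     (\<exists>u. supported n u \<and> (\<forall>i<n. u i > 0) \<and> mat_app n A u = (\<lambda>_. 0) \<and>
        (\<forall>v. supported n v \<and> mat_app n A v = (\<lambda>_. 0) \<longrightarrow> (\<exists>t. v = vscale t u))) \<and>
     (\<forall>v. supported n v \<and> (\<forall>i<n. mat_app n A v i \<ge> 0) \<longrightarrow> mat_app n A v = (\<lambda>_. 0))"

definition symmetrizer :: "nat \<Rightarrow> cmat \<Rightarrow> (nat \<Rightarrow> real) \<Rightarrow> bool" where
  "symmetrizer n A d \<longleftrightarrow> (\<forall>i<n. d i > 0) \<and>
     (\<forall>i<n. \<forall>j<n. d i * of_int (A i j) = d j * of_int (A j i))"

inductive_set weyl_orbit :: "nat \<Rightarrow> cmat \<Rightarrow> vec set \<Rightarrow> vec set" for n A S where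
  base: "v \<in> S \<Longrightarrow> v \<in> weyl_orbit n A S"
| step: "v \<in> weyl_orbit n A S \<Longrightarrow> i < n \<Longrightarrow> refl n A i v \<in> weyl_orbit n A S"

definition simples :: "nat \<Rightarrow> vec set" where
  "simples n = simple ` {..<n}"

definition real_roots :: "nat \<Rightarrow> cmat \<Rightarrow> vec set" where
  "real_roots n A = weyl_orbit n A (simples n)"

definition fund_set :: "nat \<Rightarrow> cmat \<Rightarrow> vec set" where
  "fund_set n A = {a. supported n a \<and> (\<forall>i<n. a i \<in> \<int> \<and> a i \<ge> 0) \<and> (\<exists>i<n. a i \<noteq> 0)
      \<and> conn_nodes A {i. i < n \<and> a i \<noteq> 0} \<and> (\<forall>i<n. cpair n A i a \<le> 0)}"

definition pos_imag_roots :: "nat \<Rightarrow> cmat \<Rightarrow> vec set" where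
  "pos_imag_roots n A = weyl_orbit n A (fund_set n A)"

definition roots :: "nat \<Rightarrow> cmat \<Rightarrow> vec set" where
  "roots n A = real_roots n A \<union> pos_imag_roots n A \<union> vneg ` pos_imag_roots n A"

definition positive :: "nat \<Rightarrow> vec \<Rightarrow> bool" where
  "positive n v \<longleftrightarrow> (\<forall>i<n. v i \<ge> 0)"

definition pos_roots :: "nat \<Rightarrow> cmat \<Rightarrow> vec set" where
  "pos_roots n A = {b \<in> roots n A. positive n b}"

text \<open>delta: the positive imaginary root closest to 0 (all positive imaginary
 roots are positive integer multiples of it).\<close>
definition delta :: "nat \<Rightarrow> cmat \<Rightarrow> vec" where
  "delta n A = (THE dl. dl \<in> pos_imag_roots n A \<and>
      (\<forall>b\<in>pos_imag_roots n A. \<exists>k::nat. k \<ge> 1 \<and> b = vscale (real k) dl))"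

text \<open>Coordinates [beta^vee : alpha_i^vee] of the co-root of a root beta in Phi_c:
 beta^vee = 2 beta / K(beta,beta) for real roots (and [v:alpha_i^vee] = d_i [v:alpha_i]),
 delta^vee = positive imaginary root closest to 0 of the dual system (matrix A^T),
 whose coordinates are taken in the co-root basis.\<close>
definition ccoord :: "nat \<Rightarrow> cmat \<Rightarrow> (nat \<Rightarrow> real) \<Rightarrow> vec \<Rightarrow> nat \<Rightarrow> real" where
  "ccoord n A d b i =
     (if b \<in> real_roots n A then 2 / Kform n A d b b * b i * d i
      else if b = delta n A then delta n (transpose_cm A) i else 0)"

definition cox :: "nat \<Rightarrow> cmat \<Rightarrow> vec \<Rightarrow> vec" where
  "cox n A = foldr (\<lambda>i f. refl n A i \<circ> f) [0..<n] id"

definition cox_inv :: "nat \<Rightarrow> cmat \<Rightarrow> vec \<Rightarrow> vec" where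
  "cox_inv n A = foldr (\<lambda>i f. refl n A i \<circ> f) (rev [0..<n]) id"

definition cox_pow :: "nat \<Rightarrow> cmat \<Rightarrow> int \<Rightarrow> vec \<Rightarrow> vec" where
  "cox_pow n A k = (if k \<ge> 0 then cox n A ^^ nat k else cox_inv n A ^^ nat (- k))"

definition Vfin :: "nat \<Rightarrow> nat \<Rightarrow> vec set" where
  "Vfin n aff = {v. supported n v \<and> v aff = 0}"

definition Phi_fin :: "nat \<Rightarrow> cmat \<Rightarrow> nat \<Rightarrow> vec set" where
  "Phi_fin n A aff = roots n A \<inter> Vfin n aff"

definition gamma_c :: "nat \<Rightarrow> cmat \<Rightarrow> nat \<Rightarrow> vec" where
  "gamma_c n A aff = (THE g. g \<in> Vfin n aff \<and> cox n A g = vadd g (delta n A))"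

definition U_c :: "nat \<Rightarrow> cmat \<Rightarrow> (nat \<Rightarrow> real) \<Rightarrow> nat \<Rightarrow> vec set" where
  "U_c n A d aff = {v. Kform n A d (gamma_c n A aff) v = 0}"

definition Ups_c :: "nat \<Rightarrow> cmat \<Rightarrow> (nat \<Rightarrow> real) \<Rightarrow> nat \<Rightarrow> vec set" where
  "Ups_c n A d aff = roots n A \<inter> U_c n A d aff"

definition Ups_re :: "nat \<Rightarrow> cmat \<Rightarrow> (nat \<Rightarrow> real) \<Rightarrow> nat \<Rightarrow> vec set" where
  "Ups_re n A d aff = {b \<in> real_roots n A. positive n b \<and> b \<in> U_c n A d aff \<and>
       (\<exists>k::int. cox_pow n A k b \<in> Phi_fin n A aff)}"

definition Phi_c :: "nat \<Rightarrow> cmat \<Rightarrow> (nat \<Rightarrow> real) \<Rightarrow> nat \<Rightarrow> vec set" where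
  "Phi_c n A d aff = vneg ` simples n \<union> (pos_roots n A - U_c n A d aff)
      \<union> Ups_re n A d aff \<union> {delta n A}"

definition lin_comb :: "vec set \<Rightarrow> (vec \<Rightarrow> real) \<Rightarrow> vec" where
  "lin_comb F f = (\<lambda>j. \<Sum>q\<in>F. f q * q j)"

definition nonneg_span :: "vec set \<Rightarrow> vec set" where
  "nonneg_span S = {v. \<exists>F f. finite F \<and> F \<subseteq> S \<and> (\<forall>q\<in>F. f q \<ge> 0) \<and> v = lin_comb F f}"

definition Pi_c :: "nat \<Rightarrow> cmat \<Rightarrow> (nat \<Rightarrow> real) \<Rightarrow> nat \<Rightarrow> vec set" where
  "Pi_c n A d aff = (THE P. P \<subseteq> Ups_c n A d aff \<inter> pos_roots n A \<and>
      Ups_c n A d aff \<inter> pos_roots n A \<subseteq> nonneg_span P \<and>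
      (\<forall>Q. Q \<subset> P \<longrightarrow> \<not> (Ups_c n A d aff \<inter> pos_roots n A \<subseteq> nonneg_span Q)))"

text \<open>Irreducible components of the root system of real roots of Upsilon_c,
 identified with their sets of simple roots: connected components of Pi_c
 w.r.t. the (Dynkin) relation K(p,q) /= 0.\<close>
definition tube_component :: "nat \<Rightarrow> cmat \<Rightarrow> (nat \<Rightarrow> real) \<Rightarrow> nat \<Rightarrow> vec set \<Rightarrow> bool" where
  "tube_component n A d aff C \<longleftrightarrow> C \<noteq> {} \<and> C \<subseteq> Pi_c n A d aff \<and>
     (\<forall>p\<in>C. \<forall>q\<in>Pi_c n A d aff. Kform n A d p q \<noteq> 0 \<longrightarrow> q \<in> C) \<and>
     (\<forall>C1 C2. C1 \<union> C2 = C \<and> C1 \<inter> C2 = {} \<and> C1 \<noteq> {} \<and> C2 \<noteq> {}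
        \<longrightarrow> (\<exists>p\<in>C1. \<exists>q\<in>C2. Kform n A d p q \<noteq> 0))"

text \<open>Tube support: elements of Pi_c with nonzero coefficient in the (unique)
 expansion of beta in the simple roots of its component.\<close>
definition tsupp :: "nat \<Rightarrow> cmat \<Rightarrow> (nat \<Rightarrow> real) \<Rightarrow> nat \<Rightarrow> vec \<Rightarrow> vec set" where
  "tsupp n A d aff b = {p \<in> Pi_c n A d aff. \<exists>C. tube_component n A d aff C \<and> p \<in> C \<and>
      (\<exists>f. b = lin_comb C f \<and> f p \<noteq> 0)}"

definition tsupp_set :: "nat \<Rightarrow> cmat \<Rightarrow> (nat \<Rightarrow> real) \<Rightarrow> nat \<Rightarrow> vec set \<Rightarrow> vec set" where
  "tsupp_set n A d aff S = (\<Union>b\<in>S. tsupp n A d aff b)"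

definition component_full :: "nat \<Rightarrow> cmat \<Rightarrow> (nat \<Rightarrow> real) \<Rightarrow> nat \<Rightarrow> vec set \<Rightarrow> bool" where
  "component_full n A d aff S \<longleftrightarrow>
     (\<exists>C. tube_component n A d aff C \<and> C \<subseteq> tsupp_set n A d aff S)"

definition adjacent :: "nat \<Rightarrow> cmat \<Rightarrow> (nat \<Rightarrow> real) \<Rightarrow> nat \<Rightarrow> vec \<Rightarrow> vec \<Rightarrow> bool" where
  "adjacent n A d aff a p \<longleftrightarrow> p \<in> Pi_c n A d aff \<and>
     p \<in> tsupp n A d aff (cox n A a) \<union> tsupp n A d aff (cox_inv n A a) \<and>
     p \<notin> tsupp n A d aff a"

definition adj :: "nat \<Rightarrow> cmat \<Rightarrow> (nat \<Rightarrow> real) \<Rightarrow> nat \<Rightarrow> vec \<Rightarrow> vec \<Rightarrow> nat" where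
  "adj n A d aff a b = card {p \<in> tsupp n A d aff b. adjacent n A d aff a p}"

definition pos_part :: "real \<Rightarrow> real" where
  "pos_part x = max x 0"

definition cdeg_right :: "nat \<Rightarrow> cmat \<Rightarrow> (nat \<Rightarrow> real) \<Rightarrow> vec \<Rightarrow> vec \<Rightarrow> real" where
  "cdeg_right n A d a b =
     - (\<Sum>i<n. ccoord n A d a i * b i)
     - (\<Sum>i<n. \<Sum>j<i. of_int (A i j) * pos_part (ccoord n A d a i) * pos_part (b j))"

definition cdeg_left :: "nat \<Rightarrow> cmat \<Rightarrow> (nat \<Rightarrow> real) \<Rightarrow> vec \<Rightarrow> vec \<Rightarrow> real" where
  "cdeg_left n A d a b =
     - (\<Sum>i<n. ccoord n A d a i * b i)
     - (\<Sum>i<n. \<Sum>j\<in>{i<..<n}. of_int (A i j) * pos_part (ccoord n A d a i) * pos_part (b j))"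

definition cdeg :: "nat \<Rightarrow> cmat \<Rightarrow> (nat \<Rightarrow> real) \<Rightarrow> nat \<Rightarrow> vec \<Rightarrow> vec \<Rightarrow> real" where
  "cdeg n A d aff a b =
     (if a \<in> Ups_re n A d aff \<and> b \<in> Ups_re n A d aff \<and> component_full n A d aff {a, b}
      then real (adj n A d aff a b)
      else max (cdeg_right n A d a b) (cdeg_left n A d a b))"

definition c_compatible :: "nat \<Rightarrow> cmat \<Rightarrow> (nat \<Rightarrow> real) \<Rightarrow> nat \<Rightarrow> vec \<Rightarrow> vec \<Rightarrow> bool" where
  "c_compatible n A d aff a b \<longleftrightarrow> a \<in> Phi_c n A d aff \<and> b \<in> Phi_c n A d aff \<and> a \<noteq> b
      \<and> cdeg n A d aff a b = 0"

definition pairwise_compatible :: "nat \<Rightarrow> cmat \<Rightarrow> (nat \<Rightarrow> real) \<Rightarrow> nat \<Rightarrow> vec set \<Rightarrow> bool" where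
  "pairwise_compatible n A d aff S \<longleftrightarrow>
     (\<forall>a\<in>S. \<forall>b\<in>S. a \<noteq> b \<longrightarrow> c_compatible n A d aff a b)"

definition maximal_compatible_in ::
  "nat \<Rightarrow> cmat \<Rightarrow> (nat \<Rightarrow> real) \<Rightarrow> nat \<Rightarrow> vec set \<Rightarrow> vec set \<Rightarrow> bool" where
  "maximal_compatible_in n A d aff G S \<longleftrightarrow> S \<subseteq> G \<and> pairwise_compatible n A d aff S \<and>
     (\<forall>T. S \<subset> T \<and> T \<subseteq> G \<longrightarrow> \<not> pairwise_compatible n A d aff T)"

definition c_cluster :: "nat \<Rightarrow> cmat \<Rightarrow> (nat \<Rightarrow> real) \<Rightarrow> nat \<Rightarrow> vec set \<Rightarrow> bool" where
  "c_cluster n A d aff C \<longleftrightarrow> maximal_compatible_in n A d aff (Phi_c n A d aff) C"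

definition real_c_cluster :: "nat \<Rightarrow> cmat \<Rightarrow> (nat \<Rightarrow> real) \<Rightarrow> nat \<Rightarrow> vec set \<Rightarrow> bool" where
  "real_c_cluster n A d aff C \<longleftrightarrow> c_cluster n A d aff C \<and> delta n A \<notin> C"

end

theory Submission imports Defs "HOL-Library.Function_Algebras"
begin

text \<open>A cluster that is maximal without \<open>\<delta>\<close> can only fail to be maximal if all of its roots are compatible
  with \<open>\<delta>\<close>. Let \<open>E\<close> be the Euler form, \<open>K u v = E u v + E v u\<close> and \<open>E u v = - E (c v) u\<close>. Compatibility
  degrees of positive roots are multiples of values of \<open>E\<close>, and \<open>U_c\<close> is the kernel of \<open>E \<delta>\<close>, so every root
  compatible with \<open>\<delta>\<close> lies in the tubes \<open>Ups_re\<close>. It then suffices to find a real root outside \<open>U_c\<close> that is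
  compatible with all roots of \<open>C\<close>.

  The Coxeter element permutes \<open>Pi_c\<close>, its orbits are the simple systems of the components, and for
  \<open>p, q\<close> in \<open>Pi_c\<close> one has \<open>E p q = 0\<close> unless \<open>p = q\<close> or \<open>p = c q\<close>. The roots of \<open>Ups_re\<close> are the sums over
  proper arcs of such orbits, and pairwise compatible arcs always miss an element of each orbit: take a
  longest arc in the orbit and look at the element following it.

  The preprojective root \<open>Pr e\<close> of a special node \<open>e\<close> lies outside \<open>U_c\<close> and is not \<open>E\<close>-orthogonal to exactly one
  element \<open>q\<close> of each orbit. Reflecting in \<open>q\<close> replaces it by \<open>c q\<close> and leaves the other orbits alone, so
  these elements can be moved independently to elements missed by \<open>C\<close>; the resulting root is compatible
  with \<open>C\<close>.\<close>

section \<open>Linear algebra of coordinate vectors\<close>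

text \<open>No classification of affine diagrams enters. Two positivity facts carry the argument:
  \<open>K\<close> is semidefinite with kernel spanned by \<delta>, hence definite on vectors with a
  fixed vanishing coordinate, and a vector fixed by \<open>c\<close> is isotropic. The obstacle is
  the shape of \<open>E\<close> on \<open>Pi_c\<close>: inside an orbit, obtuseness of a simple
  system gives only \<open>K p q \<le> 0\<close>, which bounds the sum of \<open>E p q\<close> and
  \<open>E q p\<close> but not each term. The stronger sign \<open>E p q \<le> 0\<close> is
  available in finite type, where the perpendicular of a root \<open>w\<close> has a simple system
  whose reflections, after the one in \<open>w\<close>, multiply to the Coxeter element. A special
  node \<open>e\<close> leads there: every real root is, modulo \<delta>, a multiple of a real root
  vanishing at \<open>e\<close>. For \<open>Pr e\<close> this gives the root \<open>w\<close>, and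
  the tube roots vanishing at \<open>e\<close> are the perpendicular of \<open>w\<close>. Each orbit
  has exactly one element that does not vanish at \<open>e\<close>, and \<open>c\<close> moves any
  element of the orbit there, so the sign transfers to every pair that leaves out a third element of
  the orbit.\<close>

abbreviation smul :: "real \<Rightarrow> vec \<Rightarrow> vec" (infixr "*s" 75) where
  "t *s v \<equiv> vscale t v"

lemma smul_apply: "(t *s v) j = t * v j" by (simp add: vscale_def)

lemmas vs = plus_fun_apply minus_apply uminus_apply zero_fun_apply smul_apply
lemmas ptw = vs fun_eq_iff
declare vs [simp del]

lemma smul_one [simp]: "1 *s v = v" by (simp add: ptw)
lemma smul_zero [simp]: "0 *s v = 0" by (simp add: ptw)
lemma smul_zero_right [simp]: "t *s 0 = 0" by (simp add: ptw)
lemma smul_smul [simp]: "a *s b *s v = (a * b) *s v" by (simp add: ptw)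
lemma smul_minus_one: "(-1) *s v = - v" by (simp add: ptw)
lemma smul_add_right: "a *s (u + v) = a *s u + a *s v" by (simp add: ptw algebra_simps)
lemma smul_diff_right: "a *s (u - v) = a *s u - a *s v" by (simp add: ptw algebra_simps)
lemma smul_add_left: "(a + b) *s u = a *s u + b *s u" by (simp add: ptw algebra_simps)
lemma smul_diff_left: "(a - b) *s u = a *s u - b *s u" by (simp add: ptw algebra_simps)
lemma smul_uminus_left: "(- a) *s u = - (a *s u)" by (simp add: ptw)

lemma sum_vec_apply: "(\<Sum>i\<in>I. (w i :: vec)) j = (\<Sum>i\<in>I. w i j)"
  by (induction I rule: infinite_finite_induct) (auto simp: vs)

lemma vneg_eq: "vneg v = - v" by (simp add: vneg_def ptw)

lemma lin_comb_eq: "lin_comb F f = (\<Sum>q\<in>F. f q *s q)"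
  by (simp add: lin_comb_def ptw sum_vec_apply)

definition lin :: "(vec \<Rightarrow> real) \<Rightarrow> bool" where
  "lin \<phi> \<longleftrightarrow> (\<forall>u v. \<phi> (u + v) = \<phi> u + \<phi> v) \<and> (\<forall>t u. \<phi> (t *s u) = t * \<phi> u)"

definition linv :: "(vec \<Rightarrow> vec) \<Rightarrow> bool" where
  "linv T \<longleftrightarrow> (\<forall>u v. T (u + v) = T u + T v) \<and> (\<forall>t u. T (t *s u) = t *s T u)"

lemma lin_add: "lin \<phi> \<Longrightarrow> \<phi> (u + v) = \<phi> u + \<phi> v" by (simp add: lin_def)
lemma lin_smul: "lin \<phi> \<Longrightarrow> \<phi> (t *s u) = t * \<phi> u" by (simp add: lin_def)
lemma lin_zero: "lin \<phi> \<Longrightarrow> \<phi> 0 = 0" using lin_smul[of \<phi> 0 0] by simp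
lemma lin_minus: "lin \<phi> \<Longrightarrow> \<phi> (- u) = - \<phi> u" using lin_smul[of \<phi> "-1" u] by (simp add: smul_minus_one)
lemma lin_diff: "lin \<phi> \<Longrightarrow> \<phi> (u - v) = \<phi> u - \<phi> v"
  using lin_add[of \<phi> u "-v"] lin_minus[of \<phi> v] by simp
lemma lin_sum: "lin \<phi> \<Longrightarrow> \<phi> (\<Sum>i\<in>I. w i) = (\<Sum>i\<in>I. \<phi> (w i))"
  by (induction I rule: infinite_finite_induct) (auto simp: lin_add lin_zero)
lemma lin_comb_lin: "lin \<phi> \<Longrightarrow> \<phi> (lin_comb F f) = (\<Sum>q\<in>F. f q * \<phi> q)"
  by (simp add: lin_comb_eq lin_sum lin_smul)
lemma lin_coord: "lin (\<lambda>v. v j)" by (simp add: lin_def vs)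
lemma lin_wsum: "lin (\<lambda>v. \<Sum>j\<in>J. c j * v j)"
  by (auto simp: lin_def vs sum.distrib algebra_simps sum_distrib_left)

lemma linv_add: "linv T \<Longrightarrow> T (u + v) = T u + T v" by (simp add: linv_def)
lemma linv_smul: "linv T \<Longrightarrow> T (t *s u) = t *s T u" by (simp add: linv_def)
lemma linv_zero: "linv T \<Longrightarrow> T 0 = 0" using linv_smul[of T 0 0] by simp
lemma linv_minus: "linv T \<Longrightarrow> T (- u) = - T u" using linv_smul[of T "-1" u] by (simp add: smul_minus_one)
lemma linv_diff: "linv T \<Longrightarrow> T (u - v) = T u - T v"
  using linv_add[of T u "-v"] linv_minus[of T v] by simp
lemma linv_sum: "linv T \<Longrightarrow> T (\<Sum>i\<in>I. w i) = (\<Sum>i\<in>I. T (w i))"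
  by (induction I rule: infinite_finite_induct) (auto simp: linv_add linv_zero)
lemma linv_comp: "linv S \<Longrightarrow> linv T \<Longrightarrow> linv (S \<circ> T)" by (simp add: linv_def)
lemma linv_id: "linv id" by (simp add: linv_def)
lemma linv_funpow: "linv T \<Longrightarrow> linv (T ^^ k)"
  by (induction k) (auto simp: linv_id intro: linv_comp)

section \<open>Linear spans and convex cones\<close>

definition lspan :: "vec set \<Rightarrow> vec set" where
  "lspan S = {v. \<exists>F f. finite F \<and> F \<subseteq> S \<and> v = lin_comb F f}"

lemma lin_comb_mono: "finite G \<Longrightarrow> F \<subseteq> G \<Longrightarrow> lin_comb F f = lin_comb G (\<lambda>q. if q \<in> F then f q else 0)"
proof -
  assume a: "finite G" "F \<subseteq> G"
  have "(\<Sum>q\<in>G. (if q \<in> F then f q else 0) *s q) = (\<Sum>q\<in>F. (if q \<in> F then f q else 0) *s q)"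
    by (rule sum.mono_neutral_right) (use a in auto)
  then show ?thesis by (simp add: lin_comb_eq cong: sum.cong)
qed

lemma lin_comb_add: "lin_comb F f + lin_comb F g = lin_comb F (\<lambda>q. f q + g q)"
  by (simp add: lin_comb_eq smul_add_left sum.distrib)

lemma lin_comb_smul: "a *s lin_comb F f = lin_comb F (\<lambda>q. a * f q)"
  by (simp add: lin_comb_def ptw sum_distrib_left mult.assoc)

lemma lin_comb_single: "finite F \<Longrightarrow> p \<in> F \<Longrightarrow> lin_comb F (\<lambda>q. if q = p then a else 0) = a *s p"
proof -
  assume a: "finite F" "p \<in> F"
  have "(\<Sum>q\<in>F. (if q = p then a else 0) *s q) = (\<Sum>q\<in>F. if q = p then a *s q else 0)"
    by (rule sum.cong) auto
  also have "\<dots> = a *s p" using a by simp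
  finally show ?thesis by (simp add: lin_comb_eq)
qed

lemma nonneg_span_zero: "0 \<in> nonneg_span S"
  unfolding nonneg_span_def by (auto intro!: exI[of _ "{}"] simp: lin_comb_def ptw)

lemma nonneg_span_base: "q \<in> S \<Longrightarrow> q \<in> nonneg_span S"
  unfolding nonneg_span_def
  by (auto intro!: exI[of _ "{q}"] exI[of _ "\<lambda>_. 1"] simp: lin_comb_def ptw)

lemma nonneg_spanI: "finite F \<Longrightarrow> F \<subseteq> S \<Longrightarrow> \<forall>q\<in>F. f q \<ge> 0 \<Longrightarrow> v = lin_comb F f \<Longrightarrow> v \<in> nonneg_span S"
  unfolding nonneg_span_def mem_Collect_eq by (rule exI[of _ F], rule exI[of _ f]) simp

lemma lspanI: "finite F \<Longrightarrow> F \<subseteq> S \<Longrightarrow> v = lin_comb F f \<Longrightarrow> v \<in> lspan S"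
  unfolding lspan_def mem_Collect_eq by (rule exI[of _ F], rule exI[of _ f]) simp

lemma nonneg_span_smul: assumes "v \<in> nonneg_span S" "a \<ge> 0" shows "a *s v \<in> nonneg_span S"
proof -
  from assms obtain F f where "finite F" "F \<subseteq> S" "\<forall>q\<in>F. f q \<ge> 0" "v = lin_comb F f"
    by (auto simp: nonneg_span_def)
  then show ?thesis using assms(2)
    by (intro nonneg_spanI[of F S "\<lambda>q. a * f q"]) (simp_all add: lin_comb_smul)
qed

lemma nonneg_span_add: assumes "u \<in> nonneg_span S" "v \<in> nonneg_span S" shows "u + v \<in> nonneg_span S"
proof -
  from assms obtain F f G g where h: "finite F" "F \<subseteq> S" "\<forall>q\<in>F. f q \<ge> 0" "u = lin_comb F f"
    "finite G" "G \<subseteq> S" "\<forall>q\<in>G. g q \<ge> 0" "v = lin_comb G g"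
    by (auto simp: nonneg_span_def)
  let ?f = "\<lambda>q. (if q \<in> F then f q else 0) + (if q \<in> G then g q else 0)"
  have "u = lin_comb (F \<union> G) (\<lambda>q. if q \<in> F then f q else 0)"
    unfolding h(4) by (rule lin_comb_mono) (use h in auto)
  moreover have "v = lin_comb (F \<union> G) (\<lambda>q. if q \<in> G then g q else 0)"
    unfolding h(8) by (rule lin_comb_mono) (use h in auto)
  ultimately have "u + v = lin_comb (F \<union> G) ?f" by (simp add: lin_comb_add)
  moreover have "finite (F \<union> G)" "F \<union> G \<subseteq> S" "\<forall>q\<in>F\<union>G. ?f q \<ge> 0" using h by auto
  ultimately show ?thesis by (rule nonneg_spanI[rotated 3])
qed

lemma nonneg_span_sum: "(\<And>i. i \<in> I \<Longrightarrow> w i \<in> nonneg_span S) \<Longrightarrow> (\<Sum>i\<in>I. w i) \<in> nonneg_span S"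
  by (induction I rule: infinite_finite_induct) (auto intro: nonneg_span_add nonneg_span_zero)

lemma nonneg_span_induct [consumes 1, case_names zero step]:
  assumes "v \<in> nonneg_span S" and z: "P 0"
    and st: "\<And>a q w. a \<ge> 0 \<Longrightarrow> q \<in> S \<Longrightarrow> P w \<Longrightarrow> P (a *s q + w)"
  shows "P v"
proof -
  from assms(1) obtain F f where h: "finite F" "F \<subseteq> S" "\<forall>q\<in>F. f q \<ge> 0" "v = lin_comb F f"
    by (auto simp: nonneg_span_def)
  from h(1-3) have "P (\<Sum>q\<in>F. f q *s q)"
    by (induction F rule: finite_induct) (auto intro: z st)
  with h(4) show ?thesis by (simp add: lin_comb_eq)
qed

lemma nonneg_span_trans: "v \<in> nonneg_span S \<Longrightarrow> S \<subseteq> nonneg_span T \<Longrightarrow> v \<in> nonneg_span T"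
  by (induction rule: nonneg_span_induct) (auto intro: nonneg_span_zero nonneg_span_add nonneg_span_smul)

lemma nonneg_span_mono: "S \<subseteq> T \<Longrightarrow> nonneg_span S \<subseteq> nonneg_span T"
  using nonneg_span_trans nonneg_span_base by blast

lemma nonneg_span_image: assumes "v \<in> nonneg_span S" and T: "linv T" shows "T v \<in> nonneg_span (T ` S)"
  using assms(1)
proof (induction rule: nonneg_span_induct)
  case zero
  show ?case unfolding linv_zero[OF T] by (rule nonneg_span_zero)
next
  case (step a q w)
  then show ?case unfolding linv_add[OF T] linv_smul[OF T]
    by (metis nonneg_span_add nonneg_span_smul nonneg_span_base imageI)
qed

lemma nonneg_span_finite:
  assumes "v \<in> nonneg_span S" "finite S"
  obtains f where "\<And>q. f q \<ge> 0" "v = lin_comb S f"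
proof -
  from assms(1) obtain F f where h: "finite F" "F \<subseteq> S" "\<forall>q\<in>F. f q \<ge> 0" "v = lin_comb F f"
    by (auto simp: nonneg_span_def)
  have "v = lin_comb S (\<lambda>q. if q \<in> F then f q else 0)"
    unfolding h(4) by (rule lin_comb_mono) (use h assms in auto)
  moreover have "\<And>q. (if q \<in> F then f q else 0) \<ge> 0" using h(3) by auto
  ultimately show ?thesis by (rule that[rotated])
qed

lemma lin_comb_nonneg_span: "finite F \<Longrightarrow> F \<subseteq> S \<Longrightarrow> (\<And>q. q \<in> F \<Longrightarrow> f q \<ge> 0) \<Longrightarrow> lin_comb F f \<in> nonneg_span S"
  by (auto intro: nonneg_spanI)

lemma lspan_finite:
  assumes "v \<in> lspan S" "finite S"
  obtains f where "v = lin_comb S f"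
proof -
  from assms(1) obtain F f where h: "finite F" "F \<subseteq> S" "v = lin_comb F f"
    by (auto simp: lspan_def)
  have "v = lin_comb S (\<lambda>q. if q \<in> F then f q else 0)"
    unfolding h(3) by (rule lin_comb_mono) (use h assms in auto)
  then show ?thesis using that by blast
qed

lemma lspan_base: "q \<in> S \<Longrightarrow> q \<in> lspan S"
  unfolding lspan_def
  by (auto intro!: exI[of _ "{q}"] exI[of _ "\<lambda>_. 1"] simp: lin_comb_def ptw)

lemma lspan_zero: "0 \<in> lspan S"
  unfolding lspan_def by (auto intro!: exI[of _ "{}"] simp: lin_comb_def ptw)

lemma lspan_smul: assumes "v \<in> lspan S" shows "a *s v \<in> lspan S"
proof -
  from assms obtain F f where "finite F" "F \<subseteq> S" "v = lin_comb F f" by (auto simp: lspan_def)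
  then show ?thesis by (intro lspanI[of F S _ "\<lambda>q. a * f q"]) (simp_all add: lin_comb_smul)
qed

lemma lspan_add: assumes "u \<in> lspan S" "v \<in> lspan S" shows "u + v \<in> lspan S"
proof -
  from assms obtain F f G g where h: "finite F" "F \<subseteq> S" "u = lin_comb F f"
    "finite G" "G \<subseteq> S" "v = lin_comb G g"
    by (auto simp: lspan_def)
  let ?f = "\<lambda>q. (if q \<in> F then f q else 0) + (if q \<in> G then g q else 0)"
  have "u = lin_comb (F \<union> G) (\<lambda>q. if q \<in> F then f q else 0)"
    unfolding h(3) by (rule lin_comb_mono) (use h in auto)
  moreover have "v = lin_comb (F \<union> G) (\<lambda>q. if q \<in> G then g q else 0)"
    unfolding h(6) by (rule lin_comb_mono) (use h in auto)
  ultimately have "u + v = lin_comb (F \<union> G) ?f" by (simp add: lin_comb_add)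
  moreover have "finite (F \<union> G)" "F \<union> G \<subseteq> S" using h by auto
  ultimately show ?thesis by (rule lspanI[rotated 2])
qed

lemma lspan_minus: "v \<in> lspan S \<Longrightarrow> - v \<in> lspan S"
  using lspan_smul[of v S "-1"] by (simp add: smul_minus_one)

lemma lspan_diff: "u \<in> lspan S \<Longrightarrow> v \<in> lspan S \<Longrightarrow> u - v \<in> lspan S"
  using lspan_add[of u S "-v"] lspan_minus[of v S] by simp

lemma lspan_sum: "(\<And>i. i \<in> I \<Longrightarrow> w i \<in> lspan S) \<Longrightarrow> (\<Sum>i\<in>I. w i) \<in> lspan S"
  by (induction I rule: infinite_finite_induct) (auto intro: lspan_add lspan_zero)

lemma lspan_induct [consumes 1, case_names zero step]:
  assumes "v \<in> lspan S" and z: "P 0"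
    and st: "\<And>a q w. q \<in> S \<Longrightarrow> P w \<Longrightarrow> P (a *s q + w)"
  shows "P v"
proof -
  from assms(1) obtain F f where h: "finite F" "F \<subseteq> S" "v = lin_comb F f"
    by (auto simp: lspan_def)
  from h(1-2) have "P (\<Sum>q\<in>F. f q *s q)"
    by (induction F rule: finite_induct) (auto intro: z st)
  with h(3) show ?thesis by (simp add: lin_comb_eq)
qed

lemma lspan_trans: "v \<in> lspan S \<Longrightarrow> S \<subseteq> lspan T \<Longrightarrow> v \<in> lspan T"
  by (induction rule: lspan_induct) (auto intro: lspan_zero lspan_add lspan_smul)

lemma lspan_image: assumes "v \<in> lspan S" and T: "linv T" shows "T v \<in> lspan (T ` S)"
  using assms(1)
proof (induction rule: lspan_induct)
  case zero
  show ?case unfolding linv_zero[OF T] by (rule lspan_zero)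
next
  case (step a q w)
  then show ?case unfolding linv_add[OF T] linv_smul[OF T]
    by (metis lspan_add lspan_smul lspan_base imageI)
qed

lemma nonneg_span_lspan: "nonneg_span S \<subseteq> lspan S"
  by (auto simp: nonneg_span_def intro: lspanI)

lemma simple_simps [simp]: "simple i i = 1" "j \<noteq> i \<Longrightarrow> simple i j = 0"
  by (auto simp: simple_def)

lemma supported_add: "supported n u \<Longrightarrow> supported n v \<Longrightarrow> supported n (u + v)" by (simp add: supported_def vs)
lemma supported_diff: "supported n u \<Longrightarrow> supported n v \<Longrightarrow> supported n (u - v)" by (simp add: supported_def vs)
lemma supported_minus: "supported n u \<Longrightarrow> supported n (- u)" by (simp add: supported_def vs)
lemma supported_smul: "supported n u \<Longrightarrow> supported n (t *s u)" by (simp add: supported_def vs)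
lemma supported_zero: "supported n 0" by (simp add: supported_def vs)
lemma supported_simple: "i < n \<Longrightarrow> supported n (simple i)" by (auto simp: supported_def simple_def)
lemma supported_sum: "(\<And>i. i \<in> I \<Longrightarrow> supported n (w i)) \<Longrightarrow> supported n (\<Sum>i\<in>I. w i)"
  by (simp add: supported_def sum_vec_apply)
lemma supported_lin_comb: "(\<And>i. i \<in> I \<Longrightarrow> supported n i) \<Longrightarrow> supported n (lin_comb I f)"
  by (auto simp: supported_def lin_comb_def intro!: sum.neutral)
lemma supported_refl: "i < n \<Longrightarrow> supported n v \<Longrightarrow> supported n (refl n A i v)"
  by (auto simp: supported_def refl_def simple_def)

lemmas supp_intros = supported_add supported_diff supported_minus supported_smul supported_zero
  supported_simple supported_sum supported_lin_comb supported_refl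

lemma supported_eqI: "supported n u \<Longrightarrow> supported n v \<Longrightarrow> (\<And>j. j < n \<Longrightarrow> u j = v j) \<Longrightarrow> u = v"
  by (rule ext) (metis supported_def not_le)

lemma supported_expand: "supported n v \<Longrightarrow> v = (\<Sum>i<n. v i *s simple i)"
proof (rule supported_eqI[of n])
  fix j assume "j < n"
  then show "v j = (\<Sum>i<n. v i *s simple i) j"
    by (simp add: vs sum_vec_apply simple_def if_distrib[of "\<lambda>x. _ * x"] cong: if_cong)
qed (auto intro!: supp_intros)

section \<open>The invariant form and the real roots\<close>

locale affine =
  fixes n :: nat and A :: cmat and d :: "nat \<Rightarrow> real"
  assumes aff: "affine_type n A" and symm: "symmetrizer n A d"
begin

abbreviation "K \<equiv> Kform n A d"
abbreviation "s \<equiv> refl n A"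
abbreviation "cp \<equiv> cpair n A"
abbreviation "supp \<equiv> supported n"

lemma d_pos: "i < n \<Longrightarrow> d i > 0" using symm by (simp add: symmetrizer_def)
lemma d_sym: "i < n \<Longrightarrow> j < n \<Longrightarrow> d i * of_int (A i j) = d j * of_int (A j i)"
  using symm by (simp add: symmetrizer_def)
lemma A_diag: "i < n \<Longrightarrow> A i i = 2" using aff by (simp add: affine_type_def GCM_def)
lemma A_off: "i < n \<Longrightarrow> j < n \<Longrightarrow> i \<noteq> j \<Longrightarrow> A i j \<le> 0" using aff by (simp add: affine_type_def GCM_def)

lemma lin_cp: "lin (cp i)" unfolding cpair_def by (rule lin_wsum)

lemma K_alt: "K u v = (\<Sum>i<n. u i * d i * cp i v)"
  by (simp add: Kform_def cpair_def sum_distrib_left mult.assoc)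

lemma K_sym: "K u v = K v u"
proof -
  have "K u v = (\<Sum>i<n. \<Sum>j<n. v j * d j * of_int (A j i) * u i)"
    unfolding Kform_def by (intro sum.cong refl) (use d_sym in \<open>auto simp: mult.assoc mult.left_commute mult.commute\<close>)
  also have "\<dots> = K v u" unfolding Kform_def by (rule sum.swap)
  finally show ?thesis .
qed

lemma lin_K: "lin (K u)"
  unfolding lin_def K_alt using lin_cp
  by (auto simp: lin_add lin_smul algebra_simps sum.distrib sum_distrib_left)

lemma lin_K2: "lin (\<lambda>u. K u v)" using lin_K[of v] by (simp add: K_sym[of _ v])

lemmas K_lin = lin_add[OF lin_K] lin_smul[OF lin_K] lin_diff[OF lin_K] lin_minus[OF lin_K] lin_zero[OF lin_K]
  lin_add[OF lin_K2] lin_smul[OF lin_K2] lin_diff[OF lin_K2] lin_minus[OF lin_K2] lin_zero[OF lin_K2]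
lemmas cp_lin = lin_add[OF lin_cp] lin_smul[OF lin_cp] lin_diff[OF lin_cp] lin_minus[OF lin_cp] lin_zero[OF lin_cp]

lemma K_simple: "i < n \<Longrightarrow> K (simple i) v = d i * cp i v"
proof -
  assume i: "i < n"
  have "K (simple i) v = (\<Sum>j<n. if j = i then d j * cp j v else 0)"
    unfolding K_alt by (rule sum.cong) (auto simp: simple_def)
  then show ?thesis using i by simp
qed

lemma cp_simple: "j < n \<Longrightarrow> cp i (simple j) = of_int (A i j)"
  unfolding cpair_def simple_def by (simp add: if_distrib[of "\<lambda>x. _ * x"] cong: if_cong)

lemma K_simple_simple: "i < n \<Longrightarrow> K (simple i) (simple i) = 2 * d i"
  by (simp add: K_simple cp_simple A_diag)

lemma s_eq: "s i v = v - cp i v *s simple i"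
  by (simp add: refl_def ptw)

lemma linv_s: "linv (s i)"
  by (auto simp: linv_def s_eq cp_lin smul_add_left smul_diff_right ptw algebra_simps)

lemma s_invol: "i < n \<Longrightarrow> s i (s i v) = v"
  by (simp add: s_eq cp_lin cp_simple A_diag ptw)

lemma K_s: "i < n \<Longrightarrow> K (s i u) (s i v) = K u v"
  by (simp add: s_eq K_lin K_simple K_simple_simple K_sym[of u "simple i"] cp_simple A_diag algebra_simps)

lemma n_pos: "n > 0" using aff by (simp add: affine_type_def indecomposable_def)

section \<open>The null vector and semidefiniteness of the invariant form\<close>

definition nullv :: vec where
  "nullv = (SOME u. supp u \<and> (\<forall>i<n. u i > 0) \<and> mat_app n A u = (\<lambda>_. 0))"

lemma nullv: "supp nullv" "i < n \<Longrightarrow> nullv i > 0" "i < n \<Longrightarrow> cp i nullv = 0"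
proof -
  have "\<exists>u. supp u \<and> (\<forall>i<n. u i > 0) \<and> mat_app n A u = (\<lambda>_. 0)"
    using aff unfolding affine_type_def by blast
  then have h: "supp nullv \<and> (\<forall>i<n. nullv i > 0) \<and> mat_app n A nullv = (\<lambda>_. 0)"
    unfolding nullv_def by (rule someI_ex)
  then show "supp nullv" "i < n \<Longrightarrow> nullv i > 0" by auto
  assume "i < n"
  then show "cp i nullv = 0" using h by (auto simp: mat_app_def cpair_def ptw split: if_splits)
qed

text \<open>In the coordinates \<open>v i / nullv i\<close> the matrix of \<open>K\<close> is
  symmetric with zero row sums, so the quadratic form is minus half the weighted sum of squared
  differences, as for a graph Laplacian.\<close>

lemma K_sos:
  "K v v = - (\<Sum>i<n. \<Sum>j<n. d i * of_int (A i j) * nullv i * nullv j * (v i / nullv i - v j / nullv j)\<^sup>2) / 2"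
proof -
  define w where "w i j = d i * of_int (A i j) * nullv i * nullv j" for i j
  define x where "x i = v i / nullv i" for i
  have v: "i < n \<Longrightarrow> v i = x i * nullv i" for i using nullv(2)[of i] by (simp add: x_def)
  have wsym: "i < n \<Longrightarrow> j < n \<Longrightarrow> w i j = w j i" for i j using d_sym[of i j] by (simp add: w_def)
  have row: "i < n \<Longrightarrow> (\<Sum>j<n. w i j) = 0" for i
    using nullv(3)[of i] by (simp add: w_def cpair_def mult.assoc sum_distrib_left[symmetric] mult.left_commute[of _ "nullv i"])
  have Kw: "K v v = (\<Sum>i<n. \<Sum>j<n. w i j * (x i * x j))"
    unfolding Kform_def by (intro sum.cong refl) (auto simp: w_def v)
  have "(\<Sum>i<n. \<Sum>j<n. w i j * (x i - x j)\<^sup>2) =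
     (\<Sum>i<n. \<Sum>j<n. w i j * (x i)\<^sup>2) + (\<Sum>i<n. \<Sum>j<n. w i j * (x j)\<^sup>2) - 2 * (\<Sum>i<n. \<Sum>j<n. w i j * (x i * x j))"
    by (simp add: sum.distrib[symmetric] sum_subtractf[symmetric] sum_distrib_left power2_eq_square algebra_simps)
  also have "(\<Sum>i<n. \<Sum>j<n. w i j * (x i)\<^sup>2) = 0"
    using row by (simp add: sum_distrib_right[symmetric])
  also have "(\<Sum>i<n. \<Sum>j<n. w i j * (x j)\<^sup>2) = (\<Sum>j<n. \<Sum>i<n. w j i * (x j)\<^sup>2)"
    by (subst sum.swap) (intro sum.cong refl, use wsym in auto)
  also have "\<dots> = 0" using row by (simp add: sum_distrib_right[symmetric])
  finally show ?thesis using Kw by (simp add: w_def x_def)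
qed

lemma K_sos_term: "i < n \<Longrightarrow> j < n \<Longrightarrow>
  d i * of_int (A i j) * nullv i * nullv j * (v i / nullv i - v j / nullv j)\<^sup>2 \<le> 0"
proof (cases "i = j")
  case False
  assume ij: "i < n" "j < n"
  have "d i * of_int (A i j) * nullv i * nullv j \<le> 0"
    using A_off[OF ij False] d_pos[of i] nullv(2)[of i] nullv(2)[of j] ij
    by (intro mult_nonpos_nonneg mult_nonneg_nonpos) auto
  then show ?thesis by (simp add: mult_nonpos_nonneg)
qed auto

lemma K_nonneg: "K v v \<ge> 0"
proof -
  have "(\<Sum>i<n. \<Sum>j<n. d i * of_int (A i j) * nullv i * nullv j * (v i / nullv i - v j / nullv j)\<^sup>2) \<le> 0"
    by (intro sum_nonpos K_sos_term) auto
  then show ?thesis by (subst K_sos) linarith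
qed

text \<open>All terms of \<open>K_sos\<close> vanish, so the ratio \<open>v i / nullv i\<close>
  agrees along every edge of the diagram, which is connected.\<close>

lemma K_zero_null: assumes "supp v" "K v v = 0" shows "\<exists>t. v = t *s nullv"
proof -
  let ?g = "\<lambda>i j. d i * of_int (A i j) * nullv i * nullv j * (v i / nullv i - v j / nullv j)\<^sup>2"
  have "(\<Sum>i<n. \<Sum>j<n. - ?g i j) = 0"
    using assms(2) K_sos[of v] by (simp add: sum_negf)
  then have "\<forall>i<n. (\<Sum>j<n. - ?g i j) = 0"
    by (subst (asm) sum_nonneg_eq_0_iff) (auto intro!: sum_nonneg K_sos_term simp del: minus_mult_left)
  then have z: "i < n \<Longrightarrow> j < n \<Longrightarrow> ?g i j = 0" for i j
  proof -
    assume ij: "i < n" "j < n" and h: "\<forall>i<n. (\<Sum>j<n. - ?g i j) = 0"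
    from h ij have "(\<Sum>j<n. - ?g i j) = 0" by blast
    then have "\<forall>j\<in>{..<n}. - ?g i j = 0"
      by (subst (asm) sum_nonneg_eq_0_iff) (use ij in \<open>auto intro!: K_sos_term simp del: minus_mult_left\<close>)
    with ij show "?g i j = 0" by auto
  qed
  define x where "x i = v i / nullv i" for i
  have adj: "i < n \<Longrightarrow> j < n \<Longrightarrow> A i j \<noteq> 0 \<Longrightarrow> x i = x j" for i j
    using z[of i j] d_pos[of i] nullv(2)[of i] nullv(2)[of j] by (auto simp: x_def)
  have con: "conn_nodes A {..<n}" using aff by (simp add: affine_type_def indecomposable_def)
  have "x i = x 0" if "i < n" for i
  proof (rule ccontr)
    assume ne: "x i \<noteq> x 0"
    let ?S1 = "{j. j < n \<and> x j = x 0}" and ?S2 = "{j. j < n \<and> x j \<noteq> x 0}"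
    have "0 \<in> ?S1" "i \<in> ?S2" using n_pos that ne by auto
    then have "?S1 \<noteq> {}" "?S2 \<noteq> {}" by blast+
    moreover have "?S1 \<union> ?S2 = {..<n}" "?S1 \<inter> ?S2 = {}" by auto
    ultimately have "\<exists>a\<in>?S1. \<exists>b\<in>?S2. A a b \<noteq> 0"
      using con[unfolded conn_nodes_def, THEN spec, THEN spec, of ?S1 ?S2] by simp
    then obtain a b where "a \<in> ?S1" "b \<in> ?S2" "A a b \<noteq> 0" by blast
    then show False using adj[of a b] by auto
  qed
  then have c: "v i = x 0 * nullv i" if "i < n" for i
    using that nullv(2)[OF that] by (metis x_def nonzero_divide_eq_eq less_irrefl)
  have "v = x 0 *s nullv"
    by (rule supported_eqI[of n]) (auto simp: c vs intro: supp_intros assms nullv)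
  then show ?thesis by blast
qed

lemma K_nullv [simp]: "K nullv v = 0" "K v nullv = 0"
proof -
  show "K v nullv = 0" using nullv(3) by (simp add: K_alt)
  then show "K nullv v = 0" by (simp add: K_sym[of nullv v])
qed

lemma K_CS: "(K u v)\<^sup>2 \<le> K u u * K v v"
proof (cases "K v v = 0")
  case True
  have v0: "K u v = 0"
  proof (rule ccontr)
    assume ne: "K u v \<noteq> 0"
    \<comment> \<open>As \<open>K v v = 0\<close>, the norm is affine in \<open>t\<close> along this
      line; this \<open>t\<close> makes it -1.\<close>
    define t where "t = - (K u u + 1) / (2 * K u v)"
    have "K (u + t *s v) (u + t *s v) = K u u + 2 * t * K u v"
      using True by (simp add: K_lin K_sym[of v u] algebra_simps)
    also have "\<dots> = -1" using ne by (simp add: t_def field_simps)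
    finally show False using K_nonneg[of "u + t *s v"] by simp
  qed
  then show ?thesis using True by simp
next
  case False
  then have p: "K v v > 0" using K_nonneg[of v] by simp
  define t where "t = - K u v / K v v"
  have "K (u + t *s v) (u + t *s v) = K u u + 2 * t * K u v + t\<^sup>2 * K v v"
    by (simp add: K_lin K_sym[of v u] algebra_simps power2_eq_square)
  also have "\<dots> = K u u - (K u v)\<^sup>2 / K v v"
    using p by (simp add: t_def field_simps power2_eq_square)
  finally have "K u u - (K u v)\<^sup>2 / K v v \<ge> 0" using K_nonneg[of "u + t *s v"] by simp
  then show ?thesis using p by (simp add: field_simps)
qed

text \<open>A substitute for finite type: a nonzero multiple of \<open>nullv\<close> has no zero
  coordinate, so the form is positive definite on the vectors vanishing at one fixed node.\<close>

lemma K_pos_def: assumes "supp v" "f < n" "v f = 0" "v \<noteq> 0" shows "K v v > 0"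
proof (rule ccontr)
  assume "\<not> ?thesis"
  then have "K v v = 0" using K_nonneg[of v] by simp
  then obtain t where t: "v = t *s nullv" using K_zero_null assms(1) by blast
  with assms(2,3) nullv(2)[of f] have "t = 0" by (auto simp: vs)
  with t assms(4) show False by simp
qed

section \<open>Real roots: integrality, signs, finiteness modulo the null vector\<close>

abbreviation "RR \<equiv> real_roots n A"
abbreviation "pos \<equiv> positive n"

definition tr :: "vec \<Rightarrow> vec \<Rightarrow> vec" where
  "tr b v = v - (2 * K b v / K b b) *s b"

lemma tr_simple: "i < n \<Longrightarrow> tr (simple i) v = s i v"
  using d_pos[of i] by (simp add: tr_def s_eq K_simple cp_simple A_diag)

lemma linv_tr: "linv (tr b)"
  by (auto simp: linv_def tr_def K_lin ptw algebra_simps add_divide_distrib)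

lemma tr_invol: "K b b \<noteq> 0 \<Longrightarrow> tr b (tr b v) = v"
  by (simp add: tr_def K_lin ptw field_simps)

lemma tr_conj: "i < n \<Longrightarrow> tr (s i b) v = s i (tr b (s i v))"
proof -
  assume i: "i < n"
  have "s i (tr b (s i v)) = s i (s i v) - (2 * K b (s i v) / K b b) *s s i b"
    unfolding tr_def linv_diff[OF linv_s] linv_smul[OF linv_s] ..
  also have "K b (s i v) = K (s i b) v" using K_s[OF i, of b "s i v"] s_invol[OF i] by simp
  finally show ?thesis using i by (simp add: tr_def s_invol K_s)
qed

lemma RR_simple: "i < n \<Longrightarrow> simple i \<in> RR"
  by (simp add: real_roots_def simples_def weyl_orbit.base)

lemma RR_s: "r \<in> RR \<Longrightarrow> i < n \<Longrightarrow> s i r \<in> RR"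
  by (simp add: real_roots_def weyl_orbit.step)

lemma RR_induct [consumes 1, case_names base step]:
  assumes "r \<in> RR" and "\<And>i. i < n \<Longrightarrow> P (simple i)"
    and "\<And>r i. r \<in> RR \<Longrightarrow> P r \<Longrightarrow> i < n \<Longrightarrow> P (s i r)"
  shows "P r"
  using assms(1) unfolding real_roots_def
  by (induction rule: weyl_orbit.induct) (auto simp: simples_def real_roots_def intro: assms(2,3))

lemma RR_supp: "r \<in> RR \<Longrightarrow> supp r"
  by (induction rule: RR_induct) (auto intro: supp_intros)

lemma RR_norm: "r \<in> RR \<Longrightarrow> \<exists>j<n. K r r = 2 * d j"
  by (induction rule: RR_induct) (auto simp: K_simple_simple K_s)

lemma RR_norm_pos: "r \<in> RR \<Longrightarrow> K r r > 0" using RR_norm[of r] d_pos by force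

lemma RR_neg: "r \<in> RR \<Longrightarrow> - r \<in> RR"
proof (induction rule: RR_induct)
  case (base i)
  have "s i (simple i) = - simple i" using base by (simp add: s_eq cp_simple A_diag ptw)
  then show ?case using RR_s[OF RR_simple base] base by metis
next
  case (step r i)
  then show ?case using RR_s[of "-r" i] by (simp add: linv_minus[OF linv_s])
qed

text \<open>The reflection in \<open>s i b\<close> is the conjugate by \<open>s i\<close> of the
  reflection in \<open>b\<close>, so the property passes along the orbits of the simple
  roots.\<close>

lemma RR_tr: assumes "b \<in> RR" shows "r \<in> RR \<Longrightarrow> tr b r \<in> RR"
  using assms
proof (induction b arbitrary: r rule: RR_induct)
  case (base i)
  then show ?case by (simp add: tr_simple RR_s)
next
  case (step b i)
  then show ?case by (simp add: tr_conj RR_s)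
qed

lemma simple_int: "simple i j \<in> \<int>" by (simp add: simple_def)

text \<open>The second number is the coordinate of the co-root of \<open>r\<close> at the simple
  co-root \<open>j\<close>. As \<open>K r r\<close> is invariant, \<open>s i\<close> changes only
  the entry at \<open>i\<close>, by an integral combination of co-root coordinates.\<close>

lemma RR_ints: assumes "r \<in> RR"
  shows "j < n \<Longrightarrow> r j \<in> \<int>" "j < n \<Longrightarrow> 2 * d j * r j / K r r \<in> \<int>"
proof -
  have "\<forall>j<n. r j \<in> \<int> \<and> 2 * d j * r j / K r r \<in> \<int>"
    using assms
  proof (induction rule: RR_induct)
    case (base i)
    have "(2 * d j * simple i j) / (2 * d i) \<in> \<int>" for j
      using base d_pos[of i] by (cases "j = i") auto
    moreover have "simple i j \<in> \<int>" for j by (simp add: simple_def)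
    ultimately show ?case using base by (simp add: K_simple_simple)
  next
    case (step r i)
    have c: "cp i r \<in> \<int>" unfolding cpair_def using step.IH by (auto intro!: Ints_sum Ints_mult)
    have "d i * cp i r = (\<Sum>j<n. d j * r j * of_int (A j i))"
      unfolding cpair_def sum_distrib_left
      by (intro sum.cong refl) (use step.hyps d_sym in \<open>auto simp: algebra_simps\<close>)
    then have "2 * d i * cp i r / K r r = (\<Sum>j<n. of_int (A j i) * (2 * d j * r j / K r r))"
      by (simp add: mult.assoc) (simp add: sum_divide_distrib sum_distrib_left mult.commute mult.left_commute)
    also have "\<dots> \<in> \<int>" by (intro Ints_sum Ints_mult Ints_of_int) (use step.IH in simp)
    finally have c2: "2 * d i * cp i r / K r r \<in> \<int>" .
    show ?case
    proof (intro allI impI conjI)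
      fix j assume j: "j < n"
      show "s i r j \<in> \<int>" using c step.IH j by (auto simp: vs s_eq simple_def)
      have sij: "s i r j = r j - (if j = i then cp i r else 0)" by (simp add: s_eq vs simple_def)
      have "2 * d j * s i r j / K (s i r) (s i r) = 2 * d j * r j / K r r - (if j = i then 2 * d i * cp i r / K r r else 0)"
        unfolding K_s[OF step.hyps(2)] sij by (simp add: algebra_simps diff_divide_distrib)
      also have "\<dots> \<in> \<int>" using c2 step.IH j by auto
      finally show "2 * d j * s i r j / K (s i r) (s i r) \<in> \<int>" .
    qed
  qed
  then show "j < n \<Longrightarrow> r j \<in> \<int>" "j < n \<Longrightarrow> 2 * d j * r j / K r r \<in> \<int>" by auto
qed

lemma RR_pair_int: assumes "r \<in> RR" "\<And>j. j < n \<Longrightarrow> v j \<in> \<int>" shows "2 * K r v / K r r \<in> \<int>"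
proof -
  have "2 * K r v / K r r = (\<Sum>i<n. \<Sum>j<n. (2 * d i * r i / K r r) * of_int (A i j) * v j)"
    unfolding Kform_def by (simp add: sum_distrib_left sum_divide_distrib algebra_simps)
  also have "\<dots> \<in> \<int>"
    by (intro Ints_sum Ints_mult RR_ints(2)[OF assms(1)] assms(2) Ints_of_int) auto
  finally show ?thesis .
qed

lemma RR_cp_int: "r \<in> RR \<Longrightarrow> cp i r \<in> \<int>"
  unfolding cpair_def by (intro Ints_sum Ints_mult RR_ints(1) Ints_of_int) auto

lemma K_nonpos_disjoint:
  assumes "i < n" "\<And>j. j < n \<Longrightarrow> y j \<ge> 0" "y i = 0" shows "K (simple i) y \<le> 0"
proof -
  have "cp i y \<le> 0" unfolding cpair_def
  proof (rule sum_nonpos)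
    fix j assume "j \<in> {..<n}"
    then show "of_int (A i j) * y j \<le> 0"
      using assms A_off[of i j] by (cases "j = i") (auto intro!: mult_nonpos_nonneg)
  qed
  then show ?thesis using d_pos[OF assms(1)] assms(1) by (simp add: K_simple mult_nonneg_nonpos)
qed

lemma Ints_ge_1: "(x::real) \<in> \<int> \<Longrightarrow> x > 0 \<Longrightarrow> x \<ge> 1"
  by (auto elim!: Ints_cases)

text \<open>\<open>m\<close> is integral as a root coordinate and \<open>1 / m\<close> as a co-root
  coordinate.\<close>

lemma RR_multiple_simple: assumes "m *s simple i \<in> RR" "i < n" "m > 0" shows "m = 1"
proof -
  have "m \<in> \<int>" using RR_ints(1)[OF assms(1,2)] by (simp add: vs)
  then have "m \<ge> 1" using assms(3) by (rule Ints_ge_1)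
  have "1 / m \<in> \<int>" using RR_ints(2)[OF assms(1,2)] d_pos[OF assms(2)] assms
    by (simp add: vs K_lin K_simple_simple)
  then have "1 / m \<ge> 1" using assms(3) by (intro Ints_ge_1) auto
  then show ?thesis using \<open>m \<ge> 1\<close> by (simp add: field_simps)
qed

text \<open>If a negative coefficient appeared, the pairings of the reflected root with its positive and
  negative parts would both be 1, forcing the coefficient of the co-root at i to be a proper
  fraction.\<close>
lemma RR_s_pos_or_simple: assumes "r \<in> RR" "pos r" "i < n" shows "pos (s i r) \<or> r = simple i"
proof (rule ccontr)
  assume a: "\<not> ?thesis"
  define q where "q = s i r"
  have qRR: "q \<in> RR" using assms by (simp add: q_def RR_s)
  have qj: "q j = r j" if "j \<noteq> i" for j using that by (simp add: vs q_def s_eq)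
  define m where "m = - q i"
  have m0: "m > 0"
    using a assms(2) qj unfolding m_def q_def[symmetric] positive_def by (metis neg_0_less_iff_less not_le)
  define y where "y = q + m *s simple i"
  have yi: "y i = 0" by (simp add: vs y_def m_def)
  have y0: "\<And>j. j < n \<Longrightarrow> y j \<ge> 0"
    using qj yi assms(2) by (auto simp: vs y_def positive_def simple_def m_def)
  have q_eq: "q = y - m *s simple i" by (simp add: y_def)
  have sy: "supp y" using RR_supp[OF qRR] assms by (auto simp: y_def intro!: supp_intros)
  have mint: "m \<in> \<int>" using RR_ints(1)[OF qRR assms(3)] by (simp add: m_def)
  show False
  proof (cases "y = 0")
    case True
    then have "q = - (m *s simple i)" by (simp add: q_eq)
    then have "r = m *s simple i"
      using s_invol[OF assms(3), of r] assms(3)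
      by (simp add: q_def[symmetric] linv_minus[OF linv_s] linv_smul[OF linv_s])
         (simp add: s_eq cp_simple A_diag ptw)
    moreover from this have "m = 1" using RR_multiple_simple assms m0 by blast
    ultimately show False using a by simp
  next
    case False
    define t where "t = K q q / 2"
    have t: "t > 0" using RR_norm_pos[OF qRR] by (simp add: t_def)
    have Kyy: "K y y > 0" using K_pos_def[OF sy assms(3) yi False] .
    have Kyi: "K (simple i) y \<le> 0" by (rule K_nonpos_disjoint) (fact assms(3), fact y0, fact yi)
    have yint: "\<And>j. j < n \<Longrightarrow> y j \<in> \<int>"
      using RR_ints(1)[OF qRR] mint by (auto simp: vs y_def simple_def)
    have i1: "K q y / t \<in> \<int>" using RR_pair_int[OF qRR, of y] yint by (simp add: t_def mult.commute)
    have i2: "K q (simple i) / t \<in> \<int>"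
      using RR_pair_int[OF qRR, of "simple i"] simple_int by (simp add: t_def mult.commute)
    have "K q y = K y y - m * K (simple i) y" by (simp add: q_eq K_lin)
    then have "K q y > 0" using Kyy Kyi m0 mult_nonneg_nonpos[of m "K (simple i) y"] by simp
    then have g1: "K q y / t \<ge> 1" using i1 t by (intro Ints_ge_1) auto
    have e2: "K q (simple i) = K (simple i) y - 2 * m * d i"
      using assms(3) by (simp add: q_eq K_lin K_simple_simple K_sym[of y])
    moreover have "2 * m * d i > 0" using m0 d_pos[OF assms(3)] by simp
    ultimately have "- K q (simple i) > 0" using Kyi by linarith
    then have g2: "- (K q (simple i) / t) \<ge> 1" using i2 t
      by (intro Ints_ge_1) (auto simp: divide_neg_pos)
    have "K q q = K q y - m * K q (simple i)"
      using lin_diff[OF lin_K, of q y "m *s simple i"] by (simp add: q_eq[symmetric] K_lin)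
    then have sum2: "K q y / t + m * - (K q (simple i) / t) = 2" using t by (simp add: t_def field_simps)
    have m1: "m \<ge> 1" using mint m0 by (rule Ints_ge_1)
    have "m * - (K q (simple i) / t) \<ge> - (K q (simple i) / t)"
      using mult_right_mono[OF m1, of "- (K q (simple i) / t)"] g2 by linarith
    with sum2 g1 g2 have "- (K q (simple i) / t) = 1" "m * - (K q (simple i) / t) = 1" by linarith+
    then have "m = 1" and Kqi: "- K q (simple i) = t" using t by (auto simp: field_simps)
    then have "t \<ge> 2 * d i" using e2 Kyi by simp
    then have frac: "d i / t > 0" "d i / t \<le> 1 / 2" using d_pos[OF assms(3)] t by (auto simp: field_simps)
    have "2 * d i * q i / K q q \<in> \<int>" using RR_ints(2)[OF qRR assms(3)] .
    then have "d i / t \<in> \<int>" using \<open>m = 1\<close> by (simp add: m_def t_def mult.commute)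
    then have "d i / t \<ge> 1" using frac(1) by (rule Ints_ge_1)
    with frac(2) show False by linarith
  qed
qed

lemma RR_sign: "r \<in> RR \<Longrightarrow> pos r \<or> pos (- r)"
proof (induction rule: RR_induct)
  case (base i)
  then show ?case by (simp add: positive_def simple_def)
next
  case (step r i)
  have neg: "s i (simple i) = - simple i" using step by (simp add: s_eq cp_simple A_diag ptw)
  from step.IH show ?case
  proof
    assume "pos r"
    with RR_s_pos_or_simple[OF step.hyps(1) _ step.hyps(2)] show ?thesis
      using neg by (auto simp: vs positive_def simple_def)
  next
    assume "pos (- r)"
    with RR_s_pos_or_simple[OF RR_neg[OF step.hyps(1)] _ step.hyps(2)]
    have "pos (s i (-r)) \<or> - r = simple i" by blast
    then show ?thesis
    proof
      assume "- r = simple i"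
      then have "r = - simple i" by (metis minus_minus)
      then show ?thesis using neg by (simp add: linv_minus[OF linv_s] vs positive_def simple_def)
    qed (simp add: linv_minus[OF linv_s])
  qed
qed

lemma RR_nonzero: "r \<in> RR \<Longrightarrow> r \<noteq> 0" using RR_norm_pos[of r] by (auto simp: K_lin)

lemma RR_pos_ex: assumes "r \<in> RR" "pos r" shows "\<exists>j<n. r j > 0"
proof (rule ccontr)
  assume "\<not> ?thesis"
  then have "r = 0" using assms(2) RR_supp[OF assms(1)]
    by (intro supported_eqI[of n]) (fastforce simp: zero_fun_apply supported_zero positive_def not_less)+
  then show False using RR_nonzero assms by blast
qed

lemma RR_pos_of_coord: "r \<in> RR \<Longrightarrow> j < n \<Longrightarrow> r j > 0 \<Longrightarrow> pos r"
  using RR_sign[of r] by (force simp: vs positive_def)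

lemma RR_s_pos: "r \<in> RR \<Longrightarrow> pos r \<Longrightarrow> i < n \<Longrightarrow> r \<noteq> simple i \<Longrightarrow> pos (s i r)"
  using RR_s_pos_or_simple by blast

lemma RR_multiple: "r \<in> RR \<Longrightarrow> m *s r \<in> RR \<Longrightarrow> m > 0 \<Longrightarrow> m = 1"
proof (induction rule: RR_induct)
  case (base i)
  then show ?case using RR_multiple_simple by blast
next
  case (step r i)
  have "s i (m *s s i r) = m *s r" using step.hyps by (simp add: linv_smul[OF linv_s] s_invol)
  then show ?case using step RR_s by metis
qed

lemma null_coord_bound_finite: "finite {v. \<forall>i. v i \<in> (if i < n then {x \<in> \<int>. \<bar>x\<bar> \<le> (B::real)} else {0})}"
proof -
  have "finite {x \<in> \<int>. \<bar>x\<bar> \<le> B}" by (rule finite_abs_int_segment)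
  then have "finite {v. \<forall>i. (i \<in> {..<n} \<longrightarrow> v i \<in> {x \<in> \<int>. \<bar>x\<bar> \<le> B}) \<and> (i \<notin> {..<n} \<longrightarrow> v i = 0)}"
    by (intro finite_set_of_finite_funs) auto
  then show ?thesis by (rule rev_finite_subset) (force split: if_splits)
qed

text \<open>By \<open>cp_vec_eqD\<close> this records a vector modulo \<open>nullv\<close>.\<close>

definition cp_vec :: "vec \<Rightarrow> vec" where "cp_vec r = (\<lambda>i. if i < n then cp i r else 0)"

text \<open>The pairings with the simple co-roots are integers, and Cauchy-Schwarz bounds them
  because every real root has norm \<open>2 * d j\<close> for some \<open>j\<close>.\<close>

lemma finite_cp_vec: "finite (cp_vec ` RR)"
proof -
  define D where "D = Max (d ` {..<n})"
  define m where "m = Min (d ` {..<n})"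
  have D: "i < n \<Longrightarrow> d i \<le> D" for i unfolding D_def by (intro Max_ge) auto
  have m: "i < n \<Longrightarrow> m \<le> d i" for i unfolding m_def by (intro Min_le) auto
  have m0: "m > 0" using n_pos d_pos unfolding m_def by (subst Min_gr_iff) auto
  have "\<bar>cp i r\<bar> \<le> 2 * D / m" if r: "r \<in> RR" and i: "i < n" for r i
  proof -
    obtain j where j: "j < n" "K r r = 2 * d j" using RR_norm[OF r] by blast
    have "(K (simple i) r)\<^sup>2 \<le> (2 * d i) * (2 * d j)" using K_CS[of "simple i" r] i j by (simp add: K_simple_simple)
    also have "\<dots> \<le> (2 * D) * (2 * D)" using D[OF i] D[OF j(1)] d_pos[OF i] d_pos[OF j(1)] by (intro mult_mono) auto
    finally have "(K (simple i) r)\<^sup>2 \<le> (2 * D)\<^sup>2" by (simp add: power2_eq_square)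
    then have "\<bar>K (simple i) r\<bar>\<^sup>2 \<le> (2 * D)\<^sup>2" by simp
    then have "\<bar>K (simple i) r\<bar> \<le> 2 * D"
      by (rule power2_le_imp_le) (use D[OF i] d_pos[OF i] in auto)
    then have "d i * \<bar>cp i r\<bar> \<le> 2 * D" using i d_pos[OF i] by (simp add: K_simple abs_mult)
    moreover have "m * \<bar>cp i r\<bar> \<le> d i * \<bar>cp i r\<bar>" using m[OF i] by (intro mult_right_mono) auto
    ultimately show ?thesis using m0 by (simp add: field_simps)
  qed
  then have "cp_vec ` RR \<subseteq> {v. \<forall>i. v i \<in> (if i < n then {x \<in> \<int>. \<bar>x\<bar> \<le> 2 * D / m} else {0})}"
    using RR_cp_int by (auto simp: cp_vec_def)
  then show ?thesis using null_coord_bound_finite finite_subset by blast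
qed

lemma cp_vec_eqD: assumes "supp u" "supp v" "cp_vec u = cp_vec v" shows "\<exists>t. u = v + t *s nullv"
proof -
  have "cp i (u - v) = 0" if "i < n" for i
    using fun_cong[OF assms(3), of i] that by (simp add: cp_vec_def cp_lin)
  then have "K (u - v) (u - v) = 0" unfolding K_alt by simp
  then obtain t where "u - v = t *s nullv" using K_zero_null assms(1,2) supported_diff by blast
  then show ?thesis by (metis add.commute diff_add_cancel)
qed

lemma cp_vec_eqI: "u = v + t *s nullv \<Longrightarrow> cp_vec u = cp_vec v"
  by (auto simp: cp_vec_def cp_lin nullv(3))

text \<open>A class modulo \<open>nullv\<close> contains at most one vector with a prescribed
  coordinate at \<open>f\<close>.\<close>

lemma finite_RR_zero: assumes "f < n" shows "finite {r \<in> RR. r f = 0}"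
proof (rule inj_on_finite[of cp_vec _ "cp_vec ` RR"])
  show "inj_on cp_vec {r \<in> RR. r f = 0}"
  proof (rule inj_onI)
    fix r q assume a: "r \<in> {r \<in> RR. r f = 0}" "q \<in> {r \<in> RR. r f = 0}" "cp_vec r = cp_vec q"
    then obtain t where t: "r = q + t *s nullv" using cp_vec_eqD RR_supp by blast
    then have "r f = q f + t * nullv f" by (simp add: vs)
    then have "t = 0" using a nullv(2)[OF assms] by simp
    then show "r = q" using t by simp
  qed
qed (auto simp: finite_cp_vec)

section \<open>Coxeter elements and the Euler form\<close>

text \<open>Products over arbitrary lists are needed because the induction on parabolic subsystems
  rotates and shortens the list.\<close>

primrec cL :: "nat list \<Rightarrow> vec \<Rightarrow> vec" where
  "cL [] v = v"
| "cL (i # L) v = s i (cL L v)"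

text \<open>The summation order is the one for which the two compatibility degrees of positive roots become
  multiples of \<open>EL [0..<n] a b\<close> and \<open>EL [0..<n] b a\<close>.\<close>
primrec EL :: "nat list \<Rightarrow> vec \<Rightarrow> vec \<Rightarrow> real" where
  "EL [] u v = 0"
| "EL (i # L) u v = d i * u i * v i + (\<Sum>j\<in>set L. d j * of_int (A j i) * u j) * v i + EL L u v"

lemma cL_append: "cL (L @ M) v = cL L (cL M v)"
  by (induction L) auto

lemma linv_cL: "linv (cL L)"
proof (induction L)
  case Nil
  show ?case by (simp add: linv_def)
next
  case (Cons i L)
  then show ?case unfolding linv_def
    by (simp add: linv_add[OF linv_s] linv_smul[OF linv_s])
qed

lemma cL_rev: "set L \<subseteq> {..<n} \<Longrightarrow> cL L (cL (rev L) v) = v"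
  by (induction L arbitrary: v) (auto simp: cL_append s_invol)

lemma cL_rev2: "set L \<subseteq> {..<n} \<Longrightarrow> cL (rev L) (cL L v) = v"
  using cL_rev[of "rev L" v] by simp

lemma cL_coord: "i \<notin> set L \<Longrightarrow> cL L v i = v i"
  by (induction L) (auto simp: s_eq vs)

lemma cL_supp: "set L \<subseteq> {..<n} \<Longrightarrow> supp v \<Longrightarrow> supp (cL L v)"
  by (induction L) (auto intro: supp_intros)

lemma cL_RR: "set L \<subseteq> {..<n} \<Longrightarrow> v \<in> RR \<Longrightarrow> cL L v \<in> RR"
  by (induction L) (auto intro: RR_s)

lemma cL_K: "set L \<subseteq> {..<n} \<Longrightarrow> K (cL L u) (cL L v) = K u v"
  by (induction L) (auto simp: K_s)

lemma s_nullv: "i < n \<Longrightarrow> s i (t *s nullv) = t *s nullv"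
  by (simp add: s_eq cp_lin nullv(3))

lemma cL_nullv: "set L \<subseteq> {..<n} \<Longrightarrow> cL L (t *s nullv) = t *s nullv"
  by (induction L) (auto simp: s_nullv)

lemma cL_foldr: "foldr (\<lambda>i f. s i \<circ> f) L id = cL L"
proof (induction L)
  case (Cons i L)
  then show ?case by (simp add: comp_def)
qed (simp add: id_def)

lemma lin_EL2: "lin (EL L u)"
  by (induction L) (auto simp: lin_def vs algebra_simps)

lemma lin_EL1: "lin (\<lambda>u. EL L u v)"
proof (induction L)
  case (Cons i L)
  then show ?case
    by (auto simp: lin_def vs algebra_simps sum.distrib sum_distrib_left sum_distrib_right)
qed (simp add: lin_def)

lemmas EL_lin = lin_add[OF lin_EL2] lin_smul[OF lin_EL2] lin_diff[OF lin_EL2] lin_minus[OF lin_EL2] lin_zero[OF lin_EL2]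
  lin_add[OF lin_EL1] lin_smul[OF lin_EL1] lin_diff[OF lin_EL1] lin_minus[OF lin_EL1] lin_zero[OF lin_EL1]

lemma EL_cong: "(\<And>j. j \<in> set L \<Longrightarrow> u j = u' j) \<Longrightarrow> (\<And>j. j \<in> set L \<Longrightarrow> v j = v' j) \<Longrightarrow> EL L u v = EL L u' v'"
  by (induction L) auto

text \<open>\<open>EL\<close> peels off the head of the list; rotating the head to the end also
  requires peeling off the last entry.\<close>

lemma EL_snoc: "EL (L @ [i]) u v = EL L u v + d i * u i * v i + d i * u i * (\<Sum>j\<in>set L. of_int (A i j) * v j)"
  if "distinct (L @ [i])"
  using that
proof (induction L)
  case (Cons k L)
  then have "i \<notin> set L" "k \<notin> set L" by auto
  then have 1: "(\<Sum>j\<in>set (L @ [i]). d j * of_int (A j k) * u j) = (\<Sum>j\<in>set L. d j * of_int (A j k) * u j) + d i * of_int (A i k) * u i"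
    by simp
  have 2: "(\<Sum>j\<in>set (k # L). of_int (A i j) * v j) = of_int (A i k) * v k + (\<Sum>j\<in>set L. of_int (A i j) * v j)"
    using \<open>k \<notin> set L\<close> by simp
  have IH: "EL (L @ [i]) u v = EL L u v + d i * u i * v i + d i * u i * (\<Sum>j\<in>set L. of_int (A i j) * v j)"
    using Cons by simp
  show ?case unfolding append_Cons EL.simps 1 2 IH by (simp add: algebra_simps)
qed simp

lemma cp_J: assumes "J \<subseteq> {..<n}" "\<And>j. j < n \<Longrightarrow> j \<notin> J \<Longrightarrow> v j = 0"
  shows "cp i v = (\<Sum>j\<in>J. of_int (A i j) * v j)"
  unfolding cpair_def using assms by (intro sum.mono_neutral_right) auto

text \<open>A numerical reflection functor: moving the head of the list to its end is compensated by
  applying \<open>s i\<close> to both arguments. The vanishing assumptions allow \<open>cp i\<close>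
  to be computed inside the list.\<close>

lemma EL_rotate:
  assumes "distinct (i # L)" "set (i # L) \<subseteq> {..<n}"
    "\<And>j. j < n \<Longrightarrow> j \<notin> set (i # L) \<Longrightarrow> u j = 0" "\<And>j. j < n \<Longrightarrow> j \<notin> set (i # L) \<Longrightarrow> v j = 0"
  shows "EL (i # L) u v = EL (L @ [i]) (s i u) (s i v)"
proof -
  have i: "i < n" "i \<notin> set L" "distinct (L @ [i])" "set L \<subseteq> {..<n}" using assms by auto
  define mu where "mu = (\<Sum>j\<in>set L. of_int (A i j) * u j)"
  define mv where "mv = (\<Sum>j\<in>set L. of_int (A i j) * v j)"
  have "cp i u = (\<Sum>j\<in>set (i # L). of_int (A i j) * u j)" by (rule cp_J) (use assms in auto)
  then have cu: "cp i u = 2 * u i + mu" using i by (simp add: mu_def A_diag)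
  have "cp i v = (\<Sum>j\<in>set (i # L). of_int (A i j) * v j)" by (rule cp_J) (use assms in auto)
  then have cv: "cp i v = 2 * v i + mv" using i by (simp add: mv_def A_diag)
  have su: "s i u i = - u i - mu" "s i v i = - v i - mv" by (auto simp: s_eq vs cu cv)
  have so: "s i u j = u j" "s i v j = v j" if "j \<noteq> i" for j using that by (auto simp: s_eq vs)
  have E0: "EL L (s i u) (s i v) = EL L u v" using i by (intro EL_cong so) auto
  have mv': "(\<Sum>j\<in>set L. of_int (A i j) * s i v j) = mv"
    unfolding mv_def by (rule sum.cong[OF HOL.refl]) (use i(2) so(2) in metis)
  have "(\<Sum>j\<in>set L. d j * of_int (A j i) * u j) = d i * mu"
    unfolding mu_def sum_distrib_left
  proof (rule sum.cong[OF HOL.refl])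
    fix j assume "j \<in> set L"
    then have "d j * of_int (A j i) = d i * of_int (A i j)" using i by (intro d_sym) auto
    then show "d j * of_int (A j i) * u j = d i * (of_int (A i j) * u j)" by (simp add: mult.assoc)
  qed
  then have "EL (i # L) u v = d i * u i * v i + d i * mu * v i + EL L u v" by simp
  also have "\<dots> = EL (L @ [i]) (s i u) (s i v)"
    unfolding EL_snoc[OF i(3)] E0 mv' su by (simp add: algebra_simps)
  finally show ?thesis .
qed

lemma EL_sym: "distinct L \<Longrightarrow> set L \<subseteq> {..<n} \<Longrightarrow>
  EL L u v + EL L v u = (\<Sum>i\<in>set L. \<Sum>j\<in>set L. u i * d i * of_int (A i j) * v j)"
proof (induction L)
  case (Cons i L)
  then have i: "i < n" "i \<notin> set L" by auto
  have 1: "(\<Sum>j\<in>set L. d j * of_int (A j i) * v j) * u i = (\<Sum>j\<in>set L. u i * d i * of_int (A i j) * v j)"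
    unfolding sum_distrib_right
  proof (rule sum.cong[OF HOL.refl])
    fix j assume "j \<in> set L"
    then have "d j * of_int (A j i) = d i * of_int (A i j)" using i Cons by (intro d_sym) auto
    then show "d j * of_int (A j i) * v j * u i = u i * d i * of_int (A i j) * v j" by simp
  qed
  have "EL (i # L) u v + EL (i # L) v u = u i * d i * 2 * v i
      + (\<Sum>j\<in>set L. d j * of_int (A j i) * u j) * v i + (\<Sum>j\<in>set L. d j * of_int (A j i) * v j) * u i
      + (\<Sum>i\<in>set L. \<Sum>j\<in>set L. u i * d i * of_int (A i j) * v j)"
    using Cons by (simp add: algebra_simps)
  also have "\<dots> = (\<Sum>k\<in>set (i # L). \<Sum>j\<in>set (i # L). u k * d k * of_int (A k j) * v j)"
  proof -
    have "(\<Sum>k\<in>set L. \<Sum>j\<in>set (i # L). u k * d k * of_int (A k j) * v j)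
      = (\<Sum>k\<in>set L. u k * d k * of_int (A k i) * v i) + (\<Sum>k\<in>set L. \<Sum>j\<in>set L. u k * d k * of_int (A k j) * v j)"
      using i by (simp add: sum.distrib)
    moreover have "(\<Sum>k\<in>set L. u k * d k * of_int (A k i) * v i) = (\<Sum>j\<in>set L. d j * of_int (A j i) * u j) * v i"
      unfolding sum_distrib_right by (rule sum.cong) auto
    ultimately show ?thesis unfolding 1 using i by (simp add: A_diag)
  qed
  finally show ?case .
qed simp

lemma EL_K: assumes "distinct L" "set L \<subseteq> {..<n}"
    "\<And>j. j < n \<Longrightarrow> j \<notin> set L \<Longrightarrow> u j = 0" "\<And>j. j < n \<Longrightarrow> j \<notin> set L \<Longrightarrow> v j = 0"
  shows "EL L u v + EL L v u = K u v"
proof -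
  have "K u v = (\<Sum>i\<in>set L. \<Sum>j<n. u i * d i * of_int (A i j) * v j)"
    unfolding Kform_def by (rule sum.mono_neutral_right) (use assms in auto)
  also have "\<dots> = (\<Sum>i\<in>set L. \<Sum>j\<in>set L. u i * d i * of_int (A i j) * v j)"
    by (intro sum.cong HOL.refl sum.mono_neutral_right) (use assms in auto)
  finally show ?thesis using EL_sym[OF assms(1,2)] by simp
qed

text \<open>The form of \<open>E (v - c v) u = K v u\<close> that an induction on the list can
  prove. The coordinate of \<open>v - cL (i # L) v\<close> at \<open>i\<close> is
  \<open>cp i (cL L v)\<close>, and its difference from \<open>cp i v\<close> gives exactly the
  cross term between \<open>i\<close> and \<open>L\<close> in \<open>EL\<close>.\<close>

lemma EL_cox: "distinct L \<Longrightarrow> set L \<subseteq> {..<n} \<Longrightarrow>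
  EL L (v - cL L v) u = (\<Sum>j\<in>set L. d j * u j * cp j v)"
proof (induction L)
  case (Cons i L)
  then have i: "i < n" "i \<notin> set L" by auto
  define w where "w = v - cL L v"
  define m where "m = cp i (cL L v)"
  have w0: "w j = 0" if "j \<notin> set L" for j using that by (simp add: w_def vs cL_coord)
  have eq: "v - cL (i # L) v = w + m *s simple i"
    by (simp add: w_def m_def s_eq)
  have "(\<Sum>j\<in>set L. d j * of_int (A j i) * (w + m *s simple i) j) = (\<Sum>j\<in>set L. d i * (of_int (A i j) * w j))"
  proof (rule sum.cong[OF HOL.refl])
    fix j assume j: "j \<in> set L"
    then have "d j * of_int (A j i) = d i * of_int (A i j)" using i Cons by (intro d_sym) auto
    moreover have "(w + m *s simple i) j = w j" using j i by (auto simp: vs simple_def)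
    ultimately show "d j * of_int (A j i) * (w + m *s simple i) j = d i * (of_int (A i j) * w j)" by simp
  qed
  also have "\<dots> = d i * cp i w" unfolding sum_distrib_left[symmetric]
    using cp_J[of "set L" w i] Cons.prems w0 by auto
  finally have 1: "(\<Sum>j\<in>set L. d j * of_int (A j i) * (w + m *s simple i) j) = d i * cp i w" .
  have 2: "(w + m *s simple i) i = m" using w0[OF i(2)] by (simp add: vs)
  have 3: "EL L (w + m *s simple i) u = EL L w u"
    using i by (intro EL_cong) (auto simp: vs simple_def)
  have 4: "EL L w u = (\<Sum>j\<in>set L. d j * u j * cp j v)" unfolding w_def using Cons by simp
  have mw: "cp i v = m + cp i w" by (simp add: m_def w_def cp_lin)
  have "EL (i # L) (v - cL (i # L) v) u = d i * u i * cp i v + (\<Sum>j\<in>set L. d j * u j * cp j v)"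
    unfolding eq EL.simps 1 2 3 4 mw by (simp add: algebra_simps)
  then show ?case using i by simp
qed simp

section \<open>The Euler form of the Coxeter element\<close>

abbreviation "E \<equiv> EL [0..<n]"
abbreviation "c \<equiv> cox n A"
abbreviation "ci \<equiv> cox_inv n A"

lemma c_eq: "c = cL [0..<n]" unfolding cox_def by (rule cL_foldr)
lemma ci_eq: "ci = cL (rev [0..<n])" unfolding cox_inv_def by (rule cL_foldr)

lemma c_ci: "c (ci v) = v" "ci (c v) = v"
  using cL_rev[of "[0..<n]" v] cL_rev2[of "[0..<n]" v] by (auto simp: c_eq ci_eq atLeast0LessThan)

lemma linv_c: "linv c" "linv ci" by (simp_all add: c_eq ci_eq linv_cL)
lemma c_supp: "supp v \<Longrightarrow> supp (c v)" "supp v \<Longrightarrow> supp (ci v)" by (auto simp: c_eq ci_eq intro!: cL_supp)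
lemma c_RR: "r \<in> RR \<Longrightarrow> c r \<in> RR" "r \<in> RR \<Longrightarrow> ci r \<in> RR" by (auto simp: c_eq ci_eq intro!: cL_RR)
lemma c_K: "K (c u) (c v) = K u v" "K (ci u) (ci v) = K u v" unfolding c_eq ci_eq by (rule cL_K, auto)+
lemma c_null: "c (t *s nullv) = t *s nullv" unfolding c_eq by (rule cL_nullv) auto
lemma c_inj: "c u = c v \<longleftrightarrow> u = v" by (metis c_ci(2))

lemma E_K: "E u v + E v u = K u v" by (rule EL_K) auto

lemma E_diff: "E (v - c v) u = K v u"
  using EL_cox[of "[0..<n]" v u] by (simp add: c_eq K_sym[of v u] K_alt[of u v] atLeast0LessThan mult_ac)

text \<open>Numerical Serre duality:
  \<open>E v u - E (c v) u = K v u = E v u + E u v\<close>.\<close>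

lemma E_c: "E u v = - E (c v) u"
  using E_diff[of v u] E_K[of u v] by (simp add: EL_lin K_sym[of v u])

lemma E_cc: "E (c u) (c v) = E u v"
  using E_c[of u v] E_c[of "c v" u] by simp

lemma c_fixed: assumes "supp v" "c v = v" shows "\<exists>t. v = t *s nullv"
proof -
  have "K v v = 0" using E_diff[of v v] assms(2) by (simp add: EL_lin)
  then show ?thesis using K_zero_null assms(1) by blast
qed

lemma E_null_anti: "E nullv v = - E v nullv" using E_K[of nullv v] by simp

text \<open>Rotating the letters of \<open>M\<close> past the end one at a time makes
  \<open>cL M\<close> adjoint to its inverse, up to the change of list.\<close>

lemma EL_shift: assumes "distinct (M @ L)" "set (M @ L) = {..<n}"
  shows "EL (M @ L) (cL M u) v = EL (L @ M) u (cL (rev M) v)"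
  using assms
proof (induction M arbitrary: L v)
  case (Cons i M)
  have "EL (i # (M @ L)) (s i (cL M u)) v = EL ((M @ L) @ [i]) (s i (s i (cL M u))) (s i v)"
    by (rule EL_rotate) (use Cons.prems in auto)
  also have "s i (s i (cL M u)) = cL M u" using Cons.prems by (intro s_invol) auto
  also have "EL ((M @ L) @ [i]) (cL M u) (s i v) = EL (M @ (L @ [i])) (cL M u) (s i v)" by simp
  also have "\<dots> = EL ((L @ [i]) @ M) u (cL (rev M) (s i v))"
    by (rule Cons.IH) (use Cons.prems in auto)
  finally show ?case by (simp add: cL_append)
qed simp

text \<open>\<open>Pr\<close> and \<open>In\<close> are modelled on dimension vectors of
  indecomposable projective and injective representations: by \<open>E_Pr\<close> and
  \<open>E_In\<close> they represent the coordinate at \<open>e\<close>, scaled by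
  \<open>d e\<close>, on the two sides of \<open>E\<close>.\<close>

definition Pr :: "nat \<Rightarrow> vec" where "Pr e = cL [0..<e] (simple e)"
definition In :: "nat \<Rightarrow> vec" where "In e = cL (rev [Suc e..<n]) (simple e)"

lemma upt_split: "e < n \<Longrightarrow> [0..<n] = [0..<e] @ e # [Suc e..<n]"
  using upt_add_eq_append[of 0 e "n - e"] upt_conv_Cons[of e n] by simp

lemma EL_head: "i \<notin> set L \<Longrightarrow> EL (i # L) (simple i) v = d i * v i"
proof -
  assume i: "i \<notin> set L"
  have "(\<Sum>j\<in>set L. d j * of_int (A j i) * simple i j) = 0"
    using i by (intro sum.neutral) (auto simp: simple_def)
  moreover have "EL L (simple i) v = EL L 0 v" using i by (intro EL_cong) (auto simp: simple_def vs)
  ultimately show ?thesis by (simp add: EL_lin)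
qed

lemma EL_last: "distinct (L @ [i]) \<Longrightarrow> EL (L @ [i]) u (simple i) = d i * u i"
proof -
  assume i: "distinct (L @ [i])"
  have "(\<Sum>j\<in>set L. of_int (A i j) * simple i j) = 0"
    using i by (intro sum.neutral) (auto simp: simple_def)
  moreover have "EL L u (simple i) = EL L u 0" using i by (intro EL_cong) (auto simp: simple_def vs)
  ultimately show ?thesis using EL_snoc[OF i, of u "simple i"] by (simp add: EL_lin)
qed

lemma E_Pr: "e < n \<Longrightarrow> E (Pr e) v = d e * v e"
proof -
  assume e: "e < n"
  have "E (Pr e) v = EL ([0..<e] @ e # [Suc e..<n]) (cL [0..<e] (simple e)) v"
    unfolding Pr_def upt_split[OF e] ..
  also have "\<dots> = EL ((e # [Suc e..<n]) @ [0..<e]) (simple e) (cL (rev [0..<e]) v)"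
    by (rule EL_shift) (use e in \<open>auto simp del: upt_Suc\<close>)
  also have "\<dots> = d e * cL (rev [0..<e]) v e" unfolding append_Cons by (rule EL_head) auto
  also have "\<dots> = d e * v e" by (simp add: cL_coord)
  finally show ?thesis .
qed

lemma E_In: "e < n \<Longrightarrow> E u (In e) = d e * u e"
proof -
  assume e: "e < n"
  have "E u (In e) = EL (([0..<e] @ [e]) @ [Suc e..<n]) u (cL (rev [Suc e..<n]) (simple e))"
    unfolding In_def upt_split[OF e] by simp
  also have "\<dots> = EL ([Suc e..<n] @ ([0..<e] @ [e])) (cL [Suc e..<n] u) (simple e)"
    by (rule EL_shift[symmetric]) (use e in \<open>auto simp del: upt_Suc\<close>)
  also have "\<dots> = EL (([Suc e..<n] @ [0..<e]) @ [e]) (cL [Suc e..<n] u) (simple e)" by simp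
  also have "\<dots> = d e * cL [Suc e..<n] u e" by (rule EL_last) auto
  also have "\<dots> = d e * u e" by (simp add: cL_coord)
  finally show ?thesis .
qed

lemma Pr_RR: "e < n \<Longrightarrow> Pr e \<in> RR" unfolding Pr_def by (rule cL_RR) (auto intro: RR_simple)
lemma Pr_coord: "Pr e e = 1" by (simp add: Pr_def cL_coord)
lemma Pr_pos: "e < n \<Longrightarrow> pos (Pr e)" using RR_pos_of_coord[OF Pr_RR, of e e] by (simp add: Pr_coord)

text \<open>A simple reflection makes a positive root negative only if that root is the simple root
  itself, so a loss of sign is traced to a step where the partial product equals the next simple
  root.\<close>

lemma cL_pos_or:
  assumes "r \<in> RR" "pos r"
  shows "set L \<subseteq> {..<n} \<Longrightarrow> pos (cL L r) \<or> (\<exists>L1 i L2. L = L1 @ i # L2 \<and> cL L2 r = simple i)"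
proof (induction L)
  case (Cons i L)
  then consider "pos (cL L r)" | "\<exists>L1 i L2. L = L1 @ i # L2 \<and> cL L2 r = simple i" by auto
  then show ?case
  proof cases
    case 1
    show ?thesis
    proof (cases "cL L r = simple i")
      case True
      then have "i # L = [] @ i # L \<and> cL L r = simple i" by simp
      then show ?thesis by blast
    next
      case False
      then show ?thesis using RR_s_pos[OF cL_RR 1] Cons.prems assms by simp
    qed
  next
    case 2
    then show ?thesis by (metis append_Cons)
  qed
qed (simp add: assms)

lemma upt_eq_split: "[0..<n] = L1 @ i # L2 \<Longrightarrow> i < n \<and> L1 = [0..<i] \<and> L2 = [Suc i..<n]"
proof -
  assume a: "[0..<n] = L1 @ i # L2"
  have l: "length L1 < n" using arg_cong[OF a, of length] by simp
  have "[0..<n] ! length L1 = i" by (simp add: a)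
  then have i: "length L1 = i" using l by simp
  have "L1 = take i [0..<n]" using a i by simp
  then have 1: "L1 = [0..<i]" using l i by (simp add: take_upt)
  have "i # L2 = drop i [0..<n]" using a i by simp
  then have "i # L2 = [i..<n]" by simp
  then have "L2 = [Suc i..<n]" using l i by (simp add: upt_conv_Cons[of i n])
  with 1 show ?thesis using l i by simp
qed

text \<open>The positive roots sent to negative ones are among the \<open>In i\<close> for
  \<open>c\<close> and among the \<open>Pr i\<close> for \<open>ci\<close>. Their values under
  \<open>E nullv\<close> are \<open>d i * nullv i\<close> up to sign, hence nonzero.\<close>

lemma c_pos: assumes "r \<in> RR" "pos r" "E nullv r = 0" shows "pos (c r)" "pos (ci r)"
proof -
  show "pos (c r)"
  proof (rule ccontr)
    assume "\<not> pos (c r)"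
    then obtain L1 i L2 where h: "[0..<n] = L1 @ i # L2" "cL L2 r = simple i"
      using cL_pos_or[OF assms(1,2), of "[0..<n]"] by (auto simp: c_eq atLeast0LessThan)
    then have i: "i < n" "L2 = [Suc i..<n]" using upt_eq_split by auto
    have "r = cL (rev L2) (cL L2 r)" by (rule cL_rev2[symmetric]) (use i in auto)
    then have "r = In i" using h i by (simp add: In_def)
    then show False using E_In[OF i(1), of nullv] assms(3) d_pos[OF i(1)] nullv(2)[OF i(1)] by simp
  qed
  show "pos (ci r)"
  proof (rule ccontr)
    assume "\<not> pos (ci r)"
    then obtain L1 i L2 where h: "rev [0..<n] = L1 @ i # L2" "cL L2 r = simple i"
      using cL_pos_or[OF assms(1,2), of "rev [0..<n]"] by (auto simp: ci_eq atLeast0LessThan)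
    from arg_cong[OF h(1), of rev] have "[0..<n] = rev L2 @ i # rev L1" by simp
    then have i: "i < n" "rev L2 = [0..<i]" using upt_eq_split by auto
    have "r = cL (rev L2) (cL L2 r)"
      by (rule cL_rev2[symmetric]) (use i in \<open>auto simp flip: set_rev[of L2]\<close>)
    then have "r = Pr i" using h i by (simp add: Pr_def)
    then show False using E_Pr[OF i(1), of nullv] assms(3) d_pos[OF i(1)] nullv(2)[OF i(1)]
      by (simp add: E_null_anti)
  qed
qed

end

section \<open>Simple systems as minimal generators of cones\<close>

lemma nonneg_span_step: "a \<ge> 0 \<Longrightarrow> q \<in> S \<Longrightarrow> z \<in> nonneg_span S \<Longrightarrow> a *s q + z \<in> nonneg_span S"
  by (rule nonneg_span_add[OF nonneg_span_smul[OF nonneg_span_base]])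

lemma nonneg_span_split:
  assumes "y \<in> nonneg_span B" "b \<in> B"
  obtains a z where "a \<ge> 0" "z \<in> nonneg_span (B - {b})" "y = a *s b + z"
proof -
  from assms(1) have "\<exists>a z. a \<ge> 0 \<and> z \<in> nonneg_span (B - {b}) \<and> y = a *s b + z"
  proof (induction rule: nonneg_span_induct)
    case zero
    show ?case by (rule exI[of _ 0], rule exI[of _ 0]) (simp add: nonneg_span_zero)
  next
    case (step x q w)
    then obtain a z where h: "a \<ge> 0" "z \<in> nonneg_span (B - {b})" "w = a *s b + z" by blast
    show ?case
    proof (cases "q = b")
      case True
      then have "x *s q + w = (x + a) *s b + z" using h by (simp add: smul_add_left)
      then show ?thesis using h step by (metis add_nonneg_nonneg)
    next
      case False
      then have "x *s q + w = a *s b + (x *s q + z)" using h by simp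
      moreover have "x *s q + z \<in> nonneg_span (B - {b})"
        using h step False by (intro nonneg_span_step) auto
      ultimately show ?thesis using h by metis
    qed
  qed
  then show ?thesis using that by blast
qed

lemma nonneg_span_ge: assumes "z \<in> nonneg_span B" "lin g" "\<And>b. b \<in> B \<Longrightarrow> g b \<ge> 0" shows "g z \<ge> 0"
  using assms(1)
proof (induction rule: nonneg_span_induct)
  case zero
  show ?case using lin_zero[OF assms(2)] by simp
next
  case (step a q w)
  then show ?case using assms(3)[of q] lin_add[OF assms(2)] lin_smul[OF assms(2)] by simp
qed

text \<open>Applying \<open>g\<close> forces \<open>a < 1\<close>, so the equation can be solved for
  \<open>r\<close>.\<close>

lemma nonneg_span_absorb:
  assumes "r = a *s r + w" "w \<in> nonneg_span B" "lin g" "g r > 0" "g w > 0" "a \<ge> 0"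
  shows "r \<in> nonneg_span B"
proof -
  have "g r = a * g r + g w" using arg_cong[OF assms(1), of g] lin_add[OF assms(3)] lin_smul[OF assms(3)] by metis
  then have "(1 - a) * g r > 0" using assms(5) by (simp add: algebra_simps)
  then have a: "1 - a > 0" using assms(4) by (simp add: zero_less_mult_iff)
  have "r - a *s r = w" using assms(1) by (metis add_diff_cancel_left')
  then have "(1 - a) *s r = w" by (simp add: smul_diff_left)
  then have "r = (1 / (1 - a)) *s w" using a by auto
  then show ?thesis using nonneg_span_smul[OF assms(2), of "1 / (1 - a)"] a by simp
qed

context affine begin

text \<open>A minimal generating subset is obtuse: if \<open>K p q > 0\<close>, then
  \<open>q - m *s p\<close> or its negative lies in \<open>R\<close>, and expanding it makes
  \<open>q\<close> or \<open>p\<close> a combination of the other generators. The functional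
  \<open>g\<close> rules out that the root's own coefficient in the expansion makes this
  trivial.\<close>

lemma base_exists:
  assumes fin: "finite F" and FR: "F \<subseteq> R" and RF: "R \<subseteq> nonneg_span F" and g: "lin g"
    and gpos: "\<And>r. r \<in> R \<Longrightarrow> g r > 0"
    and cl: "\<And>p r. p \<in> F \<Longrightarrow> r \<in> F \<Longrightarrow> p \<noteq> r \<Longrightarrow> K p r > 0 \<Longrightarrow> \<exists>m>0. r - m *s p \<in> R \<or> m *s p - r \<in> R"
  shows "\<exists>B. B \<subseteq> F \<and> R \<subseteq> nonneg_span B \<and> (\<forall>p\<in>B. \<forall>q\<in>B. p \<noteq> q \<longrightarrow> K p q \<le> 0) \<and>
    (\<forall>b\<in>B. b \<notin> nonneg_span (B - {b}))"
proof -
  let ?X = "{B. B \<subseteq> F \<and> F \<subseteq> nonneg_span B}"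
  have "finite ?X" using fin by simp
  have "F \<in> ?X" using nonneg_span_base by blast
  then have "?X \<noteq> {}" by blast
  with \<open>finite ?X\<close> have "\<exists>m\<in>?X. \<forall>b\<in>?X. b \<le> m \<longrightarrow> m = b" by (rule finite_has_minimal)
  then obtain B where B: "B \<in> ?X" and Bm: "\<forall>b\<in>?X. b \<le> B \<longrightarrow> B = b" by (rule bexE)
  have Bmin: "B' = B" if "B' \<in> ?X" "B' \<subseteq> B" for B' using bspec[OF Bm that(1)] that(2) by simp
  have RB: "R \<subseteq> nonneg_span B" using RF B nonneg_span_trans by blast
  have ext: "b \<notin> nonneg_span (B - {b})" if b: "b \<in> B" for b
  proof
    assume a: "b \<in> nonneg_span (B - {b})"
    have "B \<subseteq> nonneg_span (B - {b})" using a nonneg_span_base[of _ "B - {b}"] by blast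
    then have "F \<subseteq> nonneg_span (B - {b})" using B nonneg_span_trans by blast
    then have "B - {b} \<in> ?X" using B by blast
    then have "B - {b} = B" using Bmin by blast
    then show False using b by blast
  qed
  have gB: "b \<in> B \<Longrightarrow> g b > 0" for b using B FR gpos by blast
  have gz: "z \<in> nonneg_span B' \<Longrightarrow> B' \<subseteq> B \<Longrightarrow> g z \<ge> 0" for z B'
    using nonneg_span_ge[OF _ g] gB by (meson less_eq_real_def subsetD)
  have neg: "K p q \<le> 0" if pq: "p \<in> B" "q \<in> B" "p \<noteq> q" for p q
  proof (rule ccontr)
    assume "\<not> ?thesis"
    then obtain m where m: "m > 0" "q - m *s p \<in> R \<or> m *s p - q \<in> R"
      using cl[of p q] pq B by force
    from m(2) show False
    proof
      assume "q - m *s p \<in> R"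
      then obtain a z where az: "a \<ge> 0" "z \<in> nonneg_span (B - {q})" "q - m *s p = a *s q + z"
        using nonneg_span_split[of "q - m *s p" B q] RB pq by blast
      have "q = a *s q + (m *s p + z)" using az(3) by (metis diff_eq_eq add.assoc add.commute)
      moreover have "m *s p + z \<in> nonneg_span (B - {q})"
        using az pq m by (intro nonneg_span_step) auto
      moreover have "g (m *s p + z) > 0"
        using gB[OF pq(1)] m gz[OF az(2)] lin_add[OF g] lin_smul[OF g] by (simp add: add_pos_nonneg)
      ultimately have "q \<in> nonneg_span (B - {q})" using nonneg_span_absorb[OF _ _ g gB] az pq by blast
      then show False using ext pq by blast
    next
      assume "m *s p - q \<in> R"
      then obtain a z where az: "a \<ge> 0" "z \<in> nonneg_span (B - {p})" "m *s p - q = a *s p + z"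
        using nonneg_span_split[of "m *s p - q" B p] RB pq by blast
      have "m *s p = a *s p + (q + z)" using az(3) by (metis diff_eq_eq add.assoc add.commute)
      then have "(1 / m) *s (m *s p) = (1 / m) *s (a *s p + (q + z))" by simp
      moreover have "(1 / m) *s (m *s p) = p" using m by simp
      ultimately have "p = (a / m) *s p + (1 / m) *s (q + z)"
        unfolding smul_add_right[of "1/m" "a *s p"] by (metis smul_smul mult.commute times_divide_eq_right mult_1_right)
      moreover have "(1 / m) *s (q + z) \<in> nonneg_span (B - {p})"
        using nonneg_span_smul[OF nonneg_span_step[of 1 q "B - {p}" z], of "1/m"] az pq m by auto
      moreover have "g ((1 / m) *s (q + z)) > 0"
        using gB[OF pq(2)] m gz[OF az(2)] lin_add[OF g] lin_smul[OF g] by (simp add: add_pos_nonneg)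
      ultimately have "p \<in> nonneg_span (B - {p})" using nonneg_span_absorb[OF _ _ g gB] az pq m by fastforce
      then show False using ext pq by blast
    qed
  qed
  show ?thesis by (rule exI[of _ B]) (use B RB neg ext in simp)
qed

text \<open>Separating positive and negative coefficients of a relation writes one vector in two
  ways with disjoint supports. Obtuseness makes its norm nonpositive, so it is zero by
  \<open>nf\<close>, and \<open>g\<close> then kills every coefficient.\<close>

lemma base_indep:
  assumes fin: "finite B" and g: "lin g" and gpos: "\<And>b. b \<in> B \<Longrightarrow> g b > 0"
    and neg: "\<And>p q. p \<in> B \<Longrightarrow> q \<in> B \<Longrightarrow> p \<noteq> q \<Longrightarrow> K p q \<le> 0"
    and nf: "\<And>z. z \<in> nonneg_span B \<Longrightarrow> K z z = 0 \<Longrightarrow> z = 0"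
    and z: "lin_comb B a = 0"
  shows "b \<in> B \<Longrightarrow> a b = 0"
proof -
  define p where "p q = max (a q) 0" for q
  define m where "m q = max (- a q) 0" for q
  have a: "a q = p q - m q" "p q \<ge> 0" "m q \<ge> 0" "p q * m q = 0" for q by (auto simp: p_def m_def max_def)
  have "lin_comb B p = lin_comb B a + lin_comb B m" by (simp add: lin_comb_add a(1))
  then have eq: "lin_comb B p = lin_comb B m" using z by simp
  have zero: "lin_comb B p = 0"
  proof (rule nf)
    show "lin_comb B p \<in> nonneg_span B" by (rule lin_comb_nonneg_span) (use fin a in auto)
    have "K (lin_comb B p) (lin_comb B m) = (\<Sum>x\<in>B. \<Sum>y\<in>B. m x * (p y * K y x))"
      unfolding lin_comb_lin[OF lin_K] lin_comb_lin[OF lin_K2] by (simp add: sum_distrib_left)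
    also have "\<dots> \<le> 0"
    proof (intro sum_nonpos)
      fix x y assume xy: "x \<in> B" "y \<in> B"
      show "m x * (p y * K y x) \<le> 0"
      proof (cases "x = y")
        case True
        have "m x * (p x * K x x) = (p x * m x) * K x x" by simp
        then show ?thesis using True a(4)[of x] by auto
      next
        case False
        then show ?thesis using neg[of y x] xy a(2,3) by (simp add: mult_nonneg_nonpos)
      qed
    qed
    finally show "K (lin_comb B p) (lin_comb B p) = 0" using eq K_nonneg[of "lin_comb B p"] by simp
  qed
  have "(\<Sum>q\<in>B. p q * g q) = 0" using lin_comb_lin[OF g, of B p] zero lin_zero[OF g] by simp
  then have P: "\<forall>q\<in>B. p q * g q = 0"
    using sum_nonneg_eq_0_iff[OF fin, of "\<lambda>q. p q * g q"] a(2) gpos by (simp add: less_imp_le)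
  have "(\<Sum>q\<in>B. m q * g q) = 0" using lin_comb_lin[OF g, of B m] zero eq lin_zero[OF g] by simp
  then have M: "\<forall>q\<in>B. m q * g q = 0"
    using sum_nonneg_eq_0_iff[OF fin, of "\<lambda>q. m q * g q"] a(3) gpos by (simp add: less_imp_le)
  assume b: "b \<in> B"
  then show "a b = 0" using bspec[OF P b] bspec[OF M b] gpos[OF b] a(1)[of b] by auto
qed

section \<open>Periodicity of the Coxeter element modulo the null vector\<close>

lemma linv_cpow: "linv (c ^^ k)" using linv_c(1) by (rule linv_funpow)
lemma cpow_RR: "r \<in> RR \<Longrightarrow> (c ^^ k) r \<in> RR" by (induction k) (auto intro: c_RR)
lemma cpow_supp: "supp r \<Longrightarrow> supp ((c ^^ k) r)" by (induction k) (auto intro: c_supp)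
lemma cpow_null: "(c ^^ k) (t *s nullv) = t *s nullv" by (induction k) (auto simp: c_null)
lemma cpow_inj: "(c ^^ k) u = (c ^^ k) v \<longleftrightarrow> u = v" by (induction k) (auto simp: c_inj)

text \<open>The orbit meets only finitely many classes modulo \<open>nullv\<close>, and
  \<open>c\<close> fixes \<open>nullv\<close>.\<close>

lemma c_period: assumes "r \<in> RR" shows "\<exists>N>0. \<exists>t. (c ^^ N) r = r + t *s nullv"
proof -
  let ?f = "\<lambda>k. cp_vec ((c ^^ k) r)"
  have "finite (range ?f)" by (rule finite_subset[OF _ finite_cp_vec]) (use cpow_RR assms in blast)
  then have "\<not> inj ?f" using finite_imageD infinite_UNIV_nat by blast
  then obtain a' b' where "a' \<noteq> b'" "?f a' = ?f b'" by (auto simp: inj_def)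
  then obtain a b where ab: "a < b" "?f b = ?f a" by (metis linorder_neqE_nat)
  obtain t where "(c ^^ b) r = (c ^^ a) r + t *s nullv"
    using cp_vec_eqD[OF _ _ ab(2)] cpow_supp RR_supp[OF assms] by blast
  moreover have "(c ^^ b) r = (c ^^ a) ((c ^^ (b - a)) r)"
    using ab(1) funpow_add[of a "b - a" c] by simp
  moreover have "(c ^^ a) r + t *s nullv = (c ^^ a) (r + t *s nullv)"
    by (simp add: linv_add[OF linv_cpow] cpow_null)
  ultimately have "(c ^^ (b - a)) r = r + t *s nullv" using cpow_inj by metis
  then show ?thesis using ab(1) by (metis zero_less_diff)
qed

lemma E_cpow_null: "E ((c ^^ k) r) nullv = E r nullv"
  by (induction k) (auto, metis E_cc c_null smul_one)

lemma c_orbit_sum: "c (\<Sum>l<N. (c ^^ l) r) - (\<Sum>l<N. (c ^^ l) r) = (c ^^ N) r - r"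
proof -
  have "c (\<Sum>l<N. (c ^^ l) r) = (\<Sum>l<N. (c ^^ Suc l) r)" by (simp add: linv_sum[OF linv_c(1)])
  then show ?thesis using sum_lessThan_telescope[of "\<lambda>l. (c ^^ l) r" N] by (simp add: sum_subtractf)
qed

lemma E_null_null: "E nullv nullv = 0" using E_K[of nullv nullv] by simp

text \<open>If the translation part were zero, the orbit sum would be fixed by \<open>c\<close>,
  hence a multiple of \<open>nullv\<close> and \<open>E\<close>-orthogonal to it; but its value
  against \<open>nullv\<close> is \<open>N * E r nullv\<close>.\<close>

lemma c_period_nonzero: assumes "r \<in> RR" "E r nullv \<noteq> 0"
  shows "\<exists>N>0. \<exists>t. t \<noteq> 0 \<and> (c ^^ N) r = r + t *s nullv"
proof -
  obtain N t where h: "N > 0" "(c ^^ N) r = r + t *s nullv" using c_period[OF assms(1)] by blast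
  have "t \<noteq> 0"
  proof
    assume "t = 0"
    let ?w = "\<Sum>l<N. (c ^^ l) r"
    have "c ?w = ?w" using c_orbit_sum[of r N] h \<open>t = 0\<close> by simp
    then obtain x where x: "?w = x *s nullv"
      using c_fixed[of ?w] by (auto intro: supported_sum cpow_supp RR_supp[OF assms(1)])
    have "E ?w nullv = real N * E r nullv" by (simp add: lin_sum[OF lin_EL1] E_cpow_null)
    moreover have "E ?w nullv = 0" by (simp add: x EL_lin E_null_null)
    ultimately show False using h(1) assms(2) by simp
  qed
  then show ?thesis using h by blast
qed

lemma level_simple: "E (simple 0) nullv \<noteq> 0"
  using E_Pr[OF n_pos, of nullv] d_pos[OF n_pos] nullv(2)[OF n_pos] by (simp add: Pr_def)

section \<open>Imaginary roots and \<delta>\<close>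

definition intnull :: "vec set" where
  "intnull = {v. \<exists>t>0. v = t *s nullv \<and> (\<forall>i<n. v i \<in> \<int>)}"

text \<open>Some multiple of \<open>nullv\<close> has to be integral. The difference of two roots in
  one orbit of \<open>c\<close> is an integral vector, and \<open>c_period_nonzero\<close> provides
  such a difference that is a nonzero multiple of \<open>nullv\<close>.\<close>

lemma intnull_ex: "intnull \<noteq> {}"
proof -
  obtain N t where h: "t \<noteq> 0" "(c ^^ N) (simple 0) = simple 0 + t *s nullv"
    using c_period_nonzero[OF RR_simple[OF n_pos] level_simple] by blast
  have i: "(t *s nullv) i \<in> \<int>" if "i < n" for i
  proof -
    have "(t *s nullv) i = (c ^^ N) (simple 0) i - simple 0 i" by (simp add: h(2) vs)
    then show ?thesis using RR_ints(1)[OF cpow_RR[OF RR_simple[OF n_pos]] that] simple_int by simp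
  qed
  show ?thesis
  proof (cases "t > 0")
    case True
    then have "t *s nullv \<in> intnull" using i by (auto simp: intnull_def)
    then show ?thesis by blast
  next
    case False
    have "((-t) *s nullv) j \<in> \<int>" if "j < n" for j
      using Ints_minus[OF i[OF that]] by (simp add: vs)
    moreover have "- t > 0" using False h(1) by simp
    ultimately have "(-t) *s nullv \<in> intnull" unfolding intnull_def by blast
    then show ?thesis by blast
  qed
qed

lemma intnull_min: obtains z where "z \<in> intnull" "\<And>b. b \<in> intnull \<Longrightarrow> \<exists>k::nat. k \<ge> 1 \<and> b = real k *s z"
proof -
  define f where "f v = nat \<lfloor>v 0\<rfloor>" for v :: vec
  obtain z where z: "z \<in> intnull" and zm: "\<And>b. b \<in> intnull \<Longrightarrow> f z \<le> f b"
    using ex_has_least_nat[of "\<lambda>v. v \<in> intnull" _ f] intnull_ex by blast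
  obtain tz where tz: "tz > 0" "z = tz *s nullv" "\<forall>i<n. z i \<in> \<int>" using z by (auto simp: intnull_def)
  have z0: "z 0 > 0" "z 0 \<in> \<int>" using tz nullv(2) n_pos by (auto simp: vs)
  have "\<exists>k::nat. k \<ge> 1 \<and> b = real k *s z" if b: "b \<in> intnull" for b
  proof -
    obtain tb where tb: "tb > 0" "b = tb *s nullv" "\<forall>i<n. b i \<in> \<int>" using b by (auto simp: intnull_def)
    define k where "k = \<lfloor>tb / tz\<rfloor>"
    \<comment> \<open>The remainder of \<open>b\<close> on division by \<open>z\<close>; if it were
      nonzero, its coordinate at 0 would undercut the minimal one.\<close>
    define y where "y = b - real_of_int k *s z"
    have yn: "y = (tb - real_of_int k * tz) *s nullv" by (simp add: y_def tb(2) tz(2) smul_diff_left)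
    have yint: "\<forall>i<n. y i \<in> \<int>" using tb(3) tz(3) by (auto simp: y_def vs)
    have k: "real_of_int k \<le> tb / tz" "tb / tz < real_of_int k + 1" by (auto simp: k_def)
    have kt: "real_of_int k * tz \<le> tb" "tb < (real_of_int k + 1) * tz"
      using k tz(1) by (auto simp: field_simps)
    have "tb = real_of_int k * tz"
    proof (rule ccontr)
      assume "tb \<noteq> real_of_int k * tz"
      then have "tb - real_of_int k * tz > 0" using kt by simp
      then have yi: "y \<in> intnull" using yn yint unfolding intnull_def by blast
      have "y 0 < z 0" unfolding yn tz(2) smul_apply
        using kt nullv(2)[OF n_pos] by (intro mult_strict_right_mono) (auto simp: algebra_simps)
      moreover have "y 0 > 0" unfolding yn smul_apply
        using kt \<open>tb - real_of_int k * tz > 0\<close> nullv(2)[OF n_pos] by simp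
      moreover obtain p where "y 0 = of_int p" using yint n_pos by (auto elim: Ints_cases)
      moreover obtain q where "z 0 = of_int q" using z0 by (auto elim: Ints_cases)
      ultimately have "f y < f z" by (auto simp: f_def)
      with zm[OF yi] show False by simp
    qed
    moreover have "k \<ge> 1"
    proof -
      have "real_of_int k * tz > 0" using calculation tb(1) by simp
      then show ?thesis using tz(1) by (simp add: zero_less_mult_iff)
    qed
    ultimately show ?thesis using tb(2) tz(2) by (intro exI[of _ "nat k"]) auto
  qed
  then show ?thesis using that z by blast
qed

text \<open>Nonnegative coordinates with nonpositive pairings give \<open>K a a \<le> 0\<close>, so
  semidefiniteness leaves only multiples of \<open>nullv\<close>.\<close>

lemma fund_set_eq: "fund_set n A = intnull"
proof
  show "fund_set n A \<subseteq> intnull"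
  proof
    fix a assume "a \<in> fund_set n A"
    then have a: "supp a" "\<And>i. i < n \<Longrightarrow> a i \<in> \<int> \<and> a i \<ge> 0" "\<exists>i<n. a i \<noteq> 0" "\<And>i. i < n \<Longrightarrow> cp i a \<le> 0"
      by (auto simp: fund_set_def)
    have "K a a \<le> 0" unfolding K_alt
      by (intro sum_nonpos mult_nonneg_nonpos mult_nonneg_nonneg) (use a in \<open>auto intro: less_imp_le[OF d_pos]\<close>)
    then have "K a a = 0" using K_nonneg[of a] by simp
    then obtain t where t: "a = t *s nullv" using K_zero_null a(1) by blast
    obtain i where i: "i < n" "a i \<noteq> 0" using a(3) by blast
    then have "a i > 0" using a(2)[of i] by simp
    then have "t > 0" using nullv(2)[OF i(1)] unfolding t smul_apply by (simp add: zero_less_mult_iff)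
    then show "a \<in> intnull" using t a(2) by (auto simp: intnull_def)
  qed
  show "intnull \<subseteq> fund_set n A"
  proof
    fix a assume "a \<in> intnull"
    then obtain t where t: "t > 0" "a = t *s nullv" "\<forall>i<n. a i \<in> \<int>" by (auto simp: intnull_def)
    have p: "i < n \<Longrightarrow> a i > 0" for i using t(1) nullv(2)[of i] by (simp add: t(2) vs)
    have ne: "{i. i < n \<and> a i \<noteq> 0} = {..<n}" using p by force
    have con: "conn_nodes A {..<n}" using aff by (simp add: affine_type_def indecomposable_def)
    have cp0: "i < n \<Longrightarrow> cp i a = 0" for i using nullv(3)[of i] by (simp add: t(2) cp_lin)
    have sa: "supp a" unfolding t(2) by (intro supp_intros nullv)
    show "a \<in> fund_set n A" unfolding fund_set_def mem_Collect_eq ne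
      using sa t(3) p cp0 con n_pos by (auto intro: less_imp_le) (metis less_irrefl)
  qed
qed

lemma pos_imag_eq: "pos_imag_roots n A = intnull"
proof -
  have "v \<in> intnull" if "v \<in> weyl_orbit n A intnull" for v
    using that
  proof (induction rule: weyl_orbit.induct)
    case (step v i)
    then obtain t where "v = t *s nullv" by (auto simp: intnull_def)
    then show ?case using step s_nullv by metis
  qed
  then show ?thesis unfolding pos_imag_roots_def fund_set_eq by (auto intro: weyl_orbit.base)
qed

abbreviation "dl \<equiv> delta n A"

lemma dl_char: "dl \<in> intnull" "b \<in> intnull \<Longrightarrow> \<exists>k::nat. k \<ge> 1 \<and> b = real k *s dl"
proof -
  obtain z where z: "z \<in> intnull" "\<And>b. b \<in> intnull \<Longrightarrow> \<exists>k::nat. k \<ge> 1 \<and> b = real k *s z"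
    using intnull_min by blast
  have "dl = z" unfolding delta_def pos_imag_eq
  proof (rule the_equality)
    show "z \<in> intnull \<and> (\<forall>b\<in>intnull. \<exists>k::nat. 1 \<le> k \<and> b = real k *s z)" using z by blast
    fix y assume y: "y \<in> intnull \<and> (\<forall>b\<in>intnull. \<exists>k::nat. 1 \<le> k \<and> b = real k *s y)"
    obtain k where k: "k \<ge> 1" "y = real k *s z" using z(2) y by blast
    obtain l where l: "l \<ge> 1" "z = real l *s y" using z(1) y by blast
    have pos: "z 0 > 0" using z(1) nullv(2)[OF n_pos] by (auto simp: intnull_def vs)
    have "z 0 = real l * (real k * z 0)" using l(2) k(2) by (metis smul_apply)
    then have "real (l * k) = 1" using pos by simp
    then have "l * k = 1" by (metis of_nat_eq_1_iff)
    then show "y = z" using k by simp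
  qed
  then show "dl \<in> intnull" "b \<in> intnull \<Longrightarrow> \<exists>k::nat. k \<ge> 1 \<and> b = real k *s dl" using z by auto
qed

lemma dl_null: obtains t where "t > 0" "dl = t *s nullv" using dl_char(1) by (auto simp: intnull_def)

lemma nullv_dl: "\<exists>t>0. nullv = t *s dl"
proof -
  obtain t where "t > 0" "dl = t *s nullv" by (rule dl_null)
  then show ?thesis by (intro exI[of _ "1 / t"]) auto
qed

lemma dl_supp: "supp dl" by (rule dl_null) (auto intro!: supp_intros nullv)
lemma dl_pos: "i < n \<Longrightarrow> dl i > 0" by (rule dl_null) (auto simp: vs nullv)
lemma K_dl [simp]: "K dl v = 0" "K v dl = 0" by (rule dl_null, auto simp: K_lin)+
lemma c_dl: "c dl = dl" by (rule dl_null) (auto simp: c_null)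
lemma s_dl: "i < n \<Longrightarrow> s i dl = dl" by (rule dl_null) (auto simp: s_nullv)
lemma cL_dl: "set L \<subseteq> {..<n} \<Longrightarrow> cL L dl = dl" by (rule dl_null) (auto simp: cL_nullv)
lemma cp_vec_eq_dl: assumes "supp u" "supp v" "cp_vec u = cp_vec v" shows "\<exists>t. u = v + t *s dl"
  using cp_vec_eqD[OF assms] nullv_dl by (metis smul_smul)
lemma cp_vec_eq_dlI: "cp_vec (v + t *s dl) = cp_vec v"
  by (rule dl_null) (simp add: cp_vec_eqI)
lemma c_fixed_dl: assumes "supp v" "c v = v" shows "\<exists>t. v = t *s dl"
  using c_fixed[OF assms] nullv_dl by (metis smul_smul)
lemma c_pos_dl: assumes "r \<in> RR" "pos r" "E dl r = 0" shows "pos (c r)" "pos (ci r)"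
proof -
  obtain t where "t > 0" "nullv = t *s dl" using nullv_dl by blast
  then have "E nullv r = 0" using assms(3) by (simp add: EL_lin)
  then show "pos (c r)" "pos (ci r)" using c_pos assms by blast+
qed
lemma E_dl_anti: "E dl v = - E v dl" using E_K[of dl v] by simp
lemma E_dl_dl: "E dl dl = 0" using E_dl_anti[of dl] by simp
lemma E_dl_c: "E dl (c v) = E dl v" using E_cc[of dl v] by (simp add: c_dl)
lemma E_dl_ci: "E dl (ci v) = E dl v" using E_dl_c[of "ci v"] by (simp add: c_ci)
lemma dl_not_RR: "t *s dl \<notin> RR" using RR_norm_pos[of "t *s dl"] by (auto simp: K_lin)

lemma gamma_char: assumes "af < n"
  shows "gamma_c n A af \<in> Vfin n af" "c (gamma_c n A af) = gamma_c n A af + dl"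
proof -
  obtain N t where h: "t \<noteq> 0" "(c ^^ N) (simple 0) = simple 0 + t *s nullv"
    using c_period_nonzero[OF RR_simple[OF n_pos] level_simple] by blast
  obtain x where x: "x > 0" "nullv = x *s dl" using nullv_dl by blast
  define w where "w = (\<Sum>l<N. (c ^^ l) (simple 0))"
  \<comment> \<open>The orbit sum satisfies \<open>c w - w = (t * x) *s dl\<close>, so after this
    rescaling \<open>c\<close> translates by exactly \<open>dl\<close>. The correction in
    \<open>g\<close> is harmless because \<open>c\<close> fixes \<open>dl\<close>.\<close>
  define y where "y = (1 / (t * x)) *s w"
  define g where "g = y - (y af / dl af) *s dl"
  have sw: "supp w" unfolding w_def by (intro supported_sum cpow_supp supported_simple n_pos)
  have "c w - w = (t * x) *s dl" using c_orbit_sum[of "simple 0" N] h x by (simp add: w_def)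
  then have "(1 / (t * x)) *s (c w - w) = dl" using h(1) x(1) by simp
  then have cy: "c y - y = dl" unfolding y_def by (simp add: linv_smul[OF linv_c(1)] smul_diff_right)
  have "c g - g = c y - y" unfolding g_def by (simp add: linv_diff[OF linv_c(1)] linv_smul[OF linv_c(1)] c_dl)
  then have cg: "c g = g + dl" using cy by (metis add.commute diff_add_cancel)
  have sg: "supp g" unfolding g_def y_def by (intro supp_intros sw dl_supp)
  have "g af = 0" using dl_pos[OF assms] by (simp add: g_def vs)
  then have gV: "g \<in> Vfin n af" using sg by (simp add: Vfin_def)
  have "gamma_c n A af = g" unfolding gamma_c_def
  proof (rule the_equality)
    have va: "vadd u v = u + v" for u v :: vec by (simp add: vadd_def ptw)
    show "g \<in> Vfin n af \<and> c g = vadd g dl" using gV cg by (simp add: va)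
    fix u assume "u \<in> Vfin n af \<and> c u = vadd u dl"
    then have u: "supp u" "u af = 0" "c u = u + dl" by (auto simp: Vfin_def va)
    have "c (u - g) = u - g" by (simp add: linv_diff[OF linv_c(1)] u(3) cg)
    then obtain z where z: "u - g = z *s dl" using c_fixed_dl supported_diff[OF u(1) sg] by blast
    have "(u - g) af = 0" using u(2) \<open>g af = 0\<close> by (simp add: vs)
    then have "z = 0" using z dl_pos[OF assms] by (simp add: vs)
    then show "u = g" using z by simp
  qed
  then show "gamma_c n A af \<in> Vfin n af" "c (gamma_c n A af) = gamma_c n A af + dl" using gV cg by auto
qed

text \<open>By \<open>E_diff\<close>, pairing with \<open>gamma_c\<close> is the functional
  \<open>- E dl\<close>, because \<open>c\<close> translates \<open>gamma_c\<close> by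
  \<open>dl\<close>.\<close>

lemma U_c_eq: assumes "af < n" shows "v \<in> U_c n A d af \<longleftrightarrow> E dl v = 0"
proof -
  let ?g = "gamma_c n A af"
  have "?g - c ?g = - dl" using gamma_char(2)[OF assms] by simp
  then have "K ?g v = - E dl v" using E_diff[of ?g v] by (simp add: EL_lin)
  then show ?thesis by (simp add: U_c_def)
qed

section \<open>Compatibility degrees in terms of the Euler form\<close>

lemma E_sums: "EL [0..<m] u v = (\<Sum>i<m. d i * u i * v i) + (\<Sum>i<m. \<Sum>j<i. d i * u i * (of_int (A i j) * v j))"
proof (induction m)
  case (Suc m)
  have "EL [0..<Suc m] u v = EL [0..<m] u v + d m * u m * v m + d m * u m * (\<Sum>j<m. of_int (A m j) * v j)"
    using EL_snoc[of "[0..<m]" m u v] by (simp add: atLeast0LessThan)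
  then show ?case using Suc by (simp add: sum_distrib_left)
qed simp

lemma pos_coord: "pos v \<Longrightarrow> j < n \<Longrightarrow> pos_part (v j) = v j" by (simp add: positive_def pos_part_def)

text \<open>Positivity removes the truncations \<open>pos_part\<close>, and the co-root coordinates
  are \<open>2 * a i * d i / K a a\<close>. The left degree sums over the opposite triangle; moving
  \<open>d\<close> across by symmetrizability exchanges the two arguments of
  \<open>E\<close>.\<close>

lemma cdeg_formula:
  assumes "a \<in> RR" "pos a" "pos b"
  shows "cdeg_right n A d a b = - (2 / K a a) * E a b" "cdeg_left n A d a b = - (2 / K a a) * E b a"
proof -
  define k where "k = 2 / K a a"
  have k: "k > 0" using RR_norm_pos[OF assms(1)] by (simp add: k_def)
  have cc: "ccoord n A d a i = k * a i * d i" for i using assms(1) by (simp add: ccoord_def k_def)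
  have pp: "pos_part (ccoord n A d a i) = k * a i * d i" if "i < n" for i
  proof -
    have "k * a i * d i \<ge> 0" using k assms(2) d_pos[OF that] that by (simp add: positive_def)
    then show ?thesis by (simp add: cc pos_part_def)
  qed
  have s1: "(\<Sum>i<n. ccoord n A d a i * b i) = k * (\<Sum>i<n. d i * a i * b i)"
    unfolding cc sum_distrib_left by (intro sum.cong HOL.refl) simp
  have s2: "(\<Sum>i<n. \<Sum>j<i. of_int (A i j) * pos_part (ccoord n A d a i) * pos_part (b j))
     = k * (\<Sum>i<n. \<Sum>j<i. d i * a i * (of_int (A i j) * b j))"
    unfolding sum_distrib_left by (intro sum.cong HOL.refl) (simp add: pp pos_coord[OF assms(3)])
  show "cdeg_right n A d a b = - (2 / K a a) * E a b"
    unfolding cdeg_right_def s1 s2 E_sums k_def[symmetric] by (simp add: algebra_simps)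
  have "(\<Sum>i<n. \<Sum>j\<in>{i<..<n}. of_int (A i j) * pos_part (ccoord n A d a i) * pos_part (b j))
     = (\<Sum>i<n. \<Sum>j\<in>{i<..<n}. k * (d j * b j * (of_int (A j i) * a i)))"
  proof (intro sum.cong HOL.refl)
    fix i j assume ij: "i \<in> {..<n}" "j \<in> {i<..<n}"
    then have "d i * of_int (A i j) = d j * of_int (A j i)" by (intro d_sym) auto
    then have "k * a i * b j * (d i * of_int (A i j)) = k * a i * b j * (d j * of_int (A j i))" by simp
    then show "of_int (A i j) * pos_part (ccoord n A d a i) * pos_part (b j) = k * (d j * b j * (of_int (A j i) * a i))"
      using ij by (simp add: pp pos_coord[OF assms(3)] mult_ac)
  qed
  also have "\<dots> = (\<Sum>j<n. \<Sum>i<j. k * (d j * b j * (of_int (A j i) * a i)))"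
  proof -
    let ?f = "\<lambda>i j. k * (d j * b j * (of_int (A j i) * a i))"
    have "(\<Sum>i<n. \<Sum>j\<in>{i<..<n}. ?f i j) = (\<Sum>i<n. \<Sum>j<n. if i < j then ?f i j else 0)"
    proof (rule sum.cong[OF HOL.refl])
      fix i
      have "{i<..<n} = {j \<in> {..<n}. i < j}" by auto
      then show "(\<Sum>j\<in>{i<..<n}. ?f i j) = (\<Sum>j<n. if i < j then ?f i j else 0)"
        by (simp only: sum.inter_filter[OF finite_lessThan])
    qed
    also have "\<dots> = (\<Sum>j<n. \<Sum>i<n. if i < j then ?f i j else 0)" by (rule sum.swap)
    also have "\<dots> = (\<Sum>j<n. \<Sum>i<j. ?f i j)"
    proof (rule sum.cong[OF HOL.refl])
      fix j assume "j \<in> {..<n}"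
      then have "{..<j} = {i \<in> {..<n}. i < j}" by auto
      then show "(\<Sum>i<n. if i < j then ?f i j else 0) = (\<Sum>i<j. ?f i j)"
        by (simp only: sum.inter_filter[OF finite_lessThan])
    qed
    finally show ?thesis .
  qed
  finally have s3: "(\<Sum>i<n. \<Sum>j\<in>{i<..<n}. of_int (A i j) * pos_part (ccoord n A d a i) * pos_part (b j))
     = k * (\<Sum>j<n. \<Sum>i<j. d j * b j * (of_int (A j i) * a i))" by (simp add: sum_distrib_left)
  show "cdeg_left n A d a b = - (2 / K a a) * E b a"
    unfolding cdeg_left_def s1 s3 E_sums k_def[symmetric] by (simp add: algebra_simps)
qed

end

section \<open>Real roots modulo \<delta> and the special node\<close>

lemma lspan_supported: assumes "z \<in> lspan B" "\<And>b. b \<in> B \<Longrightarrow> supported n b" shows "supported n z"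
  using assms(1)
proof (induction rule: lspan_induct)
  case zero
  show ?case by (rule supported_zero)
next
  case (step a q w)
  then show ?case using assms(2) by (simp add: supported_add supported_smul)
qed

lemma lin_comb_diff: "lin_comb F f - lin_comb F g = lin_comb F (\<lambda>q. f q - g q)"
  by (simp add: lin_comb_eq smul_diff_left sum_subtractf)

lemma lspan_lin_zero: assumes "z \<in> lspan B" "lin \<phi>" "\<And>b. b \<in> B \<Longrightarrow> \<phi> b = 0" shows "\<phi> z = 0"
  using assms(1)
proof (induction rule: lspan_induct)
  case zero
  show ?case by (rule lin_zero[OF assms(2)])
next
  case (step a q w)
  then show ?case using assms(3) lin_add[OF assms(2)] lin_smul[OF assms(2)] by simp
qed

context affine begin

text \<open>A general nonzero scalar is allowed because the real roots modulo \<delta> can form a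
  nonreduced root system, as in the twisted type A_2l^(2).\<close>

definition par :: "vec \<Rightarrow> vec \<Rightarrow> bool" where
  "par r r' \<longleftrightarrow> (\<exists>x t. x \<noteq> 0 \<and> r = x *s r' + t *s dl)"

text \<open>The vectors vanishing at 0 serve as a model of the quotient by \<open>dl\<close>; on
  them the form is definite, and the real roots have finite image.\<close>

definition pr :: "vec \<Rightarrow> vec" where "pr v = v - (v 0 / dl 0) *s dl"

lemma dl0: "dl 0 > 0" using dl_pos n_pos by blast

lemma linv_pr: "linv pr"
  by (simp add: linv_def pr_def ptw algebra_simps add_divide_distrib)

lemma pr_0: "pr v 0 = 0" using dl0 by (simp add: pr_def vs)
lemma pr_supp: "supp v \<Longrightarrow> supp (pr v)" unfolding pr_def by (intro supp_intros dl_supp)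
lemma pr_dl: "pr dl = 0" using dl0 by (simp add: pr_def)
lemma pr_eq: "v = pr v + (v 0 / dl 0) *s dl" by (simp add: pr_def)
lemma K_pr: "K (pr u) v = K u v" "K u (pr v) = K u v" by (auto simp: pr_def K_lin)

lemma pr_tr: "tr (pr p) (pr r) = pr (tr p r)"
  unfolding tr_def K_pr by (simp add: linv_diff[OF linv_pr] linv_smul[OF linv_pr])

lemma finite_pr: "finite (pr ` RR)"
proof (rule finite_imageD)
  have "cp_vec (pr r) = cp_vec r" for r
  proof -
    have "cp_vec r = cp_vec (pr r + (r 0 / dl 0) *s dl)" using pr_eq[of r] by (rule arg_cong)
    then show ?thesis by (simp add: cp_vec_eq_dlI)
  qed
  then show "finite (cp_vec ` pr ` RR)" using finite_cp_vec by (simp add: image_image)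
  show "inj_on cp_vec (pr ` RR)"
  proof (rule inj_onI)
    fix x y assume a: "x \<in> pr ` RR" "y \<in> pr ` RR" "cp_vec x = cp_vec y"
    have "supp x" "supp y" using a(1,2) by (auto intro: pr_supp RR_supp)
    then obtain t where t: "x = y + t *s dl" using cp_vec_eq_dl a(3) by blast
    have "x 0 = 0" "y 0 = 0" using a(1,2) pr_0 by auto
    then have "t = 0" using arg_cong[OF t, of "\<lambda>v. v 0"] dl0 by (simp add: vs)
    then show "x = y" using t by simp
  qed
qed

text \<open>The pairings with the simple roots are weighted by powers of \<open>z\<close>. Each real
  root then gives a nonzero polynomial in \<open>z\<close> that depends only on its class modulo
  \<open>dl\<close>, so the finitely many classes exclude finitely many \<open>z\<close>.\<close>

lemma generic_functional: obtains g where "lin g" "g dl = 0" "\<And>r. r \<in> RR \<Longrightarrow> g r \<noteq> 0"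
proof -
  let ?p = "\<lambda>x z. \<Sum>i\<le>n - 1. K (simple i) x * z ^ i"
  have fin: "finite {z. ?p (pr r) z = 0}" if r: "r \<in> RR" for r
  proof -
    have "\<exists>i<n. K (simple i) r \<noteq> 0"
    proof (rule ccontr)
      assume a: "\<not> ?thesis"
      have "cp i r = 0" if "i < n" for i using a that d_pos[OF that] by (auto simp: K_simple)
      then have "K r r = 0" by (simp add: K_alt)
      then show False using RR_norm_pos[OF r] by simp
    qed
    then obtain i where i: "i < n" "K (simple i) (pr r) \<noteq> 0" by (auto simp: K_pr)
    then show ?thesis by (intro polyfun_roots_finite[of "\<lambda>i. K (simple i) (pr r)" i]) auto
  qed
  have "finite (\<Union>x\<in>pr ` RR. {z. ?p x z = 0})" using finite_pr fin by (intro finite_UN_I) auto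
  then obtain z :: real where z: "z \<notin> (\<Union>x\<in>pr ` RR. {z. ?p x z = 0})"
    using ex_new_if_finite[OF infinite_UNIV_char_0] by blast
  define g where "g v = (\<Sum>i\<le>n - 1. z ^ i * K (simple i) v)" for v
  have "lin g" unfolding lin_def g_def
    by (auto simp: K_lin algebra_simps sum.distrib sum_distrib_left)
  moreover have "g dl = 0" by (simp add: g_def)
  moreover have "g r \<noteq> 0" if "r \<in> RR" for r
    using z that by (force simp: g_def K_pr mult.commute)
  ultimately show ?thesis using that by blast
qed

text \<open>Take a minimal generating set of the cone of classes modulo \<open>\<delta>\<close> on which a generic functional is
  positive; it is a simple system, and \<open>h\<close> vanishes on chosen representatives of its elements.\<close>
lemma special_functional:
  obtains h where "lin h" "h dl = 1" "\<And>r. r \<in> RR \<Longrightarrow> \<exists>r'\<in>RR. h r' = 0 \<and> par r r'"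
proof -
  obtain g where g: "lin g" "g dl = 0" "\<And>r. r \<in> RR \<Longrightarrow> g r \<noteq> 0" using generic_functional by blast
  have gpr: "g (pr v) = g v" for v unfolding pr_def by (simp add: lin_diff[OF g(1)] lin_smul[OF g(1)] g(2))
  define R where "R = {x \<in> pr ` RR. g x > 0}"
  have finR: "finite R" unfolding R_def using finite_pr by simp
  have Rsupp: "supp x" "x 0 = 0" if "x \<in> R" for x using that by (auto simp: R_def pr_0 intro: pr_supp RR_supp)
  have Rpos: "pr r \<in> R \<or> - pr r \<in> R" if "r \<in> RR" for r
  proof (cases "g r > 0")
    case True
    then show ?thesis using that by (auto simp: R_def gpr)
  next
    case False
    then have "g (- r) > 0" using g(3)[OF that] lin_minus[OF g(1)] by simp
    moreover have "- pr r = pr (- r)" by (simp add: linv_minus[OF linv_pr])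
    ultimately have "- pr r \<in> R" using RR_neg[OF that] unfolding R_def by (auto simp: gpr)
    then show ?thesis ..
  qed
  have cl: "\<exists>m>0. r - m *s p \<in> R \<or> m *s p - r \<in> R" if pr': "p \<in> R" "r \<in> R" "p \<noteq> r" "K p r > 0" for p r
  proof -
    obtain p' r' where l: "p' \<in> RR" "r' \<in> RR" "p = pr p'" "r = pr r'" using pr'(1,2) by (auto simp: R_def)
    define m where "m = 2 * K p r / K p p"
    have "K p p > 0" using RR_norm_pos[OF l(1)] by (simp add: l K_pr)
    then have m: "m > 0" using pr'(4) by (simp add: m_def)
    have "r - m *s p = pr (tr p' r')" using pr_tr[of p' r'] by (simp add: tr_def m_def l K_pr)
    moreover have "tr p' r' \<in> RR" using RR_tr l by blast
    ultimately have "r - m *s p \<in> R \<or> - (r - m *s p) \<in> R" using Rpos by metis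
    then show ?thesis using m by (metis minus_diff_eq)
  qed
  have RR': "R \<subseteq> nonneg_span R" using nonneg_span_base by blast
  have gR: "\<And>r. r \<in> R \<Longrightarrow> g r > 0" by (simp add: R_def)
  obtain B where B: "B \<subseteq> R" "R \<subseteq> nonneg_span B" and neg: "\<And>p q. p \<in> B \<Longrightarrow> q \<in> B \<Longrightarrow> p \<noteq> q \<Longrightarrow> K p q \<le> 0"
    using base_exists[OF finR subset_refl RR' g(1) gR cl] by auto
  have finB: "finite B" using B finR finite_subset by blast
  have nf: "z = 0" if z: "z \<in> nonneg_span B" "K z z = 0" for z
  proof (rule ccontr)
    assume "z \<noteq> 0"
    moreover have zl: "z \<in> lspan B" using z(1) nonneg_span_lspan by blast
    moreover have "supp z" using lspan_supported[OF zl] B Rsupp by blast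
    moreover have "z 0 = 0" using lspan_lin_zero[OF zl lin_coord] B Rsupp by blast
    ultimately show False using K_pos_def[of z 0] n_pos z(2) by simp
  qed
  have gB: "\<And>b. b \<in> B \<Longrightarrow> g b > 0" using B gR by blast
  have indep: "b \<in> B \<Longrightarrow> a b = 0" if "lin_comb B a = 0" for a b
    by (rule base_indep[OF finB g(1) gB neg nf that])
  have indep2: "b \<in> B \<Longrightarrow> a b = a' b" if "lin_comb B a = lin_comb B a'" for a a' b
  proof -
    have "lin_comb B (\<lambda>q. a q - a' q) = 0" using that by (simp add: lin_comb_diff[symmetric])
    then show "b \<in> B \<Longrightarrow> a b = a' b" using indep[of "\<lambda>q. a q - a' q" b] by simp
  qed
  have "\<forall>b\<in>B. \<exists>r\<in>RR. pr r = b" using B by (auto simp: R_def)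
  then obtain lf where lf: "\<And>b. b \<in> B \<Longrightarrow> lf b \<in> RR" "\<And>b. b \<in> B \<Longrightarrow> pr (lf b) = b" by metis
  define y where "y b = lf b 0 / dl 0" for b
  have "\<forall>i<n. \<exists>a. pr (simple i) = lin_comb B a"
  proof (intro allI impI)
    fix i assume "i < n"
    then have "pr (simple i) \<in> R \<or> - pr (simple i) \<in> R" using Rpos RR_simple by blast
    then have "pr (simple i) \<in> lspan B"
      using B(2) nonneg_span_lspan[of B] lspan_minus[of "- pr (simple i)" B] by auto
    then show "\<exists>a. pr (simple i) = lin_comb B a" using lspan_finite[OF _ finB] by metis
  qed
  then obtain a where a: "\<And>i. i < n \<Longrightarrow> pr (simple i) = lin_comb B (a i)" by metis
  have expand: "pr v = lin_comb B (\<lambda>b. \<Sum>i<n. v i * a i b)" if "supp v" for v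
  proof -
    have "pr v = (\<Sum>i<n. v i *s pr (simple i))"
      by (subst supported_expand[OF that]) (simp add: linv_sum[OF linv_pr] linv_smul[OF linv_pr])
    also have "\<dots> = (\<Sum>i<n. v i *s lin_comb B (a i))" using a by simp
    also have "\<dots> = lin_comb B (\<lambda>b. \<Sum>i<n. v i * a i b)"
      by (simp add: fun_eq_iff sum_vec_apply smul_apply lin_comb_def sum_distrib_left sum_distrib_right mult.assoc, intro allI, rule sum.swap)
    finally show ?thesis .
  qed
  \<comment> \<open>The first term is the coefficient of \<open>dl\<close> relative to
    \<open>pr\<close>; the second extends \<open>y\<close> linearly along the base. Hence each lift
    \<open>lf b = b + y b *s dl\<close> is sent to 0.\<close>
  define h where "h v = v 0 / dl 0 - (\<Sum>i<n. v i * (\<Sum>b\<in>B. a i b * y b))" for v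
  have lh: "lin h" unfolding lin_def h_def
    by (auto simp: vs algebra_simps sum.distrib add_divide_distrib sum_distrib_left)
  have hval: "h v = v 0 / dl 0 - (\<Sum>b\<in>B. e b * y b)" if "supp v" "pr v = lin_comb B e" for v e
  proof -
    have "(\<Sum>i<n. v i * a i b) = e b" if "b \<in> B" for b
      using indep2[of "\<lambda>b. \<Sum>i<n. v i * a i b" e b] expand[OF \<open>supp v\<close>] \<open>pr v = lin_comb B e\<close> that by simp
    then have "(\<Sum>b\<in>B. e b * y b) = (\<Sum>b\<in>B. \<Sum>i<n. v i * (a i b * y b))"
      by (intro sum.cong) (auto simp: sum_distrib_right mult.assoc[symmetric] sum_distrib_right[symmetric])
    also have "\<dots> = (\<Sum>i<n. v i * (\<Sum>b\<in>B. a i b * y b))"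
      by (subst sum.swap) (simp add: sum_distrib_left)
    finally show ?thesis by (simp add: h_def)
  qed
  have "h dl = dl 0 / dl 0 - (\<Sum>b\<in>B. 0 * y b)"
    by (rule hval[OF dl_supp]) (simp add: pr_dl lin_comb_def ptw)
  then have hdl: "h dl = 1" using dl0 by simp
  have hlf: "h (lf b) = 0" if b: "b \<in> B" for b
  proof -
    have "pr (lf b) = lin_comb B (\<lambda>q. if q = b then 1 else 0)"
      using lin_comb_single[OF finB b, of 1] lf(2)[OF b] by simp
    then have "h (lf b) = lf b 0 / dl 0 - (\<Sum>q\<in>B. (if q = b then 1 else 0) * y q)"
      by (rule hval[OF RR_supp[OF lf(1)[OF b]]])
    also have "(\<Sum>q\<in>B. (if q = b then 1 else 0) * y q) = (\<Sum>q\<in>B. if q = b then y q else 0)"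
      by (rule sum.cong) auto
    also have "\<dots> = y b" using finB b by simp
    finally show ?thesis by (simp add: y_def)
  qed
  \<comment> \<open>Descent on \<open>g\<close>: reflecting in the lift of a base element with
    positive pairing lowers \<open>g\<close> and keeps it positive, until the class is a multiple of
    a base element. The lifts lie in the kernel of \<open>h\<close>, so their reflections preserve
    this kernel.\<close>
  have desc: "\<exists>r'\<in>RR. h r' = 0 \<and> par r r'" if "r \<in> RR" "g r > 0" for r
    using that
  proof (induction "card {x \<in> R. g x < g r}" arbitrary: r rule: less_induct)
    case less
    have xR: "pr r \<in> R" using less.prems by (auto simp: R_def gpr)
    then obtain e where e: "\<And>q. e q \<ge> 0" "pr r = lin_comb B e"
      using nonneg_span_finite[OF _ finB] B(2) by (metis subsetD)
    have "(\<Sum>b\<in>B. e b * K b (pr r)) = K (pr r) (pr r)"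
      using lin_comb_lin[OF lin_K2[of "pr r"], of B e] e(2) by simp
    also have "\<dots> > 0" using RR_norm_pos[OF less.prems(1)] by (simp add: K_pr)
    finally have "\<exists>b\<in>B. e b * K b (pr r) > 0" by (meson sum_nonpos not_le)
    then obtain b where b: "b \<in> B" "e b * K b (pr r) > 0" by blast
    then have eb: "e b > 0" "K b (pr r) > 0" using e(1)[of b] by (auto simp: zero_less_mult_iff)
    show ?case
    proof (cases "\<exists>b2\<in>B. b2 \<noteq> b \<and> e b2 > 0")
      case False
      then have "\<And>q. q \<in> B \<Longrightarrow> e q = (if q = b then e b else 0)" using e(1) by (auto intro: antisym simp: not_less)
      then have "lin_comb B e = lin_comb B (\<lambda>q. if q = b then e b else 0)" by (auto simp: lin_comb_def)
      then have "pr r = e b *s pr (lf b)" using e(2) lin_comb_single[OF finB b(1), of "e b"] lf(2)[OF b(1)] by simp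
      then have "r = e b *s (lf b - y b *s dl) + (r 0 / dl 0) *s dl"
        using pr_eq[of r] by (simp add: pr_def[of "lf b"] y_def)
      also have "\<dots> = e b *s lf b + (r 0 / dl 0 - e b * y b) *s dl"
        by (simp add: smul_diff_right smul_diff_left)
      finally have "par r (lf b)" unfolding par_def using eb(1) by (metis less_irrefl)
      then show ?thesis using lf(1)[OF b(1)] hlf[OF b(1)] by blast
    next
      case True
      then obtain b2 where b2: "b2 \<in> B" "b2 \<noteq> b" "e b2 > 0" by blast
      define q where "q = tr (lf b) r"
      define m where "m = 2 * K b (pr r) / K b b"
      have Kbb: "K b b > 0" using RR_norm_pos[OF lf(1)[OF b(1)]] lf(2)[OF b(1)] K_pr by metis
      have m: "m > 0" using eb(2) Kbb by (simp add: m_def)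
      have qRR: "q \<in> RR" unfolding q_def using RR_tr lf(1)[OF b(1)] less.prems(1) by blast
      have "pr q = tr b (pr r)" unfolding q_def using pr_tr[of "lf b" r] lf(2)[OF b(1)] by simp
      then have prq: "pr q = pr r - m *s b" by (simp add: tr_def m_def)
      have gb: "g b > 0" using b(1) B by (auto simp: R_def)
      have gq: "g q > 0"
      proof (rule ccontr)
        assume "\<not> ?thesis"
        then have "- pr q \<in> R" using Rpos[OF qRR] by (auto simp: R_def gpr)
        then obtain f where f: "\<And>q. f q \<ge> 0" "- pr q = lin_comb B f"
          using nonneg_span_finite[OF _ finB] B(2) by (metis subsetD)
        have "m *s b = lin_comb B (\<lambda>x. e x + f x)"
        proof -
          have "m *s b - lin_comb B e = lin_comb B f" using f(2) e(2) prq by simp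
          then have "m *s b = lin_comb B e + lin_comb B f" by (metis add.commute diff_add_cancel)
          then show ?thesis by (simp add: lin_comb_add)
        qed
        then have "lin_comb B (\<lambda>x. if x = b then m else 0) = lin_comb B (\<lambda>x. e x + f x)"
          using lin_comb_single[OF finB b(1)] by simp
        from indep2[OF this b2(1)] show False using b2 f(1)[of b2] by simp
      qed
      have "g q = g r - m * g b"
        using arg_cong[OF prq, of g] by (simp add: lin_diff[OF g(1)] lin_smul[OF g(1)] gpr)
      then have lt: "g q < g r" using m gb by simp
      have "pr q \<in> R" using gq qRR by (simp add: R_def gpr)
      then have "pr q \<in> {x \<in> R. g x < g r}" "pr q \<notin> {x \<in> R. g x < g q}" using lt by (simp_all add: gpr)
      moreover have "{x \<in> R. g x < g q} \<subseteq> {x \<in> R. g x < g r}" using lt by auto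
      ultimately have "{x \<in> R. g x < g q} \<subset> {x \<in> R. g x < g r}" by blast
      then have "card {x \<in> R. g x < g q} < card {x \<in> R. g x < g r}"
        using finR by (intro psubset_card_mono) auto
      then obtain r1 where r1: "r1 \<in> RR" "h r1 = 0" "par q r1" using less.hyps qRR gq by blast
      obtain x t where xt: "x \<noteq> 0" "q = x *s r1 + t *s dl" using r1(3) by (auto simp: par_def)
      have K0: "K (lf b) (lf b) \<noteq> 0" using RR_norm_pos[OF lf(1)[OF b(1)]] by simp
      have "r = tr (lf b) q" unfolding q_def using tr_invol[OF K0] by simp
      also have "\<dots> = x *s tr (lf b) r1 + t *s tr (lf b) dl"
        unfolding xt(2) by (simp add: linv_add[OF linv_tr] linv_smul[OF linv_tr])
      also have "tr (lf b) dl = dl" by (simp add: tr_def)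
      finally have "par r (tr (lf b) r1)" unfolding par_def using xt(1) by blast
      moreover have "h (tr (lf b) r1) = 0"
        by (simp add: tr_def lin_diff[OF lh] lin_smul[OF lh] r1(2) hlf[OF b(1)])
      moreover have "tr (lf b) r1 \<in> RR" using RR_tr lf(1)[OF b(1)] r1(1) by blast
      ultimately show ?thesis by blast
    qed
  qed
  have "\<exists>r'\<in>RR. h r' = 0 \<and> par r r'" if r: "r \<in> RR" for r
  proof (cases "g r > 0")
    case False
    then have "g (- r) > 0" using g(3)[OF r] lin_minus[OF g(1)] by simp
    then obtain r' where r': "r' \<in> RR" "h r' = 0" "par (- r) r'" using desc RR_neg[OF r] by blast
    then obtain x t where xt: "x \<noteq> 0" "- r = x *s r' + t *s dl" by (auto simp: par_def)
    have "r = (- x) *s r' + (- t) *s dl"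
      unfolding smul_uminus_left using xt(2) by (metis minus_add_distrib minus_minus)
    then have "par r r'" unfolding par_def using xt(1) by (metis neg_equal_0_iff_equal)
    then show ?thesis using r' by blast
  qed (use desc r in blast)
  then show ?thesis using that lh hdl by blast
qed

text \<open>A special functional \<open>h\<close> that is negative on the fewest positive roots is nonnegative on simple roots.
  Any \<open>e\<close> with \<open>h (simple e) > 0\<close> then works, since by sign coherence a real root in the kernel of \<open>h\<close> has
  zero coordinate at \<open>e\<close>.\<close>
lemma special_node:
  obtains e where "e < n" "\<And>r. r \<in> RR \<Longrightarrow> \<exists>r'\<in>RR. r' e = 0 \<and> par r r'"
proof -
  define H where "H h \<longleftrightarrow> lin h \<and> h dl = 1 \<and> (\<forall>r\<in>RR. \<exists>r'\<in>RR. h r' = 0 \<and> par r r')" for h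
  define N where "N h = {r \<in> RR. pos r \<and> h r < 0}" for h :: "vec \<Rightarrow> real"
  \<comment> \<open>As \<open>h dl = 1\<close>, negativity of \<open>h r\<close> bounds the
    coordinate of \<open>r\<close> at 0 in terms of its class, and there are finitely many
    classes.\<close>
  have finN: "finite (N h)" if "H h" for h
  proof -
    define M where "M = Max ((\<lambda>x. \<bar>h x\<bar>) ` pr ` RR)"
    have "inj_on (\<lambda>r. (pr r, r 0)) (N h)"
      by (rule inj_onI) (metis pr_eq prod.inject)
    moreover have "(\<lambda>r. (pr r, r 0)) ` N h \<subseteq> pr ` RR \<times> {z \<in> \<int>. \<bar>z\<bar> \<le> M * dl 0}"
    proof clarify
      fix r assume r: "r \<in> N h"
      then have rr: "r \<in> RR" "pos r" "h r < 0" by (auto simp: N_def)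
      have "h r = h (pr r) + r 0 / dl 0"
        using arg_cong[OF pr_eq[of r], of h] that lin_add lin_smul unfolding H_def by (metis mult.right_neutral)
      then have "r 0 / dl 0 \<le> \<bar>h (pr r)\<bar>" using rr(3) by linarith
      also have "\<dots> \<le> M" unfolding M_def using finite_pr rr(1) by (intro Max_ge) auto
      finally have "r 0 \<le> M * dl 0" using dl0 by (simp add: field_simps)
      moreover have "r 0 \<ge> 0" using rr(2) n_pos by (simp add: positive_def)
      ultimately show "pr r \<in> pr ` RR \<and> r 0 \<in> {z \<in> \<int>. \<bar>z\<bar> \<le> M * dl 0}"
        using RR_ints(1)[OF rr(1) n_pos] rr(1) by auto
    qed
    moreover have "finite (pr ` RR \<times> {z \<in> \<int>. \<bar>z\<bar> \<le> M * dl 0})"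
      using finite_pr finite_abs_int_segment by blast
    ultimately show ?thesis using inj_on_finite by blast
  qed
  have "\<exists>h. H h" using special_functional unfolding H_def by metis
  then obtain h where h: "H h" and hmin: "\<And>h'. H h' \<Longrightarrow> card (N h) \<le> card (N h')"
    using ex_has_least_nat[of H _ "\<lambda>h. card (N h)"] by blast
  have lh: "lin h" using h by (simp add: H_def)
  have dom: "h (simple i) \<ge> 0" if i: "i < n" for i
  proof (rule ccontr)
    assume neg: "\<not> ?thesis"
    \<comment> \<open>Composition with \<open>s i\<close> keeps \<open>h\<close> special, and
      \<open>s i\<close> maps the positive roots on which \<open>h'\<close> is negative injectively
      to those of \<open>h\<close> other than \<open>simple i\<close>, against minimality.\<close>
    define h' where "h' v = h (s i v)" for v
    have "lin h'" unfolding lin_def h'_def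
      by (simp add: linv_add[OF linv_s] linv_smul[OF linv_s] lin_add[OF lh] lin_smul[OF lh])
    moreover have "h' dl = 1" using h i by (simp add: h'_def s_dl H_def)
    moreover have "\<exists>r'\<in>RR. h' r' = 0 \<and> par r r'" if r: "r \<in> RR" for r
    proof -
      obtain r1 where r1: "r1 \<in> RR" "h r1 = 0" "par (s i r) r1" using h RR_s[OF r i] unfolding H_def by blast
      then obtain x t where xt: "x \<noteq> 0" "s i r = x *s r1 + t *s dl" by (auto simp: par_def)
      have "r = s i (s i r)" using s_invol[OF i] by simp
      also have "\<dots> = x *s s i r1 + t *s dl"
        unfolding xt(2) by (simp add: linv_add[OF linv_s] linv_smul[OF linv_s] s_dl[OF i])
      finally have "par r (s i r1)" unfolding par_def using xt(1) by blast
      moreover have "h' (s i r1) = 0" using r1(2) by (simp add: h'_def s_invol[OF i])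
      ultimately show ?thesis using RR_s[OF r1(1) i] by blast
    qed
    ultimately have H': "H h'" by (simp add: H_def)
    have neg_s: "s i (simple i) = - simple i" using i by (simp add: s_eq cp_simple A_diag ptw)
    have "s i ` N h' \<subseteq> N h - {simple i}"
    proof clarify
      fix r assume r: "r \<in> N h'"
      then have rr: "r \<in> RR" "pos r" "h (s i r) < 0" by (auto simp: N_def h'_def)
      have "r \<noteq> simple i" using rr(3) neg neg_s lin_minus[OF lh] by auto
      then have "pos (s i r)" using RR_s_pos rr i by blast
      moreover have "s i r \<noteq> simple i"
      proof
        assume "s i r = simple i"
        then have "r = - simple i" using s_invol[OF i, of r] neg_s by simp
        then show False using rr(2) i by (auto simp: positive_def vs dest!: spec[of _ i])
      qed
      ultimately show "s i r \<in> N h - {simple i}" using rr RR_s[OF _ i] by (auto simp: N_def)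
    qed
    moreover have "simple i \<in> N h" using neg i RR_simple by (auto simp: N_def positive_def simple_def)
    ultimately have "s i ` N h' \<subset> N h" by blast
    then have "card (s i ` N h') < card (N h)" using finN[OF h] by (rule psubset_card_mono[rotated])
    moreover have "card (s i ` N h') = card (N h')"
      by (rule card_image) (metis inj_onI s_invol[OF i])
    ultimately show False using hmin[OF H'] by simp
  qed
  have hexp: "h v = (\<Sum>i<n. v i * h (simple i))" if "supp v" for v
    by (subst supported_expand[OF that]) (simp add: lin_sum[OF lh] lin_smul[OF lh])
  have "(\<Sum>i<n. dl i * h (simple i)) = 1" using hexp[OF dl_supp] h by (simp add: H_def)
  then have "\<exists>e<n. h (simple e) \<noteq> 0" by (metis (no_types, lifting) lessThan_iff mult_zero_right sum.neutral zero_neq_one)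
  then obtain e where e: "e < n" "h (simple e) > 0" using dom by (metis less_eq_real_def)
  have key: "r e = 0" if r: "r \<in> RR" "pos r" "h r = 0" for r
  proof -
    have "(\<Sum>i<n. r i * h (simple i)) = 0" using hexp[OF RR_supp[OF r(1)]] r(3) by simp
    then have "\<forall>i\<in>{..<n}. r i * h (simple i) = 0"
      by (subst (asm) sum_nonneg_eq_0_iff) (use r(2) dom in \<open>auto simp: positive_def\<close>)
    then show ?thesis using e by auto
  qed
  have "\<exists>r'\<in>RR. r' e = 0 \<and> par r r'" if r: "r \<in> RR" for r
  proof -
    obtain r' where r': "r' \<in> RR" "h r' = 0" "par r r'" using h r unfolding H_def by blast
    have "r' e = 0"
    proof (cases "pos r'")
      case True
      then show ?thesis using key r' by blast
    next
      case False
      then have "pos (- r')" using RR_sign r'(1) by blast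
      then have "(- r') e = 0" using key RR_neg[OF r'(1)] r'(2) lin_minus[OF lh] by auto
      then show ?thesis by (simp add: vs)
    qed
    then show ?thesis using r' by blast
  qed
  then show ?thesis using that e(1) by blast
qed

section \<open>Height, independence and extremal rays\<close>

definition ht :: "vec \<Rightarrow> real" where "ht v = (\<Sum>j<n. v j)"

lemma lin_ht: "lin ht" unfolding ht_def using lin_wsum[of "\<lambda>_. 1"] by simp

lemma ht_pos: assumes "r \<in> RR" "pos r" shows "ht r > 0"
proof -
  obtain j where j: "j < n" "r j > 0" using RR_pos_ex[OF assms] by blast
  show ?thesis unfolding ht_def
    by (rule sum_pos2[of _ j]) (use j assms in \<open>auto simp: positive_def\<close>)
qed

text \<open>Vanishing at \<open>f\<close> makes the form definite on the span, which supplies the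
  isotropy hypothesis of \<open>base_indep\<close>; the height is the positive functional.\<close>

lemma pos_indep:
  assumes "f < n" "finite P" "\<And>p. p \<in> P \<Longrightarrow> p \<in> RR" "\<And>p. p \<in> P \<Longrightarrow> pos p" "\<And>p. p \<in> P \<Longrightarrow> p f = 0"
    and neg: "\<And>p q. p \<in> P \<Longrightarrow> q \<in> P \<Longrightarrow> p \<noteq> q \<Longrightarrow> K p q \<le> 0"
    and eq: "lin_comb P a = lin_comb P a'" and q: "q \<in> P"
  shows "a q = a' q"
proof -
  have nf: "z = 0" if z: "z \<in> nonneg_span P" "K z z = 0" for z
  proof (rule ccontr)
    assume "z \<noteq> 0"
    moreover have zl: "z \<in> lspan P" using z(1) nonneg_span_lspan by blast
    moreover have "supp z" using lspan_supported[OF zl] assms(3) RR_supp by blast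
    moreover have "z f = 0" using lspan_lin_zero[OF zl lin_coord] assms(5) by blast
    ultimately show False using K_pos_def[of z f] assms(1) z(2) by simp
  qed
  have gP: "\<And>b. b \<in> P \<Longrightarrow> ht b > 0" using assms(3,4) ht_pos by blast
  have z: "lin_comb P (\<lambda>q. a q - a' q) = 0" using eq by (simp add: lin_comb_diff[symmetric])
  have "a q - a' q = 0" by (rule base_indep[OF assms(2) lin_ht gP neg nf z q])
  then show ?thesis by simp
qed

text \<open>Members of an independent family span extremal rays of its cone, since nonnegative
  coefficients cannot cancel.\<close>

lemma indep_extremal:
  assumes fin: "finite P" and ind: "\<And>a a' q. lin_comb P a = lin_comb P a' \<Longrightarrow> q \<in> P \<Longrightarrow> a q = a' q"
    and q: "q \<in> P" and eq: "q = x *s b + z" and x: "x > 0" and b: "b \<in> nonneg_span P" and z: "z \<in> nonneg_span P"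
  shows "\<exists>t. b = t *s q"
proof -
  obtain e where e: "\<And>p. e p \<ge> 0" "b = lin_comb P e" using nonneg_span_finite[OF b fin] by metis
  obtain f where f: "\<And>p. f p \<ge> 0" "z = lin_comb P f" using nonneg_span_finite[OF z fin] by metis
  have "lin_comb P (\<lambda>p. if p = q then 1 else 0) = q" using lin_comb_single[OF fin q, of 1] by simp
  also have "\<dots> = lin_comb P (\<lambda>p. x * e p + f p)"
    unfolding eq e(2) f(2) by (simp add: lin_comb_smul lin_comb_add)
  finally have h: "lin_comb P (\<lambda>p. if p = q then 1 else 0) = lin_comb P (\<lambda>p. x * e p + f p)" .
  have "e p = 0" if "p \<in> P" "p \<noteq> q" for p
  proof -
    have "x * e p + f p = 0" using ind[OF h that(1)] that(2) by simp
    moreover have "x * e p \<ge> 0" using x e(1) by simp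
    ultimately have "x * e p = 0" using f(1)[of p] by linarith
    then show ?thesis using x by simp
  qed
  then have "lin_comb P e = lin_comb P (\<lambda>p. if p = q then e q else 0)"
    unfolding lin_comb_eq by (intro sum.cong) auto
  then have "b = e q *s q" using e(2) lin_comb_single[OF fin q] by simp
  then show ?thesis by blast
qed

lemma EL_disjoint_nonpos:
  assumes "\<And>j. u j \<ge> 0" "\<And>j. v j \<ge> 0" "\<And>j. u j = 0 \<or> v j = 0"
  shows "distinct L \<Longrightarrow> set L \<subseteq> {..<n} \<Longrightarrow> EL L u v \<le> 0"
proof (induction L)
  case (Cons a L)
  have 1: "d a * u a * v a = 0" using assms(3)[of a] by auto
  have 2: "(\<Sum>j\<in>set L. d j * of_int (A j a) * u j) * v a \<le> 0"
  proof (rule mult_nonpos_nonneg)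
    show "(\<Sum>j\<in>set L. d j * of_int (A j a) * u j) \<le> 0"
    proof (rule sum_nonpos)
      fix j assume j: "j \<in> set L"
      then have "A j a \<le> 0" using Cons.prems by (intro A_off) auto
      moreover have "d j > 0" using j Cons.prems by (intro d_pos) auto
      ultimately show "d j * of_int (A j a) * u j \<le> 0"
        using assms(1)[of j] by (simp add: mult_nonneg_nonpos mult_nonpos_nonneg)
    qed
  qed (fact assms(2))
  have 3: "EL L u v \<le> 0" using Cons by simp
  show ?case unfolding EL.simps using 1 2 3 by linarith
qed simp

lemma EL_Cons_zero: "u i = 0 \<Longrightarrow> v i = 0 \<Longrightarrow> EL (i # M) u v = EL M u v" by simp

lemma pos_all: "supp v \<Longrightarrow> pos v \<Longrightarrow> v j \<ge> 0"
  by (cases "j < n") (auto simp: positive_def supported_def)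

section \<open>Factorizations of Coxeter elements into reflections\<close>

primrec refl_prod :: "vec list \<Rightarrow> vec \<Rightarrow> vec" where
  "refl_prod [] v = v"
| "refl_prod (p # ps) v = tr p (refl_prod ps v)"

lemma refl_prod_simple: "set M \<subseteq> {..<n} \<Longrightarrow> refl_prod (map simple M) v = cL M v"
  by (induction M) (auto simp: tr_simple)

lemma refl_prod_conj: "i < n \<Longrightarrow> refl_prod (map (s i) ps) v = s i (refl_prod ps (s i v))"
  by (induction ps) (auto simp: s_invol tr_conj)

text \<open>The numerical counterpart of the perpendicular category of \<open>w\<close>, inside the
  parabolic subsystem of \<open>L\<close>.\<close>

definition Psi :: "nat list \<Rightarrow> vec \<Rightarrow> vec set" where
  "Psi L w = {r \<in> RR. pos r \<and> (\<forall>j. j \<notin> set L \<longrightarrow> r j = 0) \<and> EL L w r = 0}"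

text \<open>In finite type: after splitting off the reflection in \<open>w\<close>, the Coxeter
  element becomes a Coxeter element of the perpendicular subsystem. The linear span is carried along
  because \<open>reflection_factorization_drop\<close> needs it to bound the size of a simple
  system.\<close>

definition reflection_factorization :: "nat list \<Rightarrow> vec \<Rightarrow> bool" where
  "reflection_factorization L w \<longleftrightarrow> (\<exists>ps. set ps \<subseteq> Psi L w \<and> Psi L w \<subseteq> nonneg_span (set ps)
     \<and> (\<forall>p\<in>set ps. \<forall>q\<in>set ps. p \<noteq> q \<longrightarrow> EL L p q \<le> 0)
     \<and> (\<forall>v. supp v \<and> (\<forall>j. j \<notin> set L \<longrightarrow> v j = 0) \<and> EL L w v = 0 \<longrightarrow> v \<in> lspan (set ps))
     \<and> (\<forall>v. cL L v = tr w (refl_prod ps v)))"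

lemma Psi_D: assumes "r \<in> Psi L w"
  shows "r \<in> RR" "pos r" "j \<notin> set L \<Longrightarrow> r j = 0" "EL L w r = 0"
  using assms by (auto simp: Psi_def)

text \<open>For the simple root at the head, \<open>EL\<close> reads off the coordinate at
  \<open>i\<close>, so the perpendicular is the parabolic subsystem of the tail.\<close>

lemma reflection_factorization_simple: assumes "distinct (i # M)" "set (i # M) \<subseteq> {..<n}" shows "reflection_factorization (i # M) (simple i)"
proof -
  let ?L = "i # M" and ?ps = "map simple M"
  have i: "i \<notin> set M" "i < n" "set M \<subseteq> {..<n}" using assms by auto
  have EH: "EL ?L (simple i) v = d i * v i" for v by (rule EL_head[OF i(1)])
  have z: "v i = 0" if "EL ?L (simple i) v = 0" for v using that d_pos[OF i(2)] unfolding EH by simp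
  have ex: "v = (\<Sum>j<n. v j *s simple j)" if "supp v" for v using supported_expand[OF that] .
  have 1: "set ?ps \<subseteq> Psi ?L (simple i)"
  proof
    fix p assume "p \<in> set ?ps"
    then obtain j where j: "j \<in> set M" "p = simple j" by auto
    moreover have "EL ?L (simple i) p = 0" unfolding EH using j i by (auto simp: simple_def)
    ultimately show "p \<in> Psi ?L (simple i)" using i RR_simple[of j]
      by (auto simp: Psi_def positive_def simple_def simp del: EL.simps)
  qed
  have 2: "Psi ?L (simple i) \<subseteq> nonneg_span (set ?ps)"
  proof
    fix r assume r: "r \<in> Psi ?L (simple i)"
    have ri: "r i = 0" using z Psi_D(4)[OF r] by blast
    have "(\<Sum>j<n. r j *s simple j) \<in> nonneg_span (set ?ps)"
    proof (rule nonneg_span_sum)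
      fix j assume "j \<in> {..<n}"
      show "r j *s simple j \<in> nonneg_span (set ?ps)"
      proof (cases "j \<in> set M")
        case True
        then show ?thesis using pos_all[OF RR_supp[OF Psi_D(1)[OF r]] Psi_D(2)[OF r]]
          by (intro nonneg_span_smul nonneg_span_base) auto
      next
        case False
        then have "r j = 0" using ri Psi_D(3)[OF r, of j] by (cases "j = i") auto
        then show ?thesis by (simp add: nonneg_span_zero)
      qed
    qed
    then show "r \<in> nonneg_span (set ?ps)" using ex[OF RR_supp[OF Psi_D(1)[OF r]]] by simp
  qed
  have 3: "EL ?L p q \<le> 0" if "p \<in> set ?ps" "q \<in> set ?ps" "p \<noteq> q" for p q
  proof -
    obtain j k where jk: "p = simple j" "q = simple k" using \<open>p \<in> set ?ps\<close> \<open>q \<in> set ?ps\<close> by auto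
    then have "j \<noteq> k" using \<open>p \<noteq> q\<close> by auto
    then show ?thesis unfolding jk
      by (intro EL_disjoint_nonpos[OF _ _ _ assms]) (auto simp: simple_def)
  qed
  have 4: "v \<in> lspan (set ?ps)" if v: "supp v" "\<forall>j. j \<notin> set ?L \<longrightarrow> v j = 0" "EL ?L (simple i) v = 0" for v
  proof -
    have vi: "v i = 0" using z v(3) by blast
    have "(\<Sum>j<n. v j *s simple j) \<in> lspan (set ?ps)"
    proof (rule lspan_sum)
      fix j assume "j \<in> {..<n}"
      show "v j *s simple j \<in> lspan (set ?ps)"
      proof (cases "j \<in> set M")
        case True
        then show ?thesis by (intro lspan_smul lspan_base) auto
      next
        case False
        then have "v j = 0" using vi v(2) by (cases "j = i") auto
        then show ?thesis by (simp add: lspan_zero)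
      qed
    qed
    then show ?thesis using ex[OF v(1)] by simp
  qed
  have 5: "cL ?L v = tr (simple i) (refl_prod ?ps v)" for v using i by (simp add: tr_simple refl_prod_simple)
  show ?thesis unfolding reflection_factorization_def
    by (rule exI[of _ ?ps]) (use 1 2 3 4 5 in \<open>simp del: EL.simps\<close>)
qed

lemma s_outside: "j \<noteq> i \<Longrightarrow> s i v j = v j" by (simp add: s_eq vs)

lemma s_simple_self: "i < n \<Longrightarrow> s i (simple i) = - simple i"
  by (simp add: s_eq cp_simple A_diag ptw)

text \<open>\<open>s i\<close> exchanges the two perpendiculars: it preserves positivity except on
  \<open>simple i\<close>, which by \<open>ne\<close> lies in neither of them.\<close>

lemma reflection_factorization_rotate:
  assumes "distinct (i # M)" "set (i # M) \<subseteq> {..<n}" "w \<in> RR" "\<And>j. j \<notin> set (i # M) \<Longrightarrow> w j = 0"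
    and ne: "EL (i # M) w (simple i) \<noteq> 0" and Q: "reflection_factorization (M @ [i]) (s i w)"
  shows "reflection_factorization (i # M) w"
proof -
  let ?L = "i # M" and ?L1 = "M @ [i]" and ?w = "s i w"
  have i: "i < n" "set ?L1 = set ?L" using assms by auto
  have rot: "EL ?L u v = EL ?L1 (s i u) (s i v)"
    if "\<And>j. j \<notin> set ?L \<Longrightarrow> u j = 0" "\<And>j. j \<notin> set ?L \<Longrightarrow> v j = 0" for u v
    by (rule EL_rotate[OF assms(1,2)]) (use that in auto)
  have so: "s i v j = 0" if "\<And>j. j \<notin> set ?L \<Longrightarrow> v j = 0" "j \<notin> set ?L" for v j
    using that by (simp add: s_outside)
  have "EL ?L w (simple i) = EL ?L1 ?w (s i (simple i))"
    by (rule rot) (use assms in \<open>auto simp: simple_def\<close>)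
  then have ne1: "EL ?L1 ?w (simple i) \<noteq> 0" using ne by (simp add: s_simple_self[OF i(1)] EL_lin del: EL.simps)
  obtain ps where ps: "set ps \<subseteq> Psi ?L1 ?w" "Psi ?L1 ?w \<subseteq> nonneg_span (set ps)"
     "\<And>p q. p\<in>set ps \<Longrightarrow> q\<in>set ps \<Longrightarrow> p \<noteq> q \<Longrightarrow> EL ?L1 p q \<le> 0"
     "\<And>v. supp v \<and> (\<forall>j. j \<notin> set ?L1 \<longrightarrow> v j = 0) \<and> EL ?L1 ?w v = 0 \<Longrightarrow> v \<in> lspan (set ps)"
     "\<And>v. cL ?L1 v = tr ?w (refl_prod ps v)"
    using Q unfolding reflection_factorization_def by auto
  have fw: "s i r \<in> Psi ?L w" if r: "r \<in> Psi ?L1 ?w" for r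
  proof -
    have "r \<noteq> simple i" using Psi_D(4)[OF r] ne1 by auto
    then have "pos (s i r)" using RR_s_pos[OF Psi_D(1,2)[OF r] i(1)] by blast
    moreover have ro: "r j = 0" if "j \<notin> set ?L" for j using Psi_D(3)[OF r] that i(2) by auto
    moreover have "EL ?L w (s i r) = EL ?L1 ?w (s i (s i r))" by (rule rot) (use assms(4) so ro in blast)+
    ultimately show ?thesis using RR_s[OF Psi_D(1)[OF r] i(1)] so[OF ro] Psi_D(4)[OF r]
      by (simp add: Psi_def s_invol[OF i(1)] del: EL.simps)
  qed
  have bw: "s i r \<in> Psi ?L1 ?w" if r: "r \<in> Psi ?L w" for r
  proof -
    have "r \<noteq> simple i" using Psi_D(4)[OF r] ne by auto
    then have "pos (s i r)" using RR_s_pos[OF Psi_D(1,2)[OF r] i(1)] by blast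
    moreover have ro: "r j = 0" if "j \<notin> set ?L" for j using Psi_D(3)[OF r] that by blast
    moreover have "EL ?L w r = EL ?L1 ?w (s i r)" by (rule rot) (use assms(4) ro in blast)+
    ultimately show ?thesis using RR_s[OF Psi_D(1)[OF r] i(1)] so[OF ro] Psi_D(4)[OF r] i(2)
      by (simp add: Psi_def del: EL.simps)
  qed
  let ?ps = "map (s i) ps"
  have 1: "set ?ps \<subseteq> Psi ?L w" using fw ps(1) by auto
  have 2: "Psi ?L w \<subseteq> nonneg_span (set ?ps)"
  proof
    fix r assume "r \<in> Psi ?L w"
    then have "s i r \<in> nonneg_span (set ps)" using bw ps(2) by blast
    then have "s i (s i r) \<in> nonneg_span (s i ` set ps)" by (rule nonneg_span_image[OF _ linv_s])
    then show "r \<in> nonneg_span (set ?ps)" using s_invol[OF i(1)] by simp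
  qed
  have 3: "EL ?L p q \<le> 0" if pq: "p \<in> set ?ps" "q \<in> set ?ps" "p \<noteq> q" for p q
  proof -
    obtain p' q' where p': "p' \<in> set ps" "q' \<in> set ps" "p = s i p'" "q = s i q'" using pq by auto
    have "EL ?L p q = EL ?L1 (s i p) (s i q)"
      by (rule rot) (use pq 1 Psi_D(3) in blast)+
    also have "\<dots> = EL ?L1 p' q'" using p' by (simp add: s_invol[OF i(1)])
    also have "\<dots> \<le> 0" using ps(3) p' pq(3) by blast
    finally show ?thesis .
  qed
  have 4: "v \<in> lspan (set ?ps)" if v: "supp v" "\<forall>j. j \<notin> set ?L \<longrightarrow> v j = 0" "EL ?L w v = 0" for v
  proof -
    have "EL ?L w v = EL ?L1 ?w (s i v)" by (rule rot) (use assms(4) v(2) in blast)+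
    then have "s i v \<in> lspan (set ps)"
      using v so[of v] i supported_refl[OF i(1) v(1)] by (intro ps(4)) (auto simp del: EL.simps)
    then have "s i (s i v) \<in> lspan (s i ` set ps)" by (rule lspan_image[OF _ linv_s])
    then show ?thesis using s_invol[OF i(1)] by simp
  qed
  have 5: "cL ?L v = tr w (refl_prod ?ps v)" for v
  proof -
    have "cL M v = cL ?L1 (s i v)" by (simp add: cL_append s_invol[OF i(1)])
    also have "\<dots> = tr ?w (refl_prod ps (s i v))" by (rule ps(5))
    finally have "cL ?L v = s i (tr ?w (refl_prod ps (s i v)))" by simp
    also have "\<dots> = s i (tr ?w (s i (s i (refl_prod ps (s i v)))))" by (simp add: s_invol[OF i(1)])
    also have "\<dots> = tr (s i ?w) (s i (refl_prod ps (s i v)))" by (simp add: tr_conj[OF i(1)])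
    also have "\<dots> = tr w (refl_prod ?ps v)" by (simp add: s_invol[OF i(1)] refl_prod_conj[OF i(1)])
    finally show ?thesis .
  qed
  show ?thesis unfolding reflection_factorization_def
    by (rule exI[of _ ?ps]) (use 1 2 3 4 5 in \<open>simp del: EL.simps cL.simps\<close>)
qed

lemma tr_pm_RR: assumes "p \<in> RR" "r \<in> RR" "K p r > 0"
  shows "\<exists>m>0. r - m *s p \<in> RR"
  using RR_tr[OF assms(1,2)] RR_norm_pos[OF assms(1)] assms(3)
  by (intro exI[of _ "2 * K p r / K p p"]) (simp add: tr_def)

text \<open>The factorization for the tail is extended by \<open>simple i\<close>. The delicate
  condition is that the enlarged family still generates the cone: a minimal generating set
  \<open>B\<close> from \<open>base_exists\<close> is shown to contain no other root.\<close>

lemma reflection_factorization_drop: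
  assumes L: "distinct (i # M)" "set (i # M) \<subseteq> {..<n}" and f: "f < n" "f \<notin> set (i # M)"
    and w: "w \<in> RR" "\<And>j. j \<notin> set (i # M) \<Longrightarrow> w j = 0"
    and ze: "EL (i # M) w (simple i) = 0" and Q: "reflection_factorization M (s i w)"
  shows "reflection_factorization (i # M) w"
proof -
  let ?L = "i # M" and ?w = "s i w"
  have i: "i < n" "i \<notin> set M" "distinct M" "set M \<subseteq> {..<n}" using L by auto
  have "EL ?L (simple i) w + EL ?L w (simple i) = K (simple i) w"
    by (rule EL_K[OF L]) (use w in \<open>auto simp: simple_def\<close>)
  then have "d i * w i = d i * cp i w" using ze unfolding EL_head[OF i(2)] by (simp add: K_simple[OF i(1)] del: EL.simps)
  then have "cp i w = w i" using d_pos[OF i(1)] by simp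
  have Eeq: "EL ?L w v = EL M ?w v" if "v i = 0" for v
  proof -
    have "EL ?L w v = EL M w v" using that by simp
    also have "\<dots> = EL M ?w v" using i(2) by (intro EL_cong) (metis s_outside)+
    finally show ?thesis .
  qed
  obtain ps where ps: "set ps \<subseteq> Psi M ?w" "Psi M ?w \<subseteq> nonneg_span (set ps)"
     "\<And>p q. p\<in>set ps \<Longrightarrow> q\<in>set ps \<Longrightarrow> p \<noteq> q \<Longrightarrow> EL M p q \<le> 0"
     "\<And>v. supp v \<and> (\<forall>j. j \<notin> set M \<longrightarrow> v j = 0) \<and> EL M ?w v = 0 \<Longrightarrow> v \<in> lspan (set ps)"
     "\<And>v. cL M v = tr ?w (refl_prod ps v)"
    using Q unfolding reflection_factorization_def by auto
  let ?ps = "simple i # ps"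
  have psD: "p \<in> RR" "pos p" "p i = 0" "j \<notin> set M \<Longrightarrow> p j = 0" "supp p" if "p \<in> set ps" for p j
    using that ps(1) Psi_D[of p M ?w] i(2) RR_supp by auto
  have sub: "Psi M ?w \<subseteq> Psi ?L w"
  proof
    fix r assume r: "r \<in> Psi M ?w"
    have "r i = 0" using Psi_D(3)[OF r] i by blast
    then show "r \<in> Psi ?L w" using r Eeq[of r] by (auto simp: Psi_def simp del: EL.simps)
  qed
  have sub2: "r \<in> Psi M ?w" if r: "r \<in> Psi ?L w" "r i = 0" for r
  proof -
    have "r j = 0" if "j \<notin> set M" for j using that r Psi_D(3)[OF r(1), of j] by (cases "j = i") auto
    then show ?thesis using r Eeq[of r] by (auto simp: Psi_def simp del: EL.simps)
  qed
  have sPsi: "simple i \<in> Psi ?L w"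
    using RR_simple[OF i(1)] ze by (auto simp: Psi_def positive_def simple_def simp del: EL.simps)
  have 1: "set ?ps \<subseteq> Psi ?L w" using sPsi sub ps(1) by auto
  have 3: "EL ?L p q \<le> 0" if pq: "p \<in> set ?ps" "q \<in> set ?ps" "p \<noteq> q" for p q
  proof (cases "p = simple i \<or> q = simple i")
    case True
    show ?thesis
    proof (rule EL_disjoint_nonpos[OF _ _ _ L])
      have P: "p \<in> Psi ?L w" "q \<in> Psi ?L w" using pq 1 by blast+
      show "p j \<ge> 0" for j by (rule pos_all[OF RR_supp[OF Psi_D(1)[OF P(1)]] Psi_D(2)[OF P(1)]])
      show "q j \<ge> 0" for j by (rule pos_all[OF RR_supp[OF Psi_D(1)[OF P(2)]] Psi_D(2)[OF P(2)]])
      show "p j = 0 \<or> q j = 0" for j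
      proof (cases "j = i")
        case True
        have "p \<in> set ps \<or> q \<in> set ps" using pq by auto
        then show ?thesis using psD(3)[of p] psD(3)[of q] True by blast
      next
        case False
        then show ?thesis using \<open>p = simple i \<or> q = simple i\<close> by (auto simp: simple_def)
      qed
    qed
  next
    case False
    then have mem: "p \<in> set ps" "q \<in> set ps" using pq by auto
    then have pi: "p i = 0" "q i = 0" using psD(3) by blast+
    show ?thesis unfolding EL_Cons_zero[of p i q M, OF pi] using ps(3)[OF mem pq(3)] .
  qed
  have 4: "v \<in> lspan (set ?ps)" if v: "supp v" "\<forall>j. j \<notin> set ?L \<longrightarrow> v j = 0" "EL ?L w v = 0" for v
  proof -
    define y where "y = v - v i *s simple i"
    have yi: "y i = 0" by (simp add: y_def vs)
    have "EL ?L w y = 0" unfolding y_def using v(3) ze by (simp add: EL_lin del: EL.simps)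
    then have "EL M ?w y = 0" using Eeq[of y, OF yi] by (simp del: EL.simps)
    moreover have "y j = 0" if "j \<notin> set M" for j
      using that v(2) yi by (cases "j = i") (auto simp: y_def vs)
    moreover have "supp y" unfolding y_def by (intro supp_intros v i)
    ultimately have "y \<in> lspan (set ps)" by (intro ps(4)) auto
    then have "y \<in> lspan (set ?ps)" using lspan_trans lspan_base by (metis list.set_intros(2) subsetI)
    moreover have "v = v i *s simple i + y" by (simp add: y_def)
    moreover have "v i *s simple i \<in> lspan (set ?ps)" by (intro lspan_smul lspan_base) auto
    ultimately show ?thesis using lspan_add by metis
  qed
  have 5: "cL ?L v = tr w (refl_prod ?ps v)" for v
  proof -
    have "cL ?L v = s i (tr ?w (s i (s i (refl_prod ps v))))" using ps(5) by (simp add: s_invol[OF i(1)])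
    also have "\<dots> = tr (s i ?w) (s i (refl_prod ps v))" by (simp add: tr_conj[OF i(1)])
    also have "\<dots> = tr w (refl_prod ?ps v)" by (simp add: s_invol[OF i(1)] tr_simple[OF i(1)])
    finally show ?thesis .
  qed
  have PsiD: "r \<in> RR" "pos r" "r f = 0" if "r \<in> Psi ?L w" for r using that Psi_D[OF that] f by auto
  have finPsi: "finite (Psi ?L w)"
    by (rule finite_subset[OF _ finite_RR_zero[OF f(1)]]) (use PsiD in blast)
  have cl: "\<exists>m>0. r - m *s p \<in> Psi ?L w \<or> m *s p - r \<in> Psi ?L w"
    if pr': "p \<in> Psi ?L w" "r \<in> Psi ?L w" "p \<noteq> r" "K p r > 0" for p r
  proof -
    obtain m where m: "m > 0" "r - m *s p \<in> RR" using tr_pm_RR[of p r] PsiD pr' by blast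
    have z: "(r - m *s p) j = 0" if "j \<notin> set ?L" for j
      using Psi_D(3)[OF pr'(1) that] Psi_D(3)[OF pr'(2) that] by (simp add: vs)
    have z2: "EL ?L w (r - m *s p) = 0"
      using Psi_D(4)[OF pr'(1)] Psi_D(4)[OF pr'(2)] by (simp add: EL_lin del: EL.simps)
    show ?thesis
    proof (cases "pos (r - m *s p)")
      case True
      then have "r - m *s p \<in> Psi ?L w" using m z z2 by (auto simp: Psi_def simp del: EL.simps)
      then show ?thesis using m by blast
    next
      case False
      then have "pos (- (r - m *s p))" using RR_sign[OF m(2)] by blast
      moreover have "(- (r - m *s p)) j = 0" if "j \<notin> set ?L" for j
        using z[OF that] unfolding uminus_apply by simp
      moreover have "EL ?L w (- (r - m *s p)) = 0" unfolding lin_minus[OF lin_EL2] using z2 by simp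
      ultimately have "- (r - m *s p) \<in> Psi ?L w" using RR_neg[OF m(2)] unfolding Psi_def by blast
      then have "m *s p - r \<in> Psi ?L w" by simp
      then show ?thesis using m by blast
    qed
  qed
  have gP: "\<And>r. r \<in> Psi ?L w \<Longrightarrow> ht r > 0" using PsiD ht_pos by blast
  have PP: "Psi ?L w \<subseteq> nonneg_span (Psi ?L w)" using nonneg_span_base by blast
  obtain B where B: "B \<subseteq> Psi ?L w" "Psi ?L w \<subseteq> nonneg_span B" "\<And>p q. p \<in> B \<Longrightarrow> q \<in> B \<Longrightarrow> p \<noteq> q \<Longrightarrow> K p q \<le> 0"
    using base_exists[OF finPsi subset_refl PP lin_ht gP cl] by auto
  have finB: "finite B" using B finPsi finite_subset by blast
  have indB: "a q = a' q" if "lin_comb B a = lin_comb B a'" "q \<in> B" for a a' q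
    by (rule pos_indep[OF f(1) finB _ _ _ B(3) that]) (use B(1) PsiD in blast)+
  have negps: "K p q \<le> 0" if "p \<in> set ps" "q \<in> set ps" "p \<noteq> q" for p q
  proof -
    have "K p q = EL M p q + EL M q p"
      by (rule EL_K[symmetric, OF i(3,4)]) (use that psD(4) in blast)+
    then show ?thesis using ps(3)[of p q] ps(3)[of q p] that by simp
  qed
  have indps: "a q = a' q" if "lin_comb (set ps) a = lin_comb (set ps) a'" "q \<in> set ps" for a a' q
    by (rule pos_indep[OF i(1) _ _ _ _ negps that]) (use psD in auto)
  have "B \<subseteq> set ?ps"
  proof -
    \<comment> \<open>All summands in an expansion of \<open>simple i\<close> are nonnegative
      vectors, hence supported at \<open>i\<close> only.\<close>
    have s1: "simple i \<in> B"
    proof -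
      obtain a where a: "\<And>q. a q \<ge> 0" "simple i = lin_comb B a"
        using nonneg_span_finite[OF _ finB, of "simple i"] sPsi B(2) by (metis subsetD)
      have "\<exists>b\<in>B. a b > 0"
      proof (rule ccontr)
        assume "\<not> ?thesis"
        then have "\<forall>b\<in>B. a b = 0" using a(1) by (metis less_eq_real_def)
        then have "simple i = 0" unfolding a(2) lin_comb_eq by (simp add: sum.neutral)
        then show False using RR_nonzero RR_simple i(1) by blast
      qed
      then obtain b where b: "b \<in> B" "a b > 0" by blast
      have bR: "b \<in> RR" "pos b" "supp b" using b B(1) PsiD RR_supp by blast+
      have "b j = 0" if j: "j < n" "j \<noteq> i" for j
      proof -
        have "(\<Sum>q\<in>B. a q * q j) = 0" using arg_cong[OF a(2), of "\<lambda>v. v j"] j by (simp add: lin_comb_def)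
        moreover have "\<forall>q\<in>B. a q * q j \<ge> 0" using a(1) B(1) PsiD(2) j by (auto simp: positive_def)
        ultimately have "a b * b j = 0" using b(1) finB sum_nonneg_eq_0_iff[of B "\<lambda>q. a q * q j"] by blast
        then show ?thesis using b(2) by simp
      qed
      then have "b = b i *s simple i"
        by (intro supported_eqI[of n] bR supp_intros i) (auto simp: vs simple_def)
      moreover from this have "b i > 0" using RR_pos_ex[OF bR(1,2)] \<open>\<And>j. j < n \<Longrightarrow> j \<noteq> i \<Longrightarrow> b j = 0\<close> by (metis less_irrefl)
      ultimately have "b = simple i" using RR_multiple_simple[of "b i" i] i(1) bR(1) by (metis smul_one)
      then show ?thesis using b by simp
    qed
    \<comment> \<open>In an expansion of \<open>q\<close> every summand vanishes at
      \<open>i\<close>, so it comes from the perpendicular for the tail, where \<open>q\<close>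
      spans an extremal ray.\<close>
    have s2: "q \<in> B" if q: "q \<in> set ps" for q
    proof -
      have qPsi: "q \<in> Psi ?L w" using q 1 by auto
      obtain a where a: "\<And>q. a q \<ge> 0" "q = lin_comb B a"
        using nonneg_span_finite[OF _ finB, of q] qPsi B(2) by (metis subsetD)
      have "(\<Sum>b\<in>B. a b * b i) = 0" using arg_cong[OF a(2), of "\<lambda>v. v i"] psD(3)[OF q] by (simp add: lin_comb_def)
      moreover have "\<forall>b\<in>B. a b * b i \<ge> 0" using a(1) B(1) PsiD(2) i by (auto simp: positive_def)
      ultimately have ai: "\<forall>b\<in>B. a b * b i = 0" using finB sum_nonneg_eq_0_iff[of B "\<lambda>b. a b * b i"] by blast
      have inc: "b \<in> nonneg_span (set ps)" if "b \<in> B" "a b > 0" for b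
        using sub2[of b] ai that B(1) ps(2) by force
      have "\<exists>b\<in>B. a b > 0"
      proof (rule ccontr)
        assume "\<not> ?thesis"
        then have "\<forall>b\<in>B. a b = 0" using a(1) by (metis less_eq_real_def)
        then have "q = 0" unfolding a(2) lin_comb_eq by (simp add: sum.neutral)
        then show False using RR_nonzero psD(1)[OF q] by blast
      qed
      then obtain b where b: "b \<in> B" "a b > 0" by blast
      have eq: "q = a b *s b + (\<Sum>x\<in>B - {b}. a x *s x)"
        using a(2) sum.remove[OF finB b(1), of "\<lambda>x. a x *s x"] by (simp add: lin_comb_eq)
      have zin: "(\<Sum>x\<in>B - {b}. a x *s x) \<in> nonneg_span (set ps)"
      proof (rule nonneg_span_sum)
        fix x assume x: "x \<in> B - {b}"
        show "a x *s x \<in> nonneg_span (set ps)"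
        proof (cases "a x > 0")
          case True
          then show ?thesis using inc[of x] x a(1) by (intro nonneg_span_smul) auto
        next
          case False
          then have "a x = 0" using a(1)[of x] by simp
          then show ?thesis by (simp add: nonneg_span_zero)
        qed
      qed
      have "\<exists>t. b = t *s q"
      proof (rule indep_extremal[of "set ps" q "a b" b "\<Sum>x\<in>B - {b}. a x *s x"])
        show "a q = a' q" if "lin_comb (set ps) a = lin_comb (set ps) a'" "q \<in> set ps" for a a' q
          by (rule indps[OF that])
      qed (use q eq b inc[OF b] zin in auto)
      then obtain t where t: "b = t *s q" by blast
      have bR: "b \<in> RR" "pos b" using b(1) B(1) PsiD by blast+
      have "t > 0"
      proof -
        have "ht b = t * ht q" unfolding t by (rule lin_smul[OF lin_ht])
        then show ?thesis using ht_pos[OF bR] ht_pos[OF psD(1,2)[OF q]] by (simp add: zero_less_mult_iff)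
      qed
      then have "t = 1" using RR_multiple psD(1)[OF q] bR(1) t by blast
      then show ?thesis using t b by simp
    qed
    \<comment> \<open>A further element would lie in the span of those already found, against
      independence of \<open>B\<close>.\<close>
    show ?thesis
    proof (rule subsetI, rule ccontr)
      fix x assume x: "x \<in> B" "x \<notin> set ?ps"
      have xP: "x \<in> Psi ?L w" using x B by blast
      have "x \<in> lspan (set ?ps)"
        using 4[of x] Psi_D[OF xP] RR_supp by blast
      then obtain a where a: "x = lin_comb (set ?ps) a" using lspan_finite by blast
      have "set ?ps \<subseteq> B" using s1 s2 by auto
      then have "x = lin_comb B (\<lambda>q. if q \<in> set ?ps then a q else 0)" using a lin_comb_mono[OF finB] by metis
      moreover have "x = lin_comb B (\<lambda>q. if q = x then 1 else 0)" using lin_comb_single[OF finB x(1), of 1] by simp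
      ultimately have "lin_comb B (\<lambda>q. if q \<in> set ?ps then a q else 0) = lin_comb B (\<lambda>q. if q = x then 1 else 0)" by simp
      from indB[OF this x(1)] show False using x(2) by simp
    qed
  qed
  then have 2: "Psi ?L w \<subseteq> nonneg_span (set ?ps)" using B(2) nonneg_span_mono by blast
  show ?thesis unfolding reflection_factorization_def
    by (rule exI[of _ ?ps]) (use 1 2 3 4 5 in \<open>simp del: EL.simps cL.simps refl_prod.simps\<close>)
qed

text \<open>The number \<open>m\<close> of rotations that bring \<open>w\<close> to the simple root
  at the head is the measure for the inner induction of the factorization.\<close>

fun hit :: "nat \<Rightarrow> nat list \<Rightarrow> vec \<Rightarrow> bool" where
  "hit 0 L w = (L \<noteq> [] \<and> w = simple (hd L))"
| "hit (Suc m) L w = hit m (tl L @ [hd L]) (s (hd L) w)"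

lemma hit_shift: "hit (length M + m) (M @ R) w = hit m (R @ M) (cL (rev M) w)"
proof (induction M arbitrary: R w)
  case (Cons i M)
  have "hit (length (i # M) + m) ((i # M) @ R) w = hit (length M + m) (M @ (R @ [i])) (s i w)" by simp
  also have "\<dots> = hit m ((R @ [i]) @ M) (cL (rev M) (s i w))" by (rule Cons.IH)
  finally show ?case by (simp add: cL_append)
qed simp

lemma hit_pos: assumes "w \<in> RR" "pos w" "\<And>m. \<not> hit m (M @ R) w" "set M \<subseteq> {..<n}"
  shows "pos (cL (rev M) w)"
  using assms
proof (induction M arbitrary: R w)
  case (Cons i M)
  have i: "i < n" "set M \<subseteq> {..<n}" using Cons.prems by auto
  have "w \<noteq> simple i" using Cons.prems(3)[of 0] by simp
  then have p: "pos (s i w)" using RR_s_pos Cons.prems(1,2) i by blast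
  have "\<not> hit m (M @ (R @ [i])) (s i w)" for m using Cons.prems(3)[of "Suc m"] by simp
  then have "pos (cL (rev M) (s i w))" by (intro Cons.IH[of _ "R @ [i]"] RR_s p Cons.prems i)
  then show ?case by (simp add: cL_append)
qed simp

text \<open>Otherwise all powers of the inverse Coxeter element of \<open>L\<close> keep
  \<open>w\<close> positive. Only finitely many real roots vanish at \<open>f\<close>, so the orbit
  is periodic and its sum is fixed, isotropic and therefore zero, although it is a sum of positive
  roots.\<close>

lemma hit_ex: assumes w: "w \<in> RR" "pos w" "\<And>j. j \<notin> set L \<Longrightarrow> w j = 0"
    and L: "distinct L" "set L \<subseteq> {..<n}" and f: "f < n" "f \<notin> set L"
  shows "\<exists>m. hit m L w"
proof (rule ccontr)
  assume "\<nexists>m. hit m L w"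
  then have nh: "\<And>m. \<not> hit m L w" by blast
  define T where "T = cL (rev L)"
  have lT: "linv T" unfolding T_def by (rule linv_cL)
  have inv: "cL L (T v) = v" for v unfolding T_def using cL_rev[OF L(2)] .
  have Tj: "T v j = v j" if "j \<notin> set L" for v j unfolding T_def using that by (simp add: cL_coord)
  have P: "(T ^^ k) w \<in> RR \<and> pos ((T ^^ k) w) \<and> (\<forall>m. \<not> hit m L ((T ^^ k) w)) \<and> (\<forall>j. j \<notin> set L \<longrightarrow> (T ^^ k) w j = 0)" for k
  proof (induction k)
    case 0
    then show ?case using w nh by simp
  next
    case (Suc k)
    let ?v = "(T ^^ k) w"
    have TE: "T ?v = cL (rev L) ?v" by (simp add: T_def)
    have 1: "T ?v \<in> RR" unfolding TE by (rule cL_RR) (use Suc L in auto)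
    have 2: "pos (T ?v)" unfolding TE by (rule hit_pos[of _ L "[]"]) (use Suc L in auto)
    have 3: "\<not> hit m L (T ?v)" for m
      unfolding TE using hit_shift[of L m "[]" ?v] Suc by simp
    show ?case using 1 2 3 Suc Tj by simp
  qed
  have Tinj: "T u = T v \<longleftrightarrow> u = v" for u v using inv by metis
  have Tpinj: "(T ^^ k) u = (T ^^ k) v \<longleftrightarrow> u = v" for k u v by (induction k) (auto simp: Tinj)
  let ?f = "\<lambda>k. (T ^^ k) w"
  have "range ?f \<subseteq> {r \<in> RR. r f = 0}" using P f(2) by auto
  then have "finite (range ?f)" using finite_RR_zero[OF f(1)] finite_subset by blast
  then have "\<not> inj ?f" using finite_imageD infinite_UNIV_nat by blast
  then obtain a' b' where "a' \<noteq> b'" "?f a' = ?f b'" by (auto simp: inj_def)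
  then obtain a b where ab: "a < b" "?f b = ?f a" by (metis linorder_neqE_nat)
  have "?f b = (T ^^ a) ((T ^^ (b - a)) w)" using ab(1) funpow_add[of a "b - a" T] by simp
  then have per: "(T ^^ (b - a)) w = w" using ab(2) Tpinj by metis
  define N where "N = b - a"
  have N: "N > 0" "(T ^^ N) w = w" using ab(1) per by (auto simp: N_def)
  define y where "y = (\<Sum>l<N. (T ^^ l) w)"
  have "T y = (\<Sum>l<N. (T ^^ Suc l) w)" unfolding y_def by (simp add: linv_sum[OF lT])
  then have "T y - y = (T ^^ N) w - w"
    unfolding y_def using sum_lessThan_telescope[of "\<lambda>l. (T ^^ l) w" N] by (simp add: sum_subtractf)
  then have "T y = y" using N(2) by simp
  then have cy: "cL L y = y" using inv[of y] by simp
  have yz: "y j = 0" if "j \<notin> set L" for j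
    unfolding y_def sum_vec_apply using P that by (intro sum.neutral) blast
  have "(\<Sum>j\<in>set L. d j * y j * cp j y) = 0"
    using EL_cox[OF L, of y y] cy by (simp add: EL_lin)
  moreover have "K y y = (\<Sum>j\<in>set L. y j * d j * cp j y)"
    unfolding K_alt by (rule sum.mono_neutral_right) (use L yz in auto)
  ultimately have "K y y = 0" by (simp add: mult.commute[of "d _"])
  moreover have sy: "supp y" unfolding y_def using P RR_supp by (intro supported_sum) blast
  ultimately have y0: "y = 0" using K_pos_def[OF sy f(1) yz[OF f(2)]] by auto
  obtain j where j: "j < n" "w j > 0" using RR_pos_ex[OF w(1,2)] by blast
  have "y j > 0" unfolding y_def sum_vec_apply
  proof (rule sum_pos2[of _ 0])
    show "0 \<le> (T ^^ l) w j" if "l \<in> {..<N}" for l using P[of l] j(1) by (auto simp: positive_def)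
  qed (use N j in auto)
  then show False by (simp add: y0 vs)
qed

text \<open>Rotate the list by conjugating with its first reflection until \<open>w\<close> is the simple root at the head;
  whenever the head is a simple root orthogonal to \<open>w\<close>, split it off and pass to the shorter list.\<close>
lemma reflection_factorization_exists:
  assumes "distinct L" "set L \<subseteq> {..<n}" "f < n" "f \<notin> set L" "w \<in> RR" "pos w" "\<And>j. j \<notin> set L \<Longrightarrow> w j = 0"
  shows "reflection_factorization L w"
  using assms
proof (induction "length L" arbitrary: L w rule: less_induct)
  case less
  have inner: "reflection_factorization L' w'" if "hit m L' w'" "length L' = length L" "distinct L'" "set L' \<subseteq> {..<n}" "f \<notin> set L'"
     "w' \<in> RR" "pos w'" "\<And>j. j \<notin> set L' \<Longrightarrow> w' j = 0" for m L' w'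
    using that
  proof (induction m arbitrary: L' w')
    case 0
    then obtain i M where L': "L' = i # M" "w' = simple i" by (cases L') auto
    show ?case using reflection_factorization_simple[of i M] 0 unfolding L' by blast
  next
    case (Suc m)
    have "L' \<noteq> []" using Suc.prems RR_nonzero[OF Suc.prems(6)] by (auto simp: ptw)
    then obtain i M where L': "L' = i # M" by (cases L') auto
    have dL: "distinct (i # M)" "set (i # M) \<subseteq> {..<n}" "f \<notin> set (i # M)" using Suc.prems L' by auto
    have i: "i < n" using dL by auto
    have wz: "\<And>j. j \<notin> set (i # M) \<Longrightarrow> w' j = 0" using Suc.prems(8) L' by blast
    show ?case
    proof (cases "w' = simple i")
      case True
      show ?thesis using reflection_factorization_simple[OF dL(1,2)] True L' by blast
    next
      case False
      have ps: "pos (s i w')" using RR_s_pos Suc.prems(6,7) i False by blast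
      have sw: "s i w' \<in> RR" using RR_s Suc.prems(6) i by blast
      show ?thesis
      proof (cases "EL (i # M) w' (simple i) = 0")
        case True
        have "EL (i # M) (simple i) w' + EL (i # M) w' (simple i) = K (simple i) w'"
          by (rule EL_K[OF dL(1,2)]) (use wz in \<open>auto simp: simple_def\<close>)
        then have "d i * w' i = d i * cp i w'"
          using True dL(1) unfolding EL_head[of i M w', simplified] by (simp add: K_simple[OF i] EL_head del: EL.simps)
        then have "cp i w' = w' i" using d_pos[OF i] by simp
        then have "s i w' i = 0" by (simp add: s_eq vs)
        then have swz: "s i w' j = 0" if "j \<notin> set M" for j
          using that wz[of j] by (cases "j = i") (auto simp: s_outside)
        have "reflection_factorization M (s i w')"
          by (rule less.hyps) (use Suc.prems(2) L' dL swz sw ps less.prems(3) in auto)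
        then show ?thesis unfolding L' using reflection_factorization_drop[OF dL(1,2) less.prems(3) dL(3) Suc.prems(6) wz True] by blast
      next
        case neq: False
        have "reflection_factorization (M @ [i]) (s i w')"
        proof (rule Suc.IH)
          show "hit m (M @ [i]) (s i w')" using Suc.prems(1) L' by simp
          show "s i w' j = 0" if "j \<notin> set (M @ [i])" for j using that wz[of j] by (auto simp: s_outside)
        qed (use Suc.prems L' dL sw ps in auto)
        then show ?thesis unfolding L' using reflection_factorization_rotate[OF dL(1,2) Suc.prems(6) wz neq] by blast
      qed
    qed
  qed
  obtain m where "hit m L w" using hit_ex[OF less.prems(5,6,7) less.prems(1,2,3,4)] by blast
  then show ?case using inner less.prems by blast
qed

lemma tr_cL: "set M \<subseteq> {..<n} \<Longrightarrow> tr (cL M b) (cL M x) = cL M (tr b x)"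
  by (induction M) (auto simp: tr_conj s_invol)

lemma EL_remove: "distinct (M @ e # R) \<Longrightarrow> u e = 0 \<Longrightarrow> v e = 0 \<Longrightarrow> EL (M @ e # R) u v = EL (M @ R) u v"
  by (induction M) auto

end

section \<open>Tubes\<close>

locale affine_sp = affine +
  fixes e :: nat
  assumes e: "e < n" and special: "\<And>r. r \<in> RR \<Longrightarrow> \<exists>r'\<in>RR. r' e = 0 \<and> par r r'"
begin

definition Ups :: "vec set" where "Ups = {r \<in> RR. pos r \<and> E dl r = 0}"

lemma Ups_D: "r \<in> Ups \<Longrightarrow> r \<in> RR" "r \<in> Ups \<Longrightarrow> pos r" "r \<in> Ups \<Longrightarrow> E dl r = 0" by (auto simp: Ups_def)
lemma Ups_supp: "r \<in> Ups \<Longrightarrow> supp r" using Ups_D(1) RR_supp by blast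

text \<open>The relation between \<open>simple e\<close> and a root vanishing at \<open>e\<close> is
  transported by the reflections before \<open>e\<close>, which leave the coordinate at
  \<open>e\<close> alone.\<close>

lemma Pr_decomposition: obtains w x t where "w \<in> RR" "pos w" "w e = 0" "Pr e = x *s w + t *s dl" "x \<noteq> 0" "t \<noteq> 0"
proof -
  obtain r' where r': "r' \<in> RR" "r' e = 0" "par (simple e) r'" using special[OF RR_simple[OF e]] by blast
  then obtain x t where xt: "x \<noteq> 0" "simple e = x *s r' + t *s dl" by (auto simp: par_def)
  have t: "t \<noteq> 0" using arg_cong[OF xt(2), of "\<lambda>v. v e"] r'(2) by (auto simp: vs)
  have sub: "set [0..<e] \<subseteq> {..<n}" using e by auto
  define w where "w = cL [0..<e] r'"
  have w: "w \<in> RR" "w e = 0" unfolding w_def using cL_RR[OF sub r'(1)] r'(2) by (auto simp: cL_coord)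
  have P: "Pr e = x *s w + t *s dl"
    unfolding Pr_def xt(2) w_def using cL_dl[OF sub] by (simp add: linv_add[OF linv_cL] linv_smul[OF linv_cL])
  show ?thesis
  proof (cases "pos w")
    case True
    then show ?thesis using that w P xt(1) t by blast
  next
    case False
    then have "pos (- w)" using RR_sign w(1) by blast
    moreover have "Pr e = (- x) *s (- w) + t *s dl" unfolding P by (simp add: ptw)
    moreover have "(- w) e = 0" using w(2) by (simp add: vs)
    ultimately show ?thesis using that[of "- w" "- x" t] RR_neg[OF w(1)] xt(1) t by simp
  qed
qed

text \<open>Pulling the letter \<open>e\<close> out of \<open>c\<close> leaves the reflection in
  \<open>Pr e\<close> times the Coxeter element of the other nodes, whose factorization begins with
  the reflection in \<open>w\<close>. As \<open>Pr e\<close> is a multiple of \<open>w\<close>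
  modulo \<open>dl\<close>, these two reflections cancel modulo \<open>dl\<close>. For
  \<open>v e = 0\<close>, orthogonality to \<open>dl\<close> and to \<open>w\<close> agree because
  \<open>E (Pr e) v = d e * v e\<close>.\<close>

lemma fin_base_exists: "\<exists>ps. (\<forall>p\<in>set ps. p \<in> Ups \<and> p e = 0) \<and> {r \<in> Ups. r e = 0} \<subseteq> nonneg_span (set ps)
    \<and> (\<forall>p\<in>set ps. \<forall>q\<in>set ps. p \<noteq> q \<longrightarrow> E p q \<le> 0) \<and> (\<forall>v. \<exists>t. c v = refl_prod ps v + t *s dl)"
proof -
  obtain w x t where w: "w \<in> RR" "pos w" "w e = 0" "Pr e = x *s w + t *s dl" "x \<noteq> 0" "t \<noteq> 0"
    by (rule Pr_decomposition)
  let ?L = "[0..<e] @ [Suc e..<n]"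
  have L: "distinct ?L" "set ?L \<subseteq> {..<n}" "e \<notin> set ?L" using e by auto
  have out: "v j = 0" if "supp v" "v e = 0" "j \<notin> set ?L" for v j
  proof (cases "j < n")
    case True
    then have "j = e" using that(3) by auto
    then show ?thesis using that by simp
  next
    case False
    then show ?thesis using that(1) by (simp add: supported_def)
  qed
  have "reflection_factorization ?L w" by (rule reflection_factorization_exists[OF L(1,2) e L(3) w(1,2)]) (rule out[OF RR_supp[OF w(1)] w(3)])
  then obtain ps where ps: "set ps \<subseteq> Psi ?L w" "Psi ?L w \<subseteq> nonneg_span (set ps)"
     "\<And>p q. p\<in>set ps \<Longrightarrow> q\<in>set ps \<Longrightarrow> p \<noteq> q \<Longrightarrow> EL ?L p q \<le> 0"
     "\<And>v. cL ?L v = tr w (refl_prod ps v)"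
    unfolding reflection_factorization_def by auto
  have Eq: "E u v = EL ?L u v" if "u e = 0" "v e = 0" for u v
    unfolding upt_split[OF e] by (rule EL_remove) (use that in auto)
  have lev: "E dl v = 0 \<longleftrightarrow> E w v = 0" if "v e = 0" for v
  proof -
    have "0 = x * E w v + t * E dl v" using E_Pr[OF e, of v] that unfolding w(4) by (simp add: EL_lin)
    then show ?thesis using w(5,6) by auto
  qed
  have PsiU: "r \<in> Psi ?L w \<longleftrightarrow> r \<in> Ups \<and> r e = 0" for r
  proof
    assume r: "r \<in> Psi ?L w"
    have "r e = 0" using Psi_D(3)[OF r] L(3) by blast
    moreover from this have "E dl r = 0" using lev[of r] Eq[of w r, OF w(3)] Psi_D(4)[OF r] by simp
    ultimately show "r \<in> Ups \<and> r e = 0" using Psi_D(1,2)[OF r] by (simp add: Ups_def)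
  next
    assume r: "r \<in> Ups \<and> r e = 0"
    then have "EL ?L w r = 0" using lev[of r] Eq[of w r, OF w(3)] Ups_D(3) by simp
    then show "r \<in> Psi ?L w" unfolding Psi_def using r Ups_D out[OF Ups_supp] by blast
  qed
  have mem: "p \<in> Ups \<and> p e = 0" if "p \<in> set ps" for p using PsiU ps(1) that by blast
  have cv: "\<exists>z. c v = refl_prod ps v + z *s dl" for v
  proof -
    let ?y = "refl_prod ps v"
    have Kw: "K w w > 0" using RR_norm_pos[OF w(1)] .
    have K0: "K w w \<noteq> 0" using Kw by simp
    have sub: "set [0..<e] \<subseteq> {..<n}" using e by auto
    have "c v = cL [0..<e] (tr (simple e) (cL [Suc e..<n] v))"
      unfolding c_eq upt_split[OF e] by (simp add: cL_append tr_simple[OF e])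
    also have "\<dots> = tr (Pr e) (cL ?L v)"
      unfolding Pr_def cL_append by (rule tr_cL[OF sub, symmetric])
    also have "\<dots> = tr (Pr e) (tr w ?y)" using ps(4) by simp
    finally have c1: "c v = tr (Pr e) (tr w ?y)" .
    define u where "u = tr w ?y"
    have KP: "K (Pr e) u = x * K w u" "K (Pr e) (Pr e) = x * x * K w w" unfolding w(4) by (auto simp: K_lin)
    have "tr (Pr e) u = u - (2 * K w u / (x * K w w)) *s Pr e"
      unfolding tr_def KP using w(5) by simp
    also have "\<dots> = u - (2 * K w u / K w w) *s w - (2 * K w u / (x * K w w) * t) *s dl"
    proof -
      have "2 * K w u / (x * K w w) * x = 2 * K w u / K w w" using w(5) by simp
      then show ?thesis unfolding w(4) smul_add_right smul_smul by (simp add: diff_diff_eq)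
    qed
    also have "\<dots> = tr w u + (- (2 * K w u / (x * K w w) * t)) *s dl"
      unfolding tr_def by (simp add: ptw)
    also have "tr w u = ?y" unfolding u_def using tr_invol[OF K0] .
    finally show ?thesis unfolding c1 u_def by blast
  qed
  show ?thesis
    by (rule exI[of _ ps]) (use mem ps(2,3) PsiU cv Eq in auto)
qed

definition fin_base :: "vec list" where
  "fin_base = (SOME ps. (\<forall>p\<in>set ps. p \<in> Ups \<and> p e = 0) \<and> {r \<in> Ups. r e = 0} \<subseteq> nonneg_span (set ps)
    \<and> (\<forall>p\<in>set ps. \<forall>q\<in>set ps. p \<noteq> q \<longrightarrow> E p q \<le> 0) \<and> (\<forall>v. \<exists>t. c v = refl_prod ps v + t *s dl))"

lemma fin_base_props:
  shows "p \<in> set fin_base \<Longrightarrow> p \<in> Ups" "p \<in> set fin_base \<Longrightarrow> p e = 0" "r \<in> Ups \<Longrightarrow> r e = 0 \<Longrightarrow> r \<in> nonneg_span (set fin_base)"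
    "p \<in> set fin_base \<Longrightarrow> q \<in> set fin_base \<Longrightarrow> p \<noteq> q \<Longrightarrow> E p q \<le> 0" "\<exists>t. c v = refl_prod fin_base v + t *s dl"
proof -
  have h: "(\<forall>p\<in>set fin_base. p \<in> Ups \<and> p e = 0) \<and> {r \<in> Ups. r e = 0} \<subseteq> nonneg_span (set fin_base)
    \<and> (\<forall>p\<in>set fin_base. \<forall>q\<in>set fin_base. p \<noteq> q \<longrightarrow> E p q \<le> 0) \<and> (\<forall>v. \<exists>t. c v = refl_prod fin_base v + t *s dl)"
    unfolding fin_base_def by (rule someI_ex[OF fin_base_exists])
  then show "p \<in> set fin_base \<Longrightarrow> p \<in> Ups" "p \<in> set fin_base \<Longrightarrow> p e = 0" "r \<in> Ups \<Longrightarrow> r e = 0 \<Longrightarrow> r \<in> nonneg_span (set fin_base)"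
    "p \<in> set fin_base \<Longrightarrow> q \<in> set fin_base \<Longrightarrow> p \<noteq> q \<Longrightarrow> E p q \<le> 0" "\<exists>t. c v = refl_prod fin_base v + t *s dl"
    by blast+
qed

lemma fin_base_K: "p \<in> set fin_base \<Longrightarrow> q \<in> set fin_base \<Longrightarrow> p \<noteq> q \<Longrightarrow> K p q \<le> 0"
  using fin_base_props(4)[of p q] fin_base_props(4)[of q p] E_K[of p q] by simp

lemma fin_base_indep: "lin_comb (set fin_base) a = lin_comb (set fin_base) a' \<Longrightarrow> q \<in> set fin_base \<Longrightarrow> a q = a' q"
  by (rule pos_indep[OF e _ _ _ _ fin_base_K]) (auto intro: fin_base_props Ups_D)

lemma ci_dl: "ci dl = dl" using c_ci(2)[of dl] by (simp add: c_dl)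

lemma c_Ups: assumes "r \<in> Ups" shows "c r \<in> Ups" "ci r \<in> Ups"
  using assms c_RR c_pos_dl E_dl_c E_dl_ci by (auto simp: Ups_def)

text \<open>A finite stand-in for \<open>Ups\<close>: at most one root in each class modulo
  \<open>dl\<close>, and stable under \<open>c\<close> because \<open>c\<close> fixes
  \<open>dl\<close>.\<close>

definition Fm :: "vec set" where
  "Fm = {r \<in> Ups. \<forall>r'\<in>Ups. \<forall>a. r = r' + a *s dl \<longrightarrow> a \<le> 0}"

lemma Ups_min: assumes "r \<in> Ups" shows "\<exists>f\<in>Fm. \<exists>a\<ge>0. r = f + a *s dl"
proof -
  let ?P = "\<lambda>q. q \<in> Ups \<and> (\<exists>a. r = q + a *s dl)"
  have "r = r + 0 *s dl" by simp
  then have "?P r" using assms by blast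
  then obtain f where f: "?P f" and fm: "\<And>q. ?P q \<Longrightarrow> nat \<lfloor>f 0\<rfloor> \<le> nat \<lfloor>q 0\<rfloor>"
    using ex_has_least_nat[of ?P r "\<lambda>q. nat \<lfloor>q 0\<rfloor>"] by blast
  obtain a where a: "r = f + a *s dl" using f by blast
  have fU: "f \<in> Ups" using f by blast
  have "b \<le> 0" if q: "q \<in> Ups" "f = q + b *s dl" for q b
  proof (rule ccontr)
    assume b: "\<not> b \<le> 0"
    have "r = q + (b + a) *s dl" unfolding a q(2) by (simp add: smul_add_left)
    then have "nat \<lfloor>f 0\<rfloor> \<le> nat \<lfloor>q 0\<rfloor>" using fm q(1) by blast
    moreover have "f 0 = q 0 + b * dl 0" using arg_cong[OF q(2), of "\<lambda>v. v 0"] by (simp add: vs)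
    moreover have "b * dl 0 > 0" using b dl0 by simp
    moreover have "f 0 \<in> \<int>" "q 0 \<in> \<int>" using RR_ints(1)[OF Ups_D(1) n_pos] fU q(1) by blast+
    moreover have "q 0 \<ge> 0" using Ups_D(2)[OF q(1)] n_pos by (simp add: positive_def)
    ultimately show False by (auto elim!: Ints_cases)
  qed
  then have fF: "f \<in> Fm" using fU by (simp add: Fm_def)
  have "a \<ge> 0"
  proof (rule ccontr)
    assume "\<not> a \<ge> 0"
    moreover have "f = r + (- a) *s dl" unfolding a by (simp add: smul_uminus_left)
    ultimately show False using fF assms unfolding Fm_def by fastforce
  qed
  then show ?thesis using fF a by blast
qed

lemma finite_Fm: "finite Fm"
proof (rule inj_on_finite[of cp_vec _ "cp_vec ` RR"])
  show "inj_on cp_vec Fm"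
  proof (rule inj_onI)
    fix r q assume a: "r \<in> Fm" "q \<in> Fm" "cp_vec r = cp_vec q"
    have U: "r \<in> Ups" "q \<in> Ups" using a by (auto simp: Fm_def)
    obtain t where t: "r = q + t *s dl" using cp_vec_eq_dl[OF Ups_supp Ups_supp a(3)] U by blast
    then have "q = r + (- t) *s dl" by (simp add: smul_uminus_left)
    then have "- t \<le> 0" using a(2) U unfolding Fm_def by blast
    moreover have "t \<le> 0" using a(1) U t unfolding Fm_def by blast
    ultimately have "t = 0" by simp
    then show "r = q" using t by simp
  qed
qed (use finite_cp_vec Ups_D(1) in \<open>auto simp: Fm_def\<close>)

lemma c_Fm: assumes "r \<in> Fm" shows "c r \<in> Fm"
proof -
  have rU: "r \<in> Ups" using assms by (simp add: Fm_def)
  have "a \<le> 0" if "q \<in> Ups" "c r = q + a *s dl" for q a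
  proof -
    have "r = ci (c r)" by (simp add: c_ci)
    also have "\<dots> = ci q + a *s dl" unfolding that(2) by (simp add: linv_add[OF linv_c(2)] linv_smul[OF linv_c(2)] ci_dl)
    finally show ?thesis using assms c_Ups(2)[OF that(1)] unfolding Fm_def by blast
  qed
  then show ?thesis using c_Ups(1)[OF rU] by (simp add: Fm_def)
qed

lemma c_inj_on: "inj_on c X" by (rule inj_onI) (simp add: c_inj)

text \<open>The sum is fixed by \<open>c\<close>, hence a multiple of \<open>dl\<close>; heights
  determine the sign.\<close>

lemma c_stable_sum:
  assumes "finite X" "c ` X \<subseteq> X" "X \<subseteq> Ups" "X \<noteq> {}"
  shows "\<exists>m>0. (\<Sum>x\<in>X. x) = m *s dl"
proof -
  have img: "c ` X = X" using endo_inj_surj[OF assms(1,2) c_inj_on] .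
  let ?w = "\<Sum>x\<in>X. x"
  have "c ?w = (\<Sum>x\<in>X. c x)" by (rule linv_sum[OF linv_c(1)])
  also have "\<dots> = (\<Sum>x\<in>c ` X. x)" by (simp add: sum.reindex[OF c_inj_on])
  finally have "c ?w = ?w" using img by simp
  moreover have "supp ?w" using assms(3) Ups_supp by (intro supported_sum) blast
  ultimately obtain m where m: "?w = m *s dl" using c_fixed_dl by blast
  have "ht ?w = (\<Sum>x\<in>X. ht x)" by (rule lin_sum[OF lin_ht])
  also have "\<dots> > 0" using assms ht_pos Ups_D by (intro sum_pos) blast+
  finally have "m * ht dl > 0" unfolding m lin_smul[OF lin_ht] .
  moreover have "ht dl > 0" unfolding ht_def using dl_pos n_pos by (intro sum_pos) auto
  ultimately have "m > 0" by (simp add: zero_less_mult_iff)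
  then show ?thesis using m by blast
qed

end

text \<open>In rank two the kernel of \<open>E dl\<close> is spanned by \<open>dl\<close>, so the
  tubes contain no real root; \<open>dl\<close> then lies in no cone generated by
  \<open>Ups\<close>.\<close>

locale affine_tube = affine_sp +
  assumes Ups_ne: "Ups \<noteq> {}"
begin

lemma dl_Fm: "dl \<in> nonneg_span Fm"
proof -
  have "Fm \<noteq> {}" using Ups_ne Ups_min by blast
  then obtain m where m: "m > 0" "(\<Sum>x\<in>Fm. x) = m *s dl"
    using c_stable_sum[OF finite_Fm] c_Fm by (force simp: Fm_def)
  have "(\<Sum>x\<in>Fm. x) \<in> nonneg_span Fm" by (rule nonneg_span_sum) (rule nonneg_span_base)
  then have "m *s dl \<in> nonneg_span Fm" unfolding m(2) .
  then have "(1 / m) *s (m *s dl) \<in> nonneg_span Fm" by (rule nonneg_span_smul) (use m(1) in simp)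
  then show ?thesis using m(1) by simp
qed

lemma Ups_Fm: "Ups \<subseteq> nonneg_span Fm"
proof
  fix r assume "r \<in> Ups"
  then obtain f a where f: "f \<in> Fm" "a \<ge> 0" "r = f + a *s dl" using Ups_min by blast
  show "r \<in> nonneg_span Fm" unfolding f(3)
    by (rule nonneg_span_add[OF nonneg_span_base[OF f(1)] nonneg_span_smul[OF dl_Fm f(2)]])
qed

lemma Ups_cl: assumes "p \<in> Ups" "r \<in> Ups" "K p r > 0"
  shows "\<exists>m>0. r - m *s p \<in> Ups \<or> m *s p - r \<in> Ups"
proof -
  obtain m where m: "m > 0" "r - m *s p \<in> RR" using tr_pm_RR assms Ups_D(1) by blast
  have z: "E dl (r - m *s p) = 0" using assms Ups_D(3) by (simp add: EL_lin)
  show ?thesis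
  proof (cases "pos (r - m *s p)")
    case True
    then show ?thesis using m z by (auto simp: Ups_def)
  next
    case False
    then have "pos (- (r - m *s p))" using RR_sign m(2) by blast
    moreover have "E dl (- (r - m *s p)) = 0" unfolding lin_minus[OF lin_EL2] using z by simp
    ultimately have "- (r - m *s p) \<in> Ups" using RR_neg[OF m(2)] unfolding Ups_def by blast
    then show ?thesis using m(1) by auto
  qed
qed

section \<open>The simple system of the tubes\<close>

definition PI :: "vec set" where
  "PI = (SOME B. B \<subseteq> Fm \<and> Ups \<subseteq> nonneg_span B \<and> (\<forall>p\<in>B. \<forall>q\<in>B. p \<noteq> q \<longrightarrow> K p q \<le> 0) \<and>
    (\<forall>b\<in>B. b \<notin> nonneg_span (B - {b})))"

lemma PI_all: "PI \<subseteq> Fm \<and> Ups \<subseteq> nonneg_span PI \<and> (\<forall>p\<in>PI. \<forall>q\<in>PI. p \<noteq> q \<longrightarrow> K p q \<le> 0) \<and>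
    (\<forall>b\<in>PI. b \<notin> nonneg_span (PI - {b}))"
  unfolding PI_def
proof (rule someI_ex, rule base_exists[OF finite_Fm _ Ups_Fm lin_ht])
  show "Fm \<subseteq> Ups" by (auto simp: Fm_def)
  show "ht r > 0" if "r \<in> Ups" for r using ht_pos Ups_D that by blast
  show "\<exists>m>0. r - m *s p \<in> Ups \<or> m *s p - r \<in> Ups" if "p \<in> Fm" "r \<in> Fm" "p \<noteq> r" "K p r > 0" for p r
    using Ups_cl[of p r] that by (auto simp: Fm_def)
qed

lemma PI_Ups: "p \<in> PI \<Longrightarrow> p \<in> Ups" using PI_all by (auto simp: Fm_def)
lemma Ups_PI: "r \<in> Ups \<Longrightarrow> r \<in> nonneg_span PI" using PI_all by blast
lemma PI_K: "p \<in> PI \<Longrightarrow> q \<in> PI \<Longrightarrow> p \<noteq> q \<Longrightarrow> K p q \<le> 0" using PI_all by blast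
lemma PI_min: "p \<in> PI \<Longrightarrow> p \<notin> nonneg_span (PI - {p})" using PI_all by blast
lemma finite_PI: "finite PI" using PI_all finite_Fm finite_subset by blast
lemma PI_RR: "p \<in> PI \<Longrightarrow> p \<in> RR" using PI_Ups Ups_D by blast
lemma PI_pos: "p \<in> PI \<Longrightarrow> pos p" using PI_Ups Ups_D by blast
lemma PI_ge0: "p \<in> PI \<Longrightarrow> p j \<ge> 0" using pos_all PI_pos RR_supp PI_RR by blast

lemma cone_ge0: assumes "z \<in> nonneg_span X" "X \<subseteq> PI" shows "z j \<ge> 0"
  by (rule nonneg_span_ge[OF assms(1) lin_coord]) (use assms(2) PI_ge0 in blast)

lemma cone_supp: assumes "z \<in> nonneg_span X" "X \<subseteq> PI" shows "supp z"
  by (rule lspan_supported[of z X]) (use assms nonneg_span_lspan RR_supp PI_RR in blast)+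

lemma cone_ht0: assumes "z \<in> nonneg_span X" "X \<subseteq> PI" "ht z \<le> 0" shows "z = 0"
proof -
  have "ht z = 0" using nonneg_span_ge[OF assms(1) lin_ht] assms(2,3) ht_pos PI_RR PI_pos
    by (meson antisym less_imp_le subsetD)
  then have "\<forall>j\<in>{..<n}. z j = 0" unfolding ht_def
    by (subst (asm) sum_nonneg_eq_0_iff) (use cone_ge0[OF assms(1,2)] in auto)
  then show ?thesis using cone_supp[OF assms(1,2)] by (intro supported_eqI[of n]) (auto simp: vs supported_zero)
qed

text \<open>\<open>PI\<close> is dependent as soon as there are two orbits, since their sums are
  proportional, so \<open>indep_extremal\<close> does not apply. Extremality comes from minimality
  instead: a nonzero contribution of the other generators would make \<open>b\<close>
  redundant.\<close>

lemma PI_ext: assumes "b \<in> PI" "b = a *s u + z" "a > 0" "u \<in> nonneg_span PI" "z \<in> nonneg_span PI"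
  shows "\<exists>t. u = t *s b"
proof -
  obtain x u' where u: "x \<ge> 0" "u' \<in> nonneg_span (PI - {b})" "u = x *s b + u'" by (rule nonneg_span_split[OF assms(4,1)])
  obtain y z' where z: "y \<ge> 0" "z' \<in> nonneg_span (PI - {b})" "z = y *s b + z'" by (rule nonneg_span_split[OF assms(5,1)])
  let ?w = "a *s u' + z'"
  have eq: "b = (a * x + y) *s b + ?w"
  proof -
    have "b = a *s u + z" by (fact assms(2))
    also have "\<dots> = (a * x + y) *s b + ?w" unfolding u(3) z(3) by (simp add: ptw algebra_simps)
    finally show ?thesis .
  qed
  have w: "?w \<in> nonneg_span (PI - {b})" using u(2) z(2) assms(3) by (intro nonneg_span_add nonneg_span_smul) auto
  have "\<not> ht ?w > 0"
  proof
    assume "ht ?w > 0"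
    then have "b \<in> nonneg_span (PI - {b})"
      by (intro nonneg_span_absorb[OF eq w lin_ht ht_pos[OF PI_RR PI_pos]]) (use assms(1,3) u(1) z(1) in auto)
    then show False using PI_min assms(1) by blast
  qed
  moreover have "ht ?w = a * ht u' + ht z'" by (simp add: lin_add[OF lin_ht] lin_smul[OF lin_ht])
  moreover have "ht z' \<ge> 0" "ht u' \<ge> 0"
    by (rule nonneg_span_ge[OF z(2) lin_ht], use ht_pos PI_RR PI_pos less_imp_le in blast,
        rule nonneg_span_ge[OF u(2) lin_ht], use ht_pos PI_RR PI_pos less_imp_le in blast)
  ultimately have "a * ht u' \<le> 0" by linarith
  then have "ht u' \<le> 0" using assms(3) by (simp add: mult_le_0_iff)
  then have "u' = 0" using cone_ht0[OF u(2)] by blast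
  then show ?thesis using u(3) by auto
qed

lemma Ups_multiple: assumes "u \<in> Ups" "b \<in> Ups" "u = t *s b" shows "u = b"
proof -
  have "ht u = t * ht b" unfolding assms(3) by (rule lin_smul[OF lin_ht])
  then have "t > 0" using ht_pos Ups_D assms(1,2) by (metis zero_less_mult_pos2)
  then have "t = 1" using RR_multiple Ups_D(1) assms by blast
  then show ?thesis using assms(3) by simp
qed

lemma PI_ext_Ups: assumes "b \<in> PI" "b = a *s u + z" "a > 0" "u \<in> Ups" "z \<in> nonneg_span PI" shows "u = b"
  using PI_ext[OF assms(1-3) Ups_PI[OF assms(4)] assms(5)] Ups_multiple[OF assms(4) PI_Ups[OF assms(1)]] by blast

lemma cone_term: assumes "v \<in> nonneg_span X" "finite X" "v \<noteq> 0"
  obtains a q where "\<And>p. a p \<ge> 0" "v = lin_comb X a" "q \<in> X" "a q > 0"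
    "v = a q *s q + lin_comb (X - {q}) a" "lin_comb (X - {q}) a \<in> nonneg_span (X - {q})"
proof -
  obtain a where a: "\<And>p. a p \<ge> 0" "v = lin_comb X a" using nonneg_span_finite[OF assms(1,2)] by metis
  have "\<exists>q\<in>X. a q > 0"
  proof (rule ccontr)
    assume "\<not> ?thesis"
    then have "\<forall>q\<in>X. a q = 0" using a(1) by (metis less_eq_real_def)
    then have "v = 0" unfolding a(2) lin_comb_eq by (simp add: sum.neutral)
    then show False using assms(3) by simp
  qed
  then obtain q where q: "q \<in> X" "a q > 0" by blast
  have "v = a q *s q + lin_comb (X - {q}) a"
    unfolding a(2) lin_comb_eq using sum.remove[OF assms(2) q(1)] by blast
  moreover have "lin_comb (X - {q}) a \<in> nonneg_span (X - {q})"
    by (rule lin_comb_nonneg_span) (use assms(2) a in auto)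
  ultimately show ?thesis using that a q by blast
qed

lemma Ups_nz: "r \<in> Ups \<Longrightarrow> r \<noteq> 0" using Ups_D(1) RR_nonzero by blast

text \<open>Applying \<open>ci\<close> to an expansion of \<open>c p\<close> expands
  \<open>p\<close>, and extremality identifies \<open>p\<close> with the image of a member of
  \<open>PI\<close>.\<close>

lemma c_PI: assumes "p \<in> PI" shows "c p \<in> PI"
proof -
  have cU: "c p \<in> Ups" using c_Ups PI_Ups assms by blast
  obtain a q where q: "q \<in> PI" "a q > 0" "c p = a q *s q + lin_comb (PI - {q}) a" "lin_comb (PI - {q}) a \<in> nonneg_span (PI - {q})"
    by (rule cone_term[OF Ups_PI[OF cU] finite_PI Ups_nz[OF cU]])
  let ?z = "lin_comb (PI - {q}) a"
  have "p = ci (c p)" by (simp add: c_ci)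
  also have "\<dots> = a q *s ci q + ci ?z" unfolding q(3) by (simp add: linv_add[OF linv_c(2)] linv_smul[OF linv_c(2)])
  finally have eq: "p = a q *s ci q + ci ?z" .
  have "ci ?z \<in> nonneg_span (ci ` (PI - {q}))" by (rule nonneg_span_image[OF q(4) linv_c(2)])
  moreover have "ci ` (PI - {q}) \<subseteq> nonneg_span PI" using c_Ups(2) PI_Ups Ups_PI by blast
  ultimately have "ci ?z \<in> nonneg_span PI" by (rule nonneg_span_trans)
  then have "ci q = p" using PI_ext_Ups[OF assms eq q(2) c_Ups(2)[OF PI_Ups[OF q(1)]]] by blast
  then have "c p = q" using c_ci(1) by metis
  then show ?thesis using q(1) by simp
qed

lemma c_PI_img: "c ` PI = PI"
  using endo_inj_surj[OF finite_PI _ c_inj_on] c_PI by blast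

lemma ci_PI: assumes "p \<in> PI" shows "ci p \<in> PI"
  using c_PI_img assms c_ci(2) by (metis imageE)

lemma cpow_PI: "p \<in> PI \<Longrightarrow> (c ^^ k) p \<in> PI" by (induction k) (auto intro: c_PI)

section \<open>Orbits of the Coxeter element on the simple system\<close>

definition orb :: "vec \<Rightarrow> vec set" where "orb p = range (\<lambda>k. (c ^^ k) p)"

lemma orb_self: "p \<in> orb p" unfolding orb_def by (rule range_eqI[of _ _ 0]) simp
lemma orb_PI: "p \<in> PI \<Longrightarrow> orb p \<subseteq> PI" unfolding orb_def using cpow_PI by blast
lemma orbI: "q = (c ^^ k) p \<Longrightarrow> q \<in> orb p" unfolding orb_def by (rule range_eqI)
lemma orbE: assumes "q \<in> orb p" obtains k where "q = (c ^^ k) p" using assms by (auto simp: orb_def)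

lemma orb_c: assumes "q \<in> orb p" shows "c q \<in> orb p"
proof -
  obtain k where "q = (c ^^ k) p" by (rule orbE[OF assms])
  then have "c q = (c ^^ Suc k) p" by simp
  then show ?thesis by (rule orbI)
qed

lemma c_order: assumes "p \<in> PI" shows "\<exists>N>0. (c ^^ N) p = p"
proof -
  let ?f = "\<lambda>k. (c ^^ k) p"
  have "finite (range ?f)" by (rule finite_subset[OF _ finite_PI]) (use cpow_PI assms in blast)
  then have "\<not> inj ?f" using finite_imageD infinite_UNIV_nat by blast
  then obtain a' b' where "a' \<noteq> b'" "?f a' = ?f b'" by (auto simp: inj_def)
  then obtain a b where ab: "a < b" "?f b = ?f a" by (metis linorder_neqE_nat)
  have "?f b = (c ^^ a) ((c ^^ (b - a)) p)" using ab(1) funpow_add[of a "b - a" c] by simp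
  then have "(c ^^ (b - a)) p = p" using ab(2) cpow_inj by metis
  then show ?thesis using ab(1) by (metis zero_less_diff)
qed

text \<open>\<open>orb\<close> uses only nonnegative powers; finite order on \<open>PI\<close>
  supplies the inverses.\<close>

lemma orb_sym: assumes "p \<in> PI" "q \<in> orb p" shows "p \<in> orb q"
proof -
  obtain k where k: "q = (c ^^ k) p" using assms(2) by (auto simp: orb_def)
  obtain N where N: "N > 0" "(c ^^ N) p = p" using c_order[OF assms(1)] by blast
  have m: "(c ^^ (N * j)) p = p" for j by (induction j) (auto simp: funpow_add N(2))
  have "k \<le> N * k" using N(1) by simp
  then have "(c ^^ (N * k)) p = (c ^^ (N * k - k)) q"
    unfolding k using funpow_add[of "N * k - k" k c] by simp
  then have "p = (c ^^ (N * k - k)) q" using m[of k] by simp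
  then show ?thesis by (rule orbI)
qed

lemma orb_trans: assumes "q \<in> orb p" "r \<in> orb q" shows "r \<in> orb p"
proof -
  obtain k l where "q = (c ^^ k) p" "r = (c ^^ l) q" using assms by (auto elim!: orbE)
  then have "r = (c ^^ (l + k)) p" by (simp add: funpow_add)
  then show ?thesis by (rule orbI)
qed

lemma orb_eq: "p \<in> PI \<Longrightarrow> q \<in> orb p \<Longrightarrow> orb q = orb p"
  using orb_trans orb_sym by blast

lemma finite_orb: "p \<in> PI \<Longrightarrow> finite (orb p)" by (rule finite_subset[OF orb_PI finite_PI])

lemma orb_sum: assumes "p \<in> PI" shows "\<exists>m>0. (\<Sum>x\<in>orb p. x) = m *s dl"
proof (rule c_stable_sum[OF finite_orb[OF assms]])
  show "c ` orb p \<subseteq> orb p" using orb_c by blast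
  show "orb p \<subseteq> Ups" using orb_PI[OF assms] PI_Ups by blast
  show "orb p \<noteq> {}" using orb_self by blast
qed

lemma E_orb_sum: assumes "p \<in> PI" "E dl q = 0" shows "(\<Sum>x\<in>orb p. E x q) = 0"
proof -
  obtain m where "(\<Sum>x\<in>orb p. x) = m *s dl" using orb_sum[OF assms(1)] by blast
  then have "E (\<Sum>x\<in>orb p. x) q = 0" using assms(2) by (simp add: EL_lin)
  then show ?thesis by (simp add: lin_sum[OF lin_EL1])
qed

text \<open>Nonpositivity of \<open>K\<close> together with \<open>E_c\<close> propagates
  \<open>E p q > 0\<close> along the whole orbit of \<open>p\<close>; but the orbit sum is a
  multiple of \<open>dl\<close>, which is orthogonal to \<open>q\<close>.\<close>

lemma E_cross_nonpos: assumes "p \<in> PI" "q \<in> PI" "q \<notin> orb p" shows "E p q \<le> 0"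
proof (rule ccontr)
  assume "\<not> ?thesis"
  then have p0: "E p q > 0" by simp
  have "E ((c ^^ k) p) q > 0" for k
  proof (induction k)
    case (Suc k)
    let ?y = "(c ^^ k) p"
    have "?y \<in> orb p" by (auto simp: orb_def)
    then have "?y \<noteq> q" "?y \<in> PI" using assms orb_PI by blast+
    then have "K ?y q \<le> 0" using PI_K assms(2) by blast
    then have "E q ?y < 0" using Suc E_K[of ?y q] by simp
    then show ?case using E_c[of q ?y] by simp
  qed (simp add: p0)
  then have "(\<Sum>x\<in>orb p. E x q) > 0"
    using finite_orb[OF assms(1)] orb_self by (intro sum_pos) (auto simp: orb_def)
  then show False using E_orb_sum[OF assms(1) Ups_D(3)[OF PI_Ups[OF assms(2)]]] by simp
qed

lemma E_cross: assumes "p \<in> PI" "q \<in> PI" "q \<notin> orb p" shows "E p q = 0"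
proof -
  have "E x q \<le> 0" if x: "x \<in> orb p" for x
    using E_cross_nonpos[of x q] x assms orb_PI orb_eq[OF assms(1) x] by blast
  then have "\<forall>x\<in>orb p. - E x q = 0"
    using E_orb_sum[OF assms(1) Ups_D(3)[OF PI_Ups[OF assms(2)]]] finite_orb[OF assms(1)]
      sum_nonneg_eq_0_iff[of "orb p" "\<lambda>x. - E x q"] by (simp add: sum_negf)
  then show ?thesis using orb_self by force
qed

lemma K_cross: assumes "p \<in> PI" "q \<in> PI" "q \<notin> orb p" shows "K p q = 0"
  using E_cross[OF assms] E_cross[of q p] assms orb_sym E_K[of p q] by fastforce

section \<open>Comparison of the simple system with its part vanishing at \<open>e\<close>\<close>

lemma fin_base_PI: assumes "p \<in> set fin_base" shows "p \<in> PI"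
proof -
  have pU: "p \<in> Ups" using fin_base_props(1) assms by blast
  obtain a q where q: "\<And>p. a p \<ge> 0" "p = lin_comb PI a" "q \<in> PI" "a q > 0" "p = a q *s q + lin_comb (PI - {q}) a"
    using cone_term[OF Ups_PI[OF pU] finite_PI Ups_nz[OF pU]] by metis
  \<comment> \<open>No term can contribute at \<open>e\<close>, so the terms with positive
    coefficient lie in the cone of \<open>fin_base\<close>, where \<open>p\<close> is
    extremal.\<close>
  have "(\<Sum>x\<in>PI. a x * x e) = 0" using arg_cong[OF q(2), of "\<lambda>v. v e"] fin_base_props(2)[OF assms] by (simp add: lin_comb_def)
  then have ae: "\<forall>x\<in>PI. a x * x e = 0"
    using sum_nonneg_eq_0_iff[OF finite_PI, of "\<lambda>x. a x * x e"] q(1) PI_ge0 by (simp add: mult_nonneg_nonneg)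
  have inc: "x \<in> nonneg_span (set fin_base)" if "x \<in> PI" "a x > 0" for x
    using fin_base_props(3)[OF PI_Ups[OF that(1)]] ae that by force
  have "\<exists>t. q = t *s p"
  proof (rule indep_extremal[of "set fin_base" p "a q" q "lin_comb (PI - {q}) a"])
    show "a q = a' q" if "lin_comb (set fin_base) a = lin_comb (set fin_base) a'" "q \<in> set fin_base" for a a' q
      by (rule fin_base_indep[OF that])
    show "lin_comb (PI - {q}) a \<in> nonneg_span (set fin_base)" unfolding lin_comb_eq
    proof (rule nonneg_span_sum)
      fix x assume x: "x \<in> PI - {q}"
      show "a x *s x \<in> nonneg_span (set fin_base)"
      proof (cases "a x > 0")
        case True
        then show ?thesis using inc[of x] x by (intro nonneg_span_smul) auto
      next
        case False
        then have "a x = 0" using q(1)[of x] by simp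
        then show ?thesis by (simp add: nonneg_span_zero)
      qed
    qed
    show "q \<in> nonneg_span (set fin_base)" using inc q(3,4) by blast
  qed (use assms q in auto)
  then have "q = p" using Ups_multiple PI_Ups[OF q(3)] pU by blast
  then show ?thesis using q(3) by simp
qed

lemma PI_fin_base: assumes "q \<in> PI" "q e = 0" shows "q \<in> set fin_base"
proof -
  have qU: "q \<in> Ups" using assms PI_Ups by blast
  obtain a p where p: "p \<in> set fin_base" "a p > 0" "q = a p *s p + lin_comb (set fin_base - {p}) a"
      "lin_comb (set fin_base - {p}) a \<in> nonneg_span (set fin_base - {p})"
    by (rule cone_term[OF fin_base_props(3)[OF qU assms(2)] finite_set Ups_nz[OF qU]])
  have "set fin_base - {p} \<subseteq> PI" using fin_base_PI by blast
  then have "lin_comb (set fin_base - {p}) a \<in> nonneg_span PI" using p(4) nonneg_span_mono by blast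
  then have "p = q" using PI_ext_Ups[OF assms(1) p(3,2) fin_base_props(1)[OF p(1)]] by blast
  then show ?thesis using p(1) by simp
qed

text \<open>The special node supplies a root vanishing at \<open>e\<close> that is parallel to
  \<open>p\<close> modulo \<open>dl\<close>; up to sign it lies in the cone of
  \<open>fin_base\<close>.\<close>

lemma PI_span: assumes "p \<in> PI" shows "\<exists>a t. p = lin_comb (set fin_base) a + t *s dl"
proof -
  obtain r where r: "r \<in> RR" "r e = 0" "par p r" using special[OF PI_RR[OF assms]] by blast
  then obtain x t where xt: "x \<noteq> 0" "p = x *s r + t *s dl" by (auto simp: par_def)
  have "E dl p = 0" using PI_Ups Ups_D(3) assms by blast
  then have Er: "E dl r = 0" using xt unfolding xt(2) by (simp add: EL_lin E_dl_dl)
  have "r \<in> lspan (set fin_base)"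
  proof (cases "pos r")
    case True
    then have "r \<in> Ups" using r Er by (simp add: Ups_def)
    then show ?thesis using fin_base_props(3) r(2) nonneg_span_lspan by blast
  next
    case False
    then have "pos (- r)" using RR_sign r(1) by blast
    moreover have "E dl (- r) = 0" using Er by (simp add: EL_lin)
    ultimately have "- r \<in> Ups" using RR_neg[OF r(1)] by (simp add: Ups_def)
    moreover have "(- r) e = 0" using r(2) by (simp add: vs)
    ultimately have "- r \<in> lspan (set fin_base)" using fin_base_props(3)[of "- r"] nonneg_span_lspan by blast
    then show ?thesis using lspan_minus[of "- r"] by simp
  qed
  then have "x *s r \<in> lspan (set fin_base)" by (rule lspan_smul)
  then obtain a where "x *s r = lin_comb (set fin_base) a" using lspan_finite[of _ "set fin_base"] by blast
  then show ?thesis using xt(2) by metis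
qed

lemma refl_prod_span: assumes "u \<in> lspan Y" "\<And>p y. p \<in> set ps \<Longrightarrow> p \<notin> Y \<Longrightarrow> y \<in> Y \<Longrightarrow> K p y = 0"
  shows "refl_prod ps u \<in> lspan Y"
  using assms(2)
proof (induction ps)
  case Nil
  show ?case using assms(1) by simp
next
  case (Cons p ps)
  have IH: "refl_prod ps u \<in> lspan Y" using Cons by simp
  show ?case
  proof (cases "p \<in> Y")
    case True
    then show ?thesis unfolding refl_prod.simps tr_def by (intro lspan_diff IH lspan_smul lspan_base)
  next
    case False
    have "K p (refl_prod ps u) = 0" by (rule lspan_lin_zero[OF IH lin_K]) (use Cons.prems False in auto)
    then show ?thesis using IH by (simp add: tr_def)
  qed
qed

lemma K_fin_base_lin: "K v (lin_comb (set fin_base) a) = (\<Sum>q\<in>set fin_base. a q * K v q)"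
  by (rule lin_comb_lin[OF lin_K])

lemma fin_base_comb_zero: assumes "K (lin_comb (set fin_base) a) (lin_comb (set fin_base) a) = 0" "q \<in> set fin_base" shows "a q = 0"
proof -
  let ?y = "lin_comb (set fin_base) a"
  have sy: "supp ?y" by (rule supported_lin_comb) (use fin_base_PI PI_RR RR_supp in blast)
  have "?y e = 0" unfolding lin_comb_def by (rule sum.neutral) (use fin_base_props(2) in auto)
  then have "?y = 0" using K_pos_def[OF sy e] assms(1) by force
  moreover have "lin_comb (set fin_base) (\<lambda>_. 0) = 0" by (simp add: lin_comb_eq)
  ultimately show ?thesis using fin_base_indep[of a "\<lambda>_. 0" q] assms(2) by simp
qed

lemma K_cross2: "o' \<in> PI \<Longrightarrow> q \<in> PI \<Longrightarrow> q' \<in> PI \<Longrightarrow> q \<in> orb o' \<Longrightarrow> q' \<notin> orb o' \<Longrightarrow> K q q' = 0"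
  using K_cross orb_eq by metis

text \<open>A member of \<open>PI\<close> that does not vanish at \<open>e\<close> acts as the
  affine node of its orbit: like the negative of a highest root, it is modulo \<open>dl\<close> a
  strictly negative combination of all the other nodes of the orbit.\<close>

lemma out_coeff: assumes o': "o' \<in> PI" "o' e \<noteq> 0"
  shows "\<exists>a t. o' = lin_comb (set fin_base) a + t *s dl \<and> (\<forall>q\<in>set fin_base. q \<notin> orb o' \<longrightarrow> a q = 0)
    \<and> (\<forall>q\<in>set fin_base. q \<in> orb o' \<longrightarrow> a q < 0)"
proof -
  let ?X = "set fin_base" and ?O = "orb o'"
  obtain a t where at: "o' = lin_comb ?X a + t *s dl" using PI_span[OF o'(1)] by blast
  have Ko: "K v o' = (\<Sum>q\<in>?X. a q * K v q)" for v
    by (subst at) (simp add: K_lin K_fin_base_lin)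
  have oX: "q \<noteq> o'" if "q \<in> ?X" for q using fin_base_props(2)[OF that] o'(2) by auto
  \<comment> \<open>The part of the combination outside the orbit is orthogonal to
    \<open>o'\<close>, while its pairing with \<open>o'\<close> equals its own norm.\<close>
  have a0: "a q = 0" if q: "q \<in> ?X" "q \<notin> ?O" for q
  proof -
    define b where "b q = (if q \<in> ?O then 0 else a q)" for q
    let ?y = "lin_comb ?X b"
    have "K ?y q' = (\<Sum>q\<in>?X. b q * K q q')" for q' by (rule lin_comb_lin[OF lin_K2])
    have yq: "K ?y q' = 0" if "q' \<in> PI" "q' \<in> ?O" for q'
      unfolding lin_comb_lin[OF lin_K2]
      by (rule sum.neutral) (use K_cross2[OF o'(1) that(1) fin_base_PI that(2)] K_sym in \<open>auto simp: b_def\<close>)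
    have "K ?y o' = 0" using yq o'(1) orb_self by blast
    moreover have "K ?y o' = (\<Sum>q\<in>?X. b q * K ?y q)" unfolding Ko
    proof (rule sum.cong[OF HOL.refl])
      fix q assume "q \<in> ?X"
      then show "a q * K ?y q = b q * K ?y q" using yq[OF fin_base_PI] by (auto simp: b_def)
    qed
    ultimately have "K ?y ?y = 0" by (simp add: K_fin_base_lin)
    then have "b q = 0" using fin_base_comb_zero q(1) by blast
    then show ?thesis using q(2) by (simp add: b_def)
  qed
  \<comment> \<open>The positive part \<open>?z\<close> satisfies
    \<open>K ?z ?z \<le> K ?z o' \<le> 0\<close>.\<close>
  have aneg: "a q \<le> 0" if q: "q \<in> ?X" for q
  proof -
    define b where "b q = max (a q) 0" for q
    define m where "m q = max (- a q) 0" for q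
    have bm: "a q = b q - m q" "b q \<ge> 0" "m q \<ge> 0" "b q * m q = 0" for q by (auto simp: b_def m_def max_def)
    let ?z = "lin_comb ?X b"
    have "K ?z o' = (\<Sum>q\<in>?X. b q * K q o')" by (rule lin_comb_lin[OF lin_K2])
    also have "\<dots> \<le> 0" using PI_K[OF fin_base_PI o'(1) oX] bm(2) by (intro sum_nonpos mult_nonneg_nonpos) auto
    finally have "K ?z o' \<le> 0" .
    moreover have "K ?z o' = K ?z ?z - (\<Sum>q\<in>?X. m q * K ?z q)"
      unfolding Ko K_fin_base_lin by (simp add: bm(1) left_diff_distrib sum_subtractf)
    moreover have "(\<Sum>q\<in>?X. m q * K ?z q) \<le> 0"
    proof (rule sum_nonpos)
      fix q assume q: "q \<in> ?X"
      have "m q * K ?z q = (\<Sum>p\<in>?X. m q * (b p * K p q))" by (simp add: lin_comb_lin[OF lin_K2] sum_distrib_left)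
      also have "\<dots> \<le> 0"
      proof (rule sum_nonpos)
        fix p assume p: "p \<in> ?X"
        show "m q * (b p * K p q) \<le> 0"
        proof (cases "p = q")
          case True
          have "m q * (b q * K q q) = (b q * m q) * K q q" by simp
          then show ?thesis using True bm(4)[of q] by auto
        next
          case False
          then show ?thesis using fin_base_K[OF p q] bm(2,3) by (simp add: mult_nonneg_nonpos)
        qed
      qed
      finally show "m q * K ?z q \<le> 0" .
    qed
    ultimately have "K ?z ?z = 0" using K_nonneg[of ?z] by linarith
    then have "b q = 0" using fin_base_comb_zero q by blast
    then show ?thesis by (simp add: b_def max_def split: if_splits)
  qed
  have "a q < 0" if q: "q \<in> ?X" "q \<in> ?O" for q
  proof (rule ccontr)
    assume "\<not> a q < 0"
    then have aq: "a q = 0" using aneg[OF q(1)] by simp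
    \<comment> \<open>The support of \<open>a\<close> is orthogonal to the rest of
      \<open>fin_base\<close>, so by the factorization of \<open>c\<close> its span is stable under
      \<open>c\<close> modulo \<open>dl\<close>. The orbit of one of its members then cannot reach
      \<open>q\<close>.\<close>
    define Y where "Y = {y \<in> ?X. y \<in> ?O \<and> a y \<noteq> 0}"
    have cond: "K p y = 0" if p: "p \<in> ?X" "p \<notin> Y" and y: "y \<in> Y" for p y
    proof (cases "p \<in> ?O")
      case False
      have "y \<in> ?X" "y \<in> ?O" using y by (auto simp: Y_def)
      then have "K y p = 0" using K_cross2[OF o'(1) fin_base_PI fin_base_PI, of y p] p(1) False by blast
      then show ?thesis using K_sym[of y p] by simp
    next
      case True
      then have ap: "a p = 0" using p by (simp add: Y_def)
      have terms: "a x * K p x \<ge> 0" if "x \<in> ?X" for x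
        using aneg[OF that] fin_base_K[OF p(1) that] ap by (cases "x = p") (auto intro: mult_nonpos_nonpos)
      have "K p o' \<le> 0" using PI_K[OF fin_base_PI[OF p(1)] o'(1) oX[OF p(1)]] .
      then have "(\<Sum>x\<in>?X. a x * K p x) = 0" using Ko[of p] sum_nonneg[of ?X "\<lambda>x. a x * K p x"] terms by simp
      then have "a y * K p y = 0" using sum_nonneg_eq_0_iff[of ?X "\<lambda>x. a x * K p x"] terms y by (auto simp: Y_def)
      then show ?thesis using y by (simp add: Y_def)
    qed
    have "Y \<noteq> {}"
    proof
      assume "Y = {}"
      then have "\<forall>q\<in>?X. a q = 0" using a0 by (auto simp: Y_def)
      then have "K o' o' = 0" by (simp add: Ko)
      then show False using RR_norm_pos PI_RR o'(1) by fastforce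
    qed
    then obtain y0 where y0: "y0 \<in> Y" by blast
    have sp: "\<exists>u t. u \<in> lspan Y \<and> (c ^^ k) y0 = u + t *s dl" for k
    proof (induction k)
      case 0
      have "(c ^^ 0) y0 = y0 + 0 *s dl" by simp
      then show ?case using lspan_base[OF y0] by blast
    next
      case (Suc k)
      then obtain u t where u: "u \<in> lspan Y" "(c ^^ k) y0 = u + t *s dl" by blast
      obtain t' where t': "c u = refl_prod fin_base u + t' *s dl" using fin_base_props(5) by blast
      have "(c ^^ Suc k) y0 = c (u + t *s dl)" using u(2) by simp
      also have "\<dots> = refl_prod fin_base u + (t' + t) *s dl"
        by (simp add: linv_add[OF linv_c(1)] linv_smul[OF linv_c(1)] c_dl t' smul_add_left)
      finally show ?case using refl_prod_span[OF u(1) cond] by blast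
    qed
    have "y0 \<in> ?O" "y0 \<in> PI" using y0 fin_base_PI by (auto simp: Y_def)
    then have "q \<in> orb y0" using q(2) orb_eq o'(1) by blast
    then obtain k where "q = (c ^^ k) y0" by (rule orbE)
    then obtain u t where u: "u \<in> lspan Y" "q = u + t *s dl" using sp by metis
    have "u e = 0" using lspan_lin_zero[OF u(1) lin_coord[of e]] fin_base_props(2) by (auto simp: Y_def)
    then have "t = 0" using arg_cong[OF u(2), of "\<lambda>v. v e"] fin_base_props(2)[OF q(1)] dl_pos[OF e] by (simp add: vs)
    then have "q \<in> lspan Y" using u by simp
    moreover have fY: "finite Y" by (simp add: Y_def)
    ultimately obtain b where b: "q = lin_comb Y b" using lspan_finite by metis
    have "q = lin_comb ?X (\<lambda>x. if x \<in> Y then b x else 0)"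
      unfolding b by (rule lin_comb_mono) (auto simp: Y_def)
    moreover have "lin_comb ?X (\<lambda>x. if x = q then 1 else 0) = q" using lin_comb_single[OF _ q(1), of 1] by simp
    ultimately have "lin_comb ?X (\<lambda>x. if x = q then 1 else 0) = lin_comb ?X (\<lambda>x. if x \<in> Y then b x else 0)" by simp
    from fin_base_indep[OF this q(1)] show False using aq by (simp add: Y_def)
  qed
  then show ?thesis using at a0 by blast
qed

text \<open>Pairing the expansion of \<open>o1\<close> with \<open>o2\<close> gives a nonpositive
  number as a sum of nonnegative terms. The coefficients being strictly negative, \<open>o2\<close>
  is orthogonal to the members of \<open>fin_base\<close> in the orbit, hence isotropic by its own
  expansion.\<close>

lemma out_unique: assumes "p \<in> PI" "o1 \<in> orb p" "o2 \<in> orb p" "o1 e \<noteq> 0" "o2 e \<noteq> 0" shows "o1 = o2"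
proof (rule ccontr)
  assume ne: "o1 \<noteq> o2"
  have P: "o1 \<in> PI" "o2 \<in> PI" using assms orb_PI by blast+
  obtain a1 t1 where a1: "o1 = lin_comb (set fin_base) a1 + t1 *s dl" "\<forall>q\<in>set fin_base. q \<notin> orb o1 \<longrightarrow> a1 q = 0"
    "\<forall>q\<in>set fin_base. q \<in> orb o1 \<longrightarrow> a1 q < 0" using out_coeff[OF P(1) assms(4)] by blast
  obtain a2 t2 where a2: "o2 = lin_comb (set fin_base) a2 + t2 *s dl" "\<forall>q\<in>set fin_base. q \<notin> orb o2 \<longrightarrow> a2 q = 0"
    using out_coeff[OF P(2) assms(5)] by blast
  have oo: "orb o1 = orb o2" using orb_eq assms by metis
  have K1: "K o2 o1 = (\<Sum>q\<in>set fin_base. a1 q * K o2 q)" by (subst a1(1)) (simp add: K_lin K_fin_base_lin)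
  have K2: "K o2 o2 = (\<Sum>q\<in>set fin_base. a2 q * K o2 q)" by (subst (2) a2(1)) (simp add: K_lin K_fin_base_lin)
  have neg: "K o2 q \<le> 0" if "q \<in> set fin_base" for q
    using PI_K[OF P(2) fin_base_PI[OF that]] fin_base_props(2)[OF that] assms(5) by force
  have terms: "a1 q * K o2 q \<ge> 0" if "q \<in> set fin_base" for q
    using neg[OF that] a1(2,3) that by (cases "q \<in> orb o1") (auto intro: mult_nonpos_nonpos less_imp_le)
  have "K o2 o1 \<le> 0" using PI_K P ne by blast
  then have "(\<Sum>q\<in>set fin_base. a1 q * K o2 q) = 0" using K1 sum_nonneg[of "set fin_base" "\<lambda>q. a1 q * K o2 q"] terms by simp
  then have z: "\<forall>q\<in>set fin_base. a1 q * K o2 q = 0"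
    using sum_nonneg_eq_0_iff[of "set fin_base" "\<lambda>q. a1 q * K o2 q"] terms by simp
  have "a2 q * K o2 q = 0" if "q \<in> set fin_base" for q
    using z that a1(3) a2(2) oo by (cases "q \<in> orb o1") fastforce+
  then have "K o2 o2 = 0" unfolding K2 by (rule sum.neutral[OF ballI])
  then show False using RR_norm_pos PI_RR P(2) by fastforce
qed

lemma out_exists: assumes "p \<in> PI" "j < n" shows "\<exists>x\<in>orb p. x j > 0"
proof -
  obtain m where m: "m > 0" "(\<Sum>x\<in>orb p. x) = m *s dl" using orb_sum[OF assms(1)] by blast
  have "(\<Sum>x\<in>orb p. x j) = m * dl j" using arg_cong[OF m(2), of "\<lambda>v. v j"] by (simp add: sum_vec_apply vs)
  then have "(\<Sum>x\<in>orb p. x j) > 0" using m(1) dl_pos[OF assms(2)] by simp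
  then show ?thesis by (meson sum_nonpos not_le)
qed

section \<open>Values of the Euler form on the simple system\<close>

lemma E_self: "E p p = K p p / 2" using E_K[of p p] by simp
lemma E_self_pos: "p \<in> PI \<Longrightarrow> E p p > 0" using RR_norm_pos[OF PI_RR] by (simp add: E_self)
lemma E_c_self: "E (c p) p = - E p p" using E_c[of p p] by simp
lemma c_neq: "p \<in> PI \<Longrightarrow> c p \<noteq> p" using E_c_self[of p] E_self_pos[of p] by auto
lemma E_cpow: "E ((c ^^ k) u) ((c ^^ k) v) = E u v" by (induction k) (auto simp: E_cc)

text \<open>A power of \<open>c\<close> moves the third element \<open>x\<close> to the one element
  of the orbit that does not vanish at \<open>e\<close>; \<open>p\<close> and \<open>q\<close> then
  land in \<open>fin_base\<close>, where the sign is known.\<close>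

lemma E_third: assumes "p \<in> PI" "q \<in> orb p" "x \<in> orb p" "x \<noteq> p" "x \<noteq> q" "p \<noteq> q" shows "E p q \<le> 0"
proof -
  obtain z where z: "z \<in> orb p" "z e > 0" using out_exists[OF assms(1) e] by blast
  have "z \<in> orb x" using z(1) orb_eq[OF assms(1,3)] by blast
  then obtain k where k: "z = (c ^^ k) x" by (rule orbE)
  have mem: "(c ^^ k) y \<in> set fin_base" if "y \<in> orb p" "y \<noteq> x" for y
  proof (rule PI_fin_base)
    have yo: "(c ^^ k) y \<in> orb p" using that(1) orb_trans orbI by blast
    then show "(c ^^ k) y \<in> PI" using orb_PI assms(1) by blast
    have "(c ^^ k) y \<noteq> z" using that(2) k cpow_inj by metis
    then show "(c ^^ k) y e = 0" using out_unique[OF assms(1) yo z(1)] z(2) by force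
  qed
  have "E ((c ^^ k) p) ((c ^^ k) q) \<le> 0"
    by (rule fin_base_props(4)) (use mem assms orb_self cpow_inj in auto)
  then show ?thesis by (simp add: E_cpow)
qed

text \<open>\<open>E p q\<close> and \<open>E (c q) p\<close> are both nonpositive by
  \<open>E_third\<close>, with third elements \<open>c q\<close> and \<open>q\<close>, and they are
  opposite numbers by \<open>E_c\<close>.\<close>

lemma E_PI: assumes "p \<in> PI" "q \<in> PI" "p \<noteq> q" "p \<noteq> c q" shows "E p q = 0"
proof (cases "q \<in> orb p")
  case False
  then show ?thesis using E_cross assms by blast
next
  case True
  have cq: "c q \<in> orb p" "c q \<noteq> q" using True orb_c c_neq assms(2) by blast+
  have "E p q \<le> 0" by (rule E_third[OF assms(1) True cq(1)]) (use assms cq in auto)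
  moreover have "E (c q) p \<le> 0"
  proof (rule E_third[of "c q" p q])
    show "c q \<in> PI" using c_PI assms(2) by blast
    show "p \<in> orb (c q)" "q \<in> orb (c q)" using orb_eq[OF assms(1) cq(1)] orb_self True by blast+
  qed (use assms cq in auto)
  ultimately show ?thesis using E_c[of p q] by simp
qed

lemma E_same: assumes "q \<in> orb p" "p \<in> PI" shows "E q q = E p p"
proof -
  obtain k where "q = (c ^^ k) p" by (rule orbE[OF assms(1)])
  then show ?thesis by (simp add: E_cpow)
qed

lemma E_PI_formula: assumes "p \<in> PI" "q \<in> PI"
  shows "E p q = E q q * ((if p = q then 1 else 0) - (if p = c q then 1 else 0))"
  using E_PI[OF assms] E_c_self[of q] c_neq[OF assms(2)] by auto

text \<open>Pairing with \<open>E (c r)\<close> sees only the coefficients at \<open>c r\<close> and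
  \<open>r\<close>. Hence every relation among \<open>PI\<close> is a relation between orbit
  sums.\<close>

lemma PI_relation: assumes "lin_comb PI x = 0" "p \<in> PI" "q \<in> orb p" shows "x q = x p"
proof -
  have step: "x (c r) = x r" if r: "r \<in> PI" for r
  proof -
    have cr: "c r \<in> PI" using c_PI r by blast
    have "0 = E (c r) (lin_comb PI x)" using assms(1) by (simp add: EL_lin)
    also have "\<dots> = (\<Sum>q\<in>PI. x q * E (c r) q)" by (rule lin_comb_lin[OF lin_EL2])
    also have "\<dots> = (\<Sum>q\<in>PI. (if q = c r then x q * E q q else 0) - (if q = r then x q * E q q else 0))"
    proof (rule sum.cong[OF HOL.refl])
      fix q assume "q \<in> PI"
      then show "x q * E (c r) q = (if q = c r then x q * E q q else 0) - (if q = r then x q * E q q else 0)"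
        using E_PI_formula[OF cr, of q] c_neq[OF r] c_inj by auto
    qed
    also have "\<dots> = x (c r) * E (c r) (c r) - x r * E r r" using finite_PI cr r by (simp add: sum_subtractf)
    finally have "x (c r) * E r r = x r * E r r" by (simp add: E_cc)
    then show ?thesis using E_self_pos[OF r] by simp
  qed
  obtain k where k: "q = (c ^^ k) p" by (rule orbE[OF assms(3)])
  have "x ((c ^^ k) p) = x p" for k
    by (induction k) (auto simp: step cpow_PI[OF assms(2)])
  then show ?thesis using k by simp
qed

section \<open>Identification with \<open>Pi_c\<close> and its components\<close>

lemma dl_PI: "dl \<in> nonneg_span PI"
  by (rule nonneg_span_trans[OF dl_Fm]) (auto simp: Fm_def intro: Ups_PI)

lemma Ups_c_pos: assumes "af < n"
  shows "Ups_c n A d af \<inter> pos_roots n A = Ups \<union> {real k *s dl | k. k \<ge> 1}"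
proof -
  have im: "pos_imag_roots n A = {real k *s dl | k. k \<ge> 1}"
  proof
    show "pos_imag_roots n A \<subseteq> {real k *s dl | k. k \<ge> 1}" unfolding pos_imag_eq using dl_char(2) by blast
    show "{real k *s dl | k. k \<ge> 1} \<subseteq> pos_imag_roots n A"
    proof clarify
      fix k :: nat assume k: "1 \<le> k"
      obtain t where t: "t > 0" "dl = t *s nullv" "\<forall>i<n. dl i \<in> \<int>" using dl_char(1) by (auto simp: intnull_def)
      have "real k *s dl = (real k * t) *s nullv" using t(2) by simp
      moreover have "real k * t > 0" using k t(1) by simp
      moreover have "(real k *s dl) i \<in> \<int>" if "i < n" for i using t(3) that by (simp add: smul_apply)
      ultimately show "real k *s dl \<in> pos_imag_roots n A" unfolding pos_imag_eq intnull_def by blast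
    qed
  qed
  have neg: "\<not> pos (vneg v)" if v: "v \<in> pos_imag_roots n A" for v
  proof -
    obtain k :: nat where k: "k \<ge> 1" "v = real k *s dl" using v unfolding im by auto
    have "vneg v 0 < 0" using k dl0 by (simp add: vneg_def vs)
    then show ?thesis using n_pos by (auto simp: positive_def not_le)
  qed
  have posi: "pos (real k *s dl)" for k by (simp add: positive_def smul_apply less_imp_le[OF dl_pos])
  show ?thesis unfolding Ups_c_def pos_roots_def roots_def Ups_def im[symmetric]
    using neg posi im by (auto simp: U_c_eq[OF assms] EL_lin E_dl_dl)
qed

text \<open>Extremality puts \<open>PI\<close> into every generating set. Multiples of
  \<open>dl\<close> among the generators cannot replace a member of \<open>PI\<close>, being
  isotropic.\<close>

lemma Pi_c_eq: assumes "af < n" shows "Pi_c n A d af = PI"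
proof -
  let ?S = "Ups \<union> {real k *s dl | k. k \<ge> 1}"
  have gen: "?S \<subseteq> nonneg_span PI" using Ups_PI nonneg_span_smul[OF dl_PI] by auto
  have dl_nz: "t *s dl \<noteq> 0" if "t \<noteq> 0" for t
  proof
    assume "t *s dl = 0"
    then have "t * dl 0 = 0" by (metis smul_apply zero_fun_apply)
    then show False using dl0 that by simp
  qed
  have uniq: "PI \<subseteq> P" if P: "P \<subseteq> ?S" "?S \<subseteq> nonneg_span P" for P
  proof
    fix b assume b: "b \<in> PI"
    then have "b \<in> nonneg_span P" using P(2) PI_Ups by blast
    then obtain F f where F: "finite F" "F \<subseteq> P" "\<forall>q\<in>F. f q \<ge> 0" "b = lin_comb F f" by (auto simp: nonneg_span_def)
    then have bF: "b \<in> nonneg_span F" by (auto intro: nonneg_spanI)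
    obtain a u where u: "u \<in> F" "a u > 0" "b = a u *s u + lin_comb (F - {u}) a" "lin_comb (F - {u}) a \<in> nonneg_span (F - {u})"
      by (rule cone_term[OF bF F(1) Ups_nz[OF PI_Ups[OF b]]])
    have "F - {u} \<subseteq> nonneg_span PI" using F(2) P(1) gen by blast
    then have z: "lin_comb (F - {u}) a \<in> nonneg_span PI" using nonneg_span_trans[OF u(4)] by blast
    have uS: "u \<in> ?S" using u(1) F(2) P(1) by blast
    have "u \<in> Ups"
    proof (rule ccontr)
      assume "u \<notin> Ups"
      then obtain k :: nat where k: "k \<ge> 1" "u = real k *s dl" using uS by blast
      obtain t where t: "u = t *s b" using PI_ext[OF b u(3,2) _ z] gen uS by blast
      have "K u u = 0" using k by (simp add: K_lin)
      moreover have "K u u = t * t * K b b" unfolding t by (simp add: K_lin)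
      ultimately have "t = 0" using RR_norm_pos[OF PI_RR[OF b]] by simp
      then have "u = 0" using t by simp
      then show False using dl_nz[of "real k"] k by simp
    qed
    then have "u = b" using PI_ext_Ups[OF b u(3,2) _ z] by blast
    then show "b \<in> P" using u(1) F(2) by blast
  qed
  have min: "\<not> ?S \<subseteq> nonneg_span Q" if Q: "Q \<subset> PI" for Q
  proof
    assume a: "?S \<subseteq> nonneg_span Q"
    obtain b where b: "b \<in> PI" "b \<notin> Q" using Q by blast
    then have "Q \<subseteq> PI - {b}" using Q by blast
    then have "b \<in> nonneg_span (PI - {b})" using a b PI_Ups nonneg_span_mono by blast
    then show False using PI_min b by blast
  qed
  show ?thesis unfolding Pi_c_def Ups_c_pos[OF assms]
  proof (rule the_equality)
    show "PI \<subseteq> ?S \<and> ?S \<subseteq> nonneg_span PI \<and> (\<forall>Q. Q \<subset> PI \<longrightarrow> \<not> ?S \<subseteq> nonneg_span Q)"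
      using gen min PI_Ups by blast
    fix P assume P: "P \<subseteq> ?S \<and> ?S \<subseteq> nonneg_span P \<and> (\<forall>Q. Q \<subset> P \<longrightarrow> \<not> ?S \<subseteq> nonneg_span Q)"
    then have "PI \<subseteq> P" using uniq by blast
    moreover have "\<not> PI \<subset> P" using P gen by blast
    ultimately show "P = PI" by blast
  qed
qed

text \<open>\<open>E (c p) p\<close> is negative and \<open>E p (c p)\<close> is never positive; the
  latter is nonzero exactly for orbits of length two.\<close>

lemma K_c_neg: assumes "p \<in> PI" shows "K p (c p) \<noteq> 0"
proof -
  have "E p (c p) \<le> 0"
    using E_PI_formula[OF assms c_PI[OF assms]] E_self_pos[OF c_PI[OF assms]] c_neq[OF assms] by auto
  then have "K p (c p) < 0" using E_K[of p "c p"] E_c_self[of p] E_self_pos[OF assms] by simp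
  then show ?thesis by simp
qed

lemma tube_comp_orb: assumes "af < n" "p \<in> PI" shows "tube_component n A d af (orb p)"
  unfolding tube_component_def Pi_c_eq[OF assms(1)]
proof (intro conjI ballI allI impI)
  show "orb p \<noteq> {}" "orb p \<subseteq> PI" using orb_self orb_PI assms(2) by blast+
  show "q \<in> orb p" if "r \<in> orb p" "q \<in> PI" "K r q \<noteq> 0" for r q
    using K_cross2[OF assms(2) _ that(2) that(1)] that orb_PI assms(2) by blast
next
  fix C1 C2 assume C: "C1 \<union> C2 = orb p \<and> C1 \<inter> C2 = {} \<and> C1 \<noteq> {} \<and> C2 \<noteq> {}"
  show "\<exists>p\<in>C1. \<exists>q\<in>C2. K p q \<noteq> 0"
  proof (rule ccontr)
    assume a: "\<not> ?thesis"
    have cl: "c x \<in> C1" if "x \<in> C1" for x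
    proof -
      have "x \<in> orb p" using that C by blast
      then have "c x \<in> orb p" "K x (c x) \<noteq> 0" using orb_c K_c_neg orb_PI assms(2) by blast+
      then show ?thesis using a that C by blast
    qed
    obtain x where x: "x \<in> C1" using C by blast
    then have "(c ^^ k) x \<in> C1" for k by (induction k) (auto intro: cl)
    then have "orb x \<subseteq> C1" by (auto simp: orb_def)
    moreover have "orb x = orb p" using x C orb_eq assms(2) by blast
    ultimately show False using C by blast
  qed
qed

lemma tube_comp_unique: assumes "af < n" "tube_component n A d af C" "p \<in> C" shows "C = orb p"
proof -
  note T = assms(2)[unfolded tube_component_def Pi_c_eq[OF assms(1)]]
  have CP: "C \<subseteq> PI" using T by (elim conjE)
  have T1: "\<forall>p\<in>C. \<forall>q\<in>PI. K p q \<noteq> 0 \<longrightarrow> q \<in> C" using T by (elim conjE)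
  have T2: "\<forall>C1 C2. C1 \<union> C2 = C \<and> C1 \<inter> C2 = {} \<and> C1 \<noteq> {} \<and> C2 \<noteq> {} \<longrightarrow> (\<exists>p\<in>C1. \<exists>q\<in>C2. K p q \<noteq> 0)"
    using T by (elim conjE)
  have pP: "p \<in> PI" using CP assms(3) by blast
  have cl: "c x \<in> C" if "x \<in> C" for x
  proof -
    have "x \<in> PI" using that CP by blast
    then have "c x \<in> PI" "K x (c x) \<noteq> 0" using c_PI K_c_neg by blast+
    then show ?thesis using T1 that by blast
  qed
  have "(c ^^ k) p \<in> C" for k by (induction k) (auto intro: cl assms(3))
  then have sub: "orb p \<subseteq> C" by (auto simp: orb_def)
  show ?thesis
  proof (rule ccontr)
    assume "C \<noteq> orb p"
    then have "C - orb p \<noteq> {}" using sub by blast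
    moreover have "orb p \<union> (C - orb p) = C" using sub by blast
    moreover have "orb p \<inter> (C - orb p) = {}" "orb p \<noteq> {}" using orb_self by blast+
    ultimately have "\<exists>x\<in>orb p. \<exists>y\<in>C - orb p. K x y \<noteq> 0"
      using T2[THEN spec, THEN spec, of "orb p" "C - orb p"] by simp
    then show False using K_cross2[OF pP] CP orb_PI[OF pP] by blast
  qed
qed

section \<open>Transjective roots compatible with tubes\<close>

text \<open>The invariant of the walk that begins at \<open>Pr e\<close>; the last condition lets
  the exceptional element of each orbit be moved separately.\<close>

definition good :: "vec \<Rightarrow> bool" where
  "good x \<longleftrightarrow> x \<in> RR \<and> pos x \<and> E x dl > 0 \<and> (\<forall>p\<in>PI. E p x \<le> 0)
     \<and> (\<forall>p\<in>PI. \<forall>q\<in>PI. q \<in> orb p \<longrightarrow> E p x \<noteq> 0 \<longrightarrow> E q x \<noteq> 0 \<longrightarrow> p = q)"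

definition nonorth :: "vec \<Rightarrow> vec set" where "nonorth x = {p \<in> PI. E p x \<noteq> 0}"

lemma orb_ci: assumes "p \<in> PI" "y \<in> orb p" shows "ci y \<in> orb p"
proof -
  have yP: "y \<in> PI" using assms orb_PI by blast
  have "y \<in> orb (ci y)" by (rule orbI[of _ 1]) (simp add: c_ci)
  then have "orb y = orb (ci y)" using orb_eq[OF ci_PI[OF yP]] by blast
  then show ?thesis using orb_self[of "ci y"] orb_eq[OF assms] by blast
qed

text \<open>By \<open>E_c\<close> the pairing of \<open>p\<close> with \<open>Pr e\<close> is
  \<open>- d e\<close> times the coordinate of \<open>ci p\<close> at \<open>e\<close>, and each
  orbit has only one element that does not vanish at \<open>e\<close>.\<close>

lemma good_Pr: "good (Pr e)"
proof -
  have val: "E p (Pr e) = - (d e * ci p e)" for p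
    using E_c[of "Pr e" "ci p"] E_Pr[OF e, of "ci p"] by (simp add: c_ci)
  have 1: "E p (Pr e) \<le> 0" if "p \<in> PI" for p
    unfolding val using d_pos[OF e] PI_ge0[OF ci_PI[OF that]] by (simp add: less_imp_le)
  have 2: "p = q" if pq: "p \<in> PI" "q \<in> PI" "q \<in> orb p" "E p (Pr e) \<noteq> 0" "E q (Pr e) \<noteq> 0" for p q
  proof -
    have "ci p e \<noteq> 0" "ci q e \<noteq> 0" using pq(4,5) unfolding val by auto
    moreover have "ci p \<in> orb p" "ci q \<in> orb p" using orb_ci pq orb_self by blast+
    ultimately have "ci p = ci q" using out_unique[OF pq(1)] by blast
    then show ?thesis by (metis c_ci(1))
  qed
  have 3: "E (Pr e) dl > 0" using E_Pr[OF e, of dl] d_pos[OF e] dl_pos[OF e] by simp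
  show ?thesis unfolding good_def using Pr_RR[OF e] Pr_pos[OF e] 1 2 3 by blast
qed

lemma good_step: assumes g: "good x" and q: "q \<in> PI" "E q x \<noteq> 0"
  shows "good (tr q x)" "nonorth (tr q x) = (nonorth x - {q}) \<union> {c q}" "c q \<notin> nonorth x"
proof -
  note G = g[unfolded good_def]
  have gRR: "x \<in> RR" and gpos: "pos x" and gl: "E x dl > 0" using G by simp_all
  have gneg: "\<And>p. p \<in> PI \<Longrightarrow> E p x \<le> 0" using G by blast
  have guni: "\<And>p r. p \<in> PI \<Longrightarrow> r \<in> PI \<Longrightarrow> r \<in> orb p \<Longrightarrow> E p x \<noteq> 0 \<Longrightarrow> E r x \<noteq> 0 \<Longrightarrow> p = r" using G by blast
  have cq: "c q \<in> PI" "c q \<in> orb q" "c q \<noteq> q" using c_PI orb_c orb_self c_neq q(1) by blast+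
  have Ecq: "E (c q) x = 0" using guni[OF q(1) cq(1,2) q(2)] cq(3) by metis
  then show cN: "c q \<notin> nonorth x" by (simp add: nonorth_def)
  define D where "D = - E q x"
  have D: "D > 0" using gneg[OF q(1)] q(2) by (simp add: D_def)
  define d' where "d' = E q q"
  have d': "d' > 0" "K q q = 2 * d'" using E_self_pos[OF q(1)] E_self[of q] by (auto simp: d'_def)
  \<comment> \<open>\<open>E x q = - E (c q) x\<close> vanishes, so \<open>K q x\<close> is just
    \<open>E q x\<close>, and the reflection adds a positive multiple of \<open>q\<close>.\<close>
  have "E x q = 0" using E_c[of x q] Ecq by simp
  then have "K q x = - D" using E_K[of q x] by (simp add: D_def)
  then have eq: "tr q x = x + (D / d') *s q" using d' by (simp add: tr_def smul_uminus_left)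
  have val: "E p (tr q x) = E p x + D * ((if p = q then 1 else 0) - (if p = c q then 1 else 0))" if "p \<in> PI" for p
    unfolding eq using E_PI_formula[OF that q(1)] d' by (simp add: EL_lin d'_def[symmetric])
  have v1: "E q (tr q x) = 0" using val[OF q(1)] cq(3) by (simp add: D_def)
  have v2: "E (c q) (tr q x) = - D" using val[OF cq(1)] cq(3) Ecq by simp
  have v3: "E p (tr q x) = E p x" if "p \<in> PI" "p \<noteq> q" "p \<noteq> c q" for p using val[OF that(1)] that by simp
  show NNeq: "nonorth (tr q x) = (nonorth x - {q}) \<union> {c q}"
  proof (rule set_eqI)
    fix p
    show "p \<in> nonorth (tr q x) \<longleftrightarrow> p \<in> (nonorth x - {q}) \<union> {c q}"
      using v1 v2 v3[of p] D cq by (cases "p = q"; cases "p = c q") (auto simp: nonorth_def)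
  qed
  have tRR: "tr q x \<in> RR" using RR_tr[OF PI_RR[OF q(1)] gRR] .
  have tpos: "pos (tr q x)"
    unfolding eq positive_def plus_fun_apply smul_apply
    using gpos PI_ge0[OF q(1)] D d' by (auto simp: positive_def intro!: add_nonneg_nonneg mult_nonneg_nonneg)
  have "E q dl = 0" using Ups_D(3)[OF PI_Ups[OF q(1)]] E_dl_anti[of q] by simp
  then have tl: "E (tr q x) dl > 0" unfolding eq using gl by (simp add: EL_lin)
  have tneg: "E p (tr q x) \<le> 0" if "p \<in> PI" for p
    using v1 v2 v3[OF that] D gneg[OF that] by (cases "p = q"; cases "p = c q") auto
  have tuni: "p = r" if pr': "p \<in> PI" "r \<in> PI" "r \<in> orb p" "E p (tr q x) \<noteq> 0" "E r (tr q x) \<noteq> 0" for p r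
  proof -
    have mem: "p \<in> (nonorth x - {q}) \<union> {c q}" "r \<in> (nonorth x - {q}) \<union> {c q}"
      using pr' NNeq by (auto simp: nonorth_def)
    have oo: "orb r = orb p" using orb_eq pr' by blast
    have key: False if "y \<in> nonorth x - {q}" "y \<in> orb (c q)" for y
      using guni[OF q(1), of y] that orb_eq[OF q(1) cq(2)] q(2) by (auto simp: nonorth_def)
    show ?thesis
    proof (cases "p = c q")
      case True
      then show ?thesis using mem(2) key[of r] pr'(3) by blast
    next
      case False
      then have pN: "p \<in> nonorth x - {q}" using mem(1) by blast
      show ?thesis
      proof (cases "r = c q")
        case True
        then show ?thesis using key[OF pN] oo orb_self by blast
      next
        case False
        then have "r \<in> nonorth x" using mem(2) by blast
        then show ?thesis using guni[OF pr'(1-3)] pN by (auto simp: nonorth_def)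
      qed
    qed
  qed
  show "good (tr q x)" unfolding good_def using tRR tpos tl tneg tuni by blast
qed

text \<open>Termination: \<open>ds\<close> is the number of steps along the orbit to
  \<open>M\<close>, and each reflection replaces one \<open>q\<close> by \<open>c q\<close>, which
  lowers the sum of these numbers.\<close>

lemma good_reach: assumes M: "\<And>p. p \<in> PI \<Longrightarrow> \<exists>x\<in>orb p. x \<in> M"
  shows "\<exists>x. good x \<and> nonorth x \<subseteq> M"
proof -
  define ds where "ds p = (LEAST j. (c ^^ j) p \<in> M)" for p
  have ds: "(c ^^ ds p) p \<in> M" if p: "p \<in> PI" for p
  proof -
    obtain x where "x \<in> orb p" "x \<in> M" using M[OF p] by blast
    then have "\<exists>j. (c ^^ j) p \<in> M" by (auto elim!: orbE)
    then show ?thesis unfolding ds_def by (rule LeastI_ex)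
  qed
  have finN: "finite (nonorth x)" for x unfolding nonorth_def using finite_PI by simp
  have "\<exists>y. good y \<and> nonorth y \<subseteq> M" if "good x" for x
    using that
  proof (induction "\<Sum>p\<in>nonorth x. ds p" arbitrary: x rule: less_induct)
    case less
    show ?case
    proof (cases "nonorth x \<subseteq> M")
      case True
      then show ?thesis using less.prems by blast
    next
      case False
      then obtain q where q: "q \<in> nonorth x" "q \<notin> M" by blast
      have qP: "q \<in> PI" "E q x \<noteq> 0" using q(1) by (auto simp: nonorth_def)
      note st = good_step[OF less.prems qP]
      have "ds q \<noteq> 0" using ds[OF qP(1)] q(2) by (metis funpow_0)
      then obtain j where j: "ds q = Suc j" by (cases "ds q") auto
      have "(c ^^ j) (c q) \<in> M" using ds[OF qP(1)] unfolding j by (simp add: funpow_swap1)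
      then have dc: "ds (c q) \<le> j" unfolding ds_def by (rule Least_le)
      have "(\<Sum>p\<in>nonorth (tr q x). ds p) = ds (c q) + (\<Sum>p\<in>nonorth x - {q}. ds p)"
        unfolding st(2) using st(3) finN by simp
      also have "\<dots> < ds q + (\<Sum>p\<in>nonorth x - {q}. ds p)" using dc j by simp
      also have "\<dots> = (\<Sum>p\<in>nonorth x. ds p)" by (rule sum.remove[OF finN q(1), symmetric])
      finally show ?thesis using less.hyps st(1) by blast
    qed
  qed
  then show ?thesis using good_Pr by blast
qed

text \<open>Through \<open>cdeg_formula\<close> these signs make one of the two degrees zero and the
  other nonpositive, so their maximum is zero.\<close>

lemma good_compat: assumes "good x" "b = lin_comb PI a" "\<And>p. a p \<ge> 0" "\<And>p. p \<in> nonorth x \<Longrightarrow> a p = 0"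
  shows "E b x = 0" "E x b \<ge> 0"
proof -
  have "E b x = (\<Sum>p\<in>PI. a p * E p x)" unfolding assms(2) by (rule lin_comb_lin[OF lin_EL1])
  also have "\<dots> = 0" by (rule sum.neutral) (use assms(4) in \<open>auto simp: nonorth_def\<close>)
  finally show "E b x = 0" .
  have "E x b = (\<Sum>p\<in>PI. a p * E x p)" unfolding assms(2) by (rule lin_comb_lin[OF lin_EL2])
  also have "\<dots> \<ge> 0"
  proof (rule sum_nonneg)
    fix p assume "p \<in> PI"
    then have "E (c p) x \<le> 0" using assms(1) c_PI unfolding good_def by blast
    then have "E x p \<ge> 0" using E_c[of x p] by simp
    then show "a p * E x p \<ge> 0" using assms(3) by simp
  qed
  finally show "E x b \<ge> 0" .
qed

section \<open>Roots of the tubes as arcs\<close>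

definition arc :: "vec \<Rightarrow> nat \<Rightarrow> vec" where "arc q l = (\<Sum>i<l. (c ^^ i) q)"
definition arc_set :: "vec \<Rightarrow> nat \<Rightarrow> vec set" where "arc_set q l = (\<lambda>i. (c ^^ i) q) ` {..<l}"
text \<open>Distinctness is required up to index \<open>l\<close> inclusive: the successor of the
  arc is a further element, so the arc does not fill its orbit.\<close>

definition proper :: "vec \<Rightarrow> nat \<Rightarrow> bool" where
  "proper q l \<longleftrightarrow> q \<in> PI \<and> l \<ge> 1 \<and> (\<forall>i j. i < j \<longrightarrow> j \<le> l \<longrightarrow> (c ^^ i) q \<noteq> (c ^^ j) q)"

lemma proper_inj: "proper q l \<Longrightarrow> i \<le> l \<Longrightarrow> j \<le> l \<Longrightarrow> (c ^^ i) q = (c ^^ j) q \<Longrightarrow> i = j"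
  unfolding proper_def by (metis linorder_neqE_nat)

lemma arc_set_orb: "arc_set q l \<subseteq> orb q" by (auto simp: arc_set_def orb_def)
lemma proper_PI: "proper q l \<Longrightarrow> q \<in> PI" by (simp add: proper_def)
lemma arc_set_PI: "proper q l \<Longrightarrow> arc_set q l \<subseteq> PI" using arc_set_orb orb_PI proper_PI by blast
lemma proper_end: "proper q l \<Longrightarrow> (c ^^ l) q \<notin> arc_set q l"
proof
  assume a: "proper q l" "(c ^^ l) q \<in> arc_set q l"
  then obtain i where "i < l" "(c ^^ l) q = (c ^^ i) q" by (auto simp: arc_set_def)
  then show False using proper_inj[OF a(1), of l i] by simp
qed

lemma arc_sum: assumes "proper q l" shows "arc q l = (\<Sum>x\<in>arc_set q l. x)"
proof -
  have "inj_on (\<lambda>i. (c ^^ i) q) {..<l}" by (rule inj_onI) (use proper_inj[OF assms] in auto)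
  then show ?thesis unfolding arc_def arc_set_def by (simp add: sum.reindex)
qed

lemma arc_comb: assumes "proper q l" "arc_set q l \<subseteq> X" "finite X"
  shows "arc q l = lin_comb X (\<lambda>x. if x \<in> arc_set q l then 1 else 0)"
proof -
  have "lin_comb (arc_set q l) (\<lambda>_. 1) = lin_comb X (\<lambda>x. if x \<in> arc_set q l then 1 else 0)"
    by (rule lin_comb_mono[OF assms(3,2)])
  then show ?thesis unfolding arc_sum[OF assms(1)] by (simp add: lin_comb_eq)
qed

lemma arc_zero: assumes "proper q l" "p \<in> PI" shows "\<exists>x\<in>orb p. x \<notin> arc_set q l"
proof (cases "p \<in> orb q")
  case True
  then have "(c ^^ l) q \<in> orb p" using orb_eq[OF proper_PI[OF assms(1)]] orbI by blast
  then show ?thesis using proper_end[OF assms(1)] by blast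
next
  case False
  then show ?thesis using arc_set_orb orb_self by blast
qed

text \<open>Relations are constant on orbits, and nonnegative coefficients that attain zero on each
  orbit leave no freedom for the constant.\<close>

lemma arc_coeff_unique:
  assumes eq: "lin_comb PI a = lin_comb PI b" and a: "\<And>p. a p \<ge> 0" and b: "\<And>p. b p \<ge> 0"
    and az: "\<And>p. p \<in> PI \<Longrightarrow> \<exists>x\<in>orb p. a x = 0" and bz: "\<And>p. p \<in> PI \<Longrightarrow> \<exists>x\<in>orb p. b x = 0"
    and p: "p \<in> PI"
  shows "a p = b p"
proof -
  have z: "lin_comb PI (\<lambda>q. a q - b q) = 0" using eq by (simp add: lin_comb_diff[symmetric])
  obtain x where x: "x \<in> orb p" "a x = 0" using az[OF p] by blast
  obtain y where y: "y \<in> orb p" "b y = 0" using bz[OF p] by blast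
  have "a x - b x = a p - b p" using PI_relation[OF z p x(1)] .
  moreover have "a y - b y = a p - b p" using PI_relation[OF z p y(1)] .
  ultimately show ?thesis using x(2) y(2) a[of y] b[of x] by linarith
qed

text \<open>\<open>E_PI_formula\<close> telescopes; only the first element and the successor of the
  last one survive.\<close>

lemma E_arc: assumes "p \<in> PI" "q \<in> PI"
  shows "E p (arc q l) = E q q * ((if p = q then 1 else 0) - (if p = (c ^^ l) q then 1 else 0))"
proof -
  let ?f = "\<lambda>i. if p = (c ^^ i) q then 1 else (0::real)"
  have "E p (arc q l) = (\<Sum>i<l. E p ((c ^^ i) q))" unfolding arc_def by (rule lin_sum[OF lin_EL2])
  also have "\<dots> = (\<Sum>i<l. E q q * (?f i - ?f (Suc i)))"
  proof (rule sum.cong[OF HOL.refl])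
    fix i
    show "E p ((c ^^ i) q) = E q q * (?f i - ?f (Suc i))"
      using E_PI_formula[OF assms(1) cpow_PI[OF assms(2), of i]] by (simp add: E_cpow)
  qed
  also have "\<dots> = E q q * (?f 0 - ?f l)"
    unfolding sum_distrib_left[symmetric] using sum_lessThan_telescope'[of ?f l] by simp
  finally show ?thesis by simp
qed

lemma cone_sum_zero: assumes "lin_comb PI x = 0" "\<And>p. p \<in> PI \<Longrightarrow> x p \<ge> 0" "p \<in> PI" shows "x p = 0"
proof -
  have "(\<Sum>q\<in>PI. x q * ht q) = 0" using lin_comb_lin[OF lin_ht, of PI x] assms(1) lin_zero[OF lin_ht] by simp
  moreover have "x q * ht q \<ge> 0" if "q \<in> PI" for q
    using assms(2)[OF that] ht_pos[OF PI_RR[OF that] PI_pos[OF that]] by simp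
  ultimately have "x p * ht p = 0" using sum_nonneg_eq_0_iff[OF finite_PI, of "\<lambda>q. x q * ht q"] assms(3) by blast
  then show ?thesis using ht_pos[OF PI_RR PI_pos] assms(3) by fastforce
qed

text \<open>Induction on the height. A reflection that lowers \<open>b\<close> leaves an arc, and
  the pairing with that arc shows that the reflecting root is attached at one of its ends with
  multiplicity one.\<close>

lemma arc_ex:
  assumes "b \<in> Ups" "b = lin_comb PI a" "\<And>p. a p \<ge> 0" "\<And>p. p \<in> PI \<Longrightarrow> \<exists>x\<in>orb p. a x = 0"
  shows "\<exists>q l. proper q l \<and> b = arc q l"
  using assms
proof (induction "nat \<lfloor>ht b\<rfloor>" arbitrary: b a rule: less_induct)
  case less
  note bU = less.prems(1) and ba = less.prems(2) and a0 = less.prems(3) and az = less.prems(4)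
  show ?case
  proof (cases "b \<in> PI")
    case True
    have "proper b 1" unfolding proper_def using True c_neq[OF True] by (auto simp: less_Suc_eq_le le_Suc_eq)
    moreover have "b = arc b 1" by (simp add: arc_def)
    ultimately show ?thesis by blast
  next
    case False
    have "(\<Sum>q\<in>PI. a q * K q b) = K b b" using lin_comb_lin[OF lin_K2[of b], of PI a] ba by simp
    also have "\<dots> > 0" using RR_norm_pos Ups_D(1)[OF bU] by blast
    finally have "\<exists>p\<in>PI. a p * K p b > 0" by (meson sum_nonpos not_le)
    then obtain p where p: "p \<in> PI" "a p * K p b > 0" by blast
    then have ap: "a p > 0" "K p b > 0" using a0[of p] by (auto simp: zero_less_mult_iff)
    define m where "m = 2 * K p b / K p p"
    define b' where "b' = tr p b"
    have Kpp: "K p p > 0" using RR_norm_pos PI_RR p(1) by blast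
    have m: "m > 0" using ap(2) Kpp by (simp add: m_def)
    have b'eq: "b' = b - m *s p" by (simp add: b'_def tr_def m_def)
    have b'R: "b' \<in> RR" unfolding b'_def using RR_tr PI_RR[OF p(1)] Ups_D(1)[OF bU] by blast
    have Eb': "E dl b' = 0" unfolding b'eq using Ups_D(3)[OF bU] Ups_D(3)[OF PI_Ups[OF p(1)]] by (simp add: EL_lin)
    have "pos b'"
    proof (rule ccontr)
      assume "\<not> pos b'"
      then have "pos (- b')" using RR_sign b'R by blast
      moreover have "E dl (- b') = 0" using Eb' by (simp add: EL_lin)
      ultimately have nU: "- b' \<in> Ups" using RR_neg[OF b'R] by (simp add: Ups_def)
      have "m *s p = b + (- b')" by (simp add: b'eq)
      then have "(1 / m) *s (m *s p) = (1 / m) *s (b + (- b'))" by (rule arg_cong)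
      moreover have "(1 / m) *s (m *s p) = p" using m by simp
      ultimately have "p = (1 / m) *s b + (1 / m) *s (- b')" unfolding smul_add_right by simp
      then have "b = p" by (rule PI_ext_Ups[OF p(1) _ _ bU nonneg_span_smul[OF Ups_PI[OF nU]]]) (use m in auto)
      then show False using False p(1) by simp
    qed
    then have b'U: "b' \<in> Ups" using b'R Eb' by (simp add: Ups_def)
    obtain f where f: "\<And>q. f q \<ge> 0" "b' = lin_comb PI f"
      using nonneg_span_finite[OF Ups_PI[OF b'U] finite_PI] by metis
    have ms: "lin_comb PI (\<lambda>q. if q = p then m else 0) = m *s p" by (rule lin_comb_single[OF finite_PI p(1)])
    \<comment> \<open>The coefficients \<open>f\<close> of \<open>b'\<close> need not be those of
      \<open>b\<close> reduced by \<open>m\<close> at \<open>p\<close>. If the latter were negative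
      at \<open>p\<close>, the difference \<open>x\<close> would be a relation, constant on orbits
      and nonnegative where \<open>a\<close> vanishes, hence zero; but
      \<open>x p > 0\<close>.\<close>
    have am: "a p \<ge> m"
    proof (rule ccontr)
      assume am: "\<not> a p \<ge> m"
      define x where "x q = f q - a q + (if q = p then m else 0)" for q
      have x0: "lin_comb PI x = 0"
      proof -
        have "lin_comb PI x = (lin_comb PI f - lin_comb PI a) + lin_comb PI (\<lambda>q. if q = p then m else 0)"
          unfolding x_def lin_comb_diff lin_comb_add by simp
        also have "\<dots> = (b' - b) + m *s p" by (simp only: ms f(2)[symmetric] ba[symmetric])
        also have "\<dots> = 0" unfolding b'eq by simp
        finally show ?thesis .
      qed
      have "x q \<ge> 0" if q: "q \<in> PI" for q
      proof -
        obtain z where z: "z \<in> orb q" "a z = 0" using az[OF q] by blast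
        have "x z \<ge> 0" using z(2) f(1)[of z] m by (simp add: x_def)
        then show ?thesis using PI_relation[OF x0 q z(1)] by simp
      qed
      then have "x p = 0" using cone_sum_zero[OF x0 _ p(1)] by blast
      then show False using am f(1)[of p] by (simp add: x_def)
    qed
    define a' where "a' q = a q - (if q = p then m else 0)" for q
    have a'0: "\<And>q. a' q \<ge> 0" using am a0 by (simp add: a'_def)
    have b'a: "b' = lin_comb PI a'"
      unfolding a'_def lin_comb_diff[symmetric] ms b'eq ba ..
    have a'z: "\<exists>x\<in>orb r. a' x = 0" if r: "r \<in> PI" for r
    proof -
      obtain z where z: "z \<in> orb r" "a z = 0" using az[OF r] by blast
      then have "z \<noteq> p" using ap(1) by auto
      then show ?thesis using z by (auto simp: a'_def)
    qed
    have "ht b' = ht b - m * ht p" unfolding b'eq by (simp add: lin_diff[OF lin_ht] lin_smul[OF lin_ht])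
    then have "ht b' < ht b" using m ht_pos[OF PI_RR[OF p(1)] PI_pos[OF p(1)]] by simp
    moreover have "ht b \<in> \<int>" "ht b' \<in> \<int>"
      unfolding ht_def by (intro Ints_sum RR_ints(1)[OF Ups_D(1)[OF bU]] RR_ints(1)[OF b'R]; simp)+
    moreover have "ht b' > 0" using ht_pos[OF b'R \<open>pos b'\<close>] .
    ultimately have "nat \<lfloor>ht b'\<rfloor> < nat \<lfloor>ht b\<rfloor>" by (auto elim!: Ints_cases)
    from less.hyps[OF this b'U b'a a'0 a'z] obtain q l where ql: "proper q l" "b' = arc q l" by blast
    have qP: "q \<in> PI" and l1: "l \<ge> 1" using ql(1) by (auto simp: proper_def)
    have inj: "\<And>i j. i \<le> l \<Longrightarrow> j \<le> l \<Longrightarrow> (c ^^ i) q = (c ^^ j) q \<Longrightarrow> i = j" using proper_inj[OF ql(1)] by blast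
    have beq: "b = arc q l + m *s p" using b'eq ql(2) by (metis diff_add_cancel)
    have ind: "a' x = (if x \<in> arc_set q l then 1 else 0)" if x: "x \<in> PI" for x
    proof (rule arc_coeff_unique[OF _ a'0 _ a'z _ x])
      show "lin_comb PI a' = lin_comb PI (\<lambda>x. if x \<in> arc_set q l then 1 else 0)"
        using arc_comb[OF ql(1) arc_set_PI[OF ql(1)] finite_PI] ql(2) b'a by simp
      show "\<exists>x\<in>orb r. (if x \<in> arc_set q l then 1 else (0::real)) = 0" if "r \<in> PI" for r
        using arc_zero[OF ql(1) that] by auto
    qed auto
    have "K p b' = - K p b" unfolding b'eq using Kpp by (simp add: K_lin m_def)
    then have Kneg: "K p (arc q l) = - (m * K p p / 2)" using ql(2) Kpp by (simp add: m_def)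
    have cpP: "c p \<in> PI" using c_PI p(1) by blast
    have Kval: "K p (arc q l) = E q q * ((if p = q then 1 else 0) - (if p = (c ^^ l) q then 1 else 0)
        - (if c p = q then 1 else 0) + (if c p = (c ^^ l) q then 1 else 0))"
      using E_K[of p "arc q l"] E_c[of "arc q l" p] E_arc[OF p(1) qP, of l] E_arc[OF cpP qP, of l]
      by (simp add: algebra_simps)
    have Eqq: "E q q > 0" using E_self_pos qP by blast
    have "m * K p p > 0" using m Kpp by simp
    then have "K p (arc q l) < 0" using Kneg by linarith
    then have "E q q * ((if p = q then 1 else 0) - (if p = (c ^^ l) q then 1 else 0)
        - (if c p = q then 1 else 0) + (if c p = (c ^^ l) q then 1 else 0)) < 0" unfolding Kval .
    \<comment> \<open>Only these two of the four indicators have a negative sign: \<open>p\<close>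
      is the successor or the predecessor of the arc.\<close>
    then have cs: "p = (c ^^ l) q \<or> c p = q" using Eqq by (auto split: if_splits simp: mult_less_0_iff)
    have "p \<in> orb q"
    proof (cases "p = (c ^^ l) q")
      case False
      then have "q \<in> orb p" using cs orb_c orb_self by blast
      then show ?thesis using orb_sym p(1) by blast
    qed (rule orbI)
    then have "E p p = E q q" using E_same qP by blast
    then have Kp: "K p p = 2 * E q q" using E_self[of p] by simp
    have mval: "- m = (if p = q then 1 else 0) - (if p = (c ^^ l) q then 1 else 0)
        - (if c p = q then 1 else 0) + (if c p = (c ^^ l) q then 1 else 0)" (is "_ = ?X")
    proof -
      have "E q q * ?X = - (m * (2 * E q q) / 2)" using Kneg unfolding Kval Kp .
      also have "\<dots> = E q q * (- m)" by simp
      finally have "E q q * ?X = E q q * (- m)" .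
      moreover have "y = z" if "E q q * y = E q q * z" for y z using that Eqq by simp
      ultimately have "?X = - m" by blast
      then show ?thesis ..
    qed
    have cnp: "c p \<noteq> p" using c_neq p(1) by blast
    show ?thesis
    proof (cases "p = (c ^^ l) q")
      case True
      have pq: "p \<noteq> q" using inj[of l 0] l1 True by auto
      have cpl: "c p = (c ^^ Suc l) q" using True by simp
      \<comment> \<open>If \<open>p\<close> joined both ends, the arc together with \<open>p\<close>
        would fill the orbit and leave no zero of \<open>a\<close> on it.\<close>
      have cpq: "c p \<noteq> q"
      proof
        assume cpq: "c p = q"
        have cl: "c x \<in> arc_set q (Suc l)" if x: "x \<in> arc_set q (Suc l)" for x
        proof -
          obtain i where i: "i \<le> l" "x = (c ^^ i) q" using x by (fastforce simp: arc_set_def less_Suc_eq_le)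
          show ?thesis
          proof (cases "i = l")
            case True
            then have "c x = (c ^^ 0) q" using i cpq \<open>p = (c ^^ l) q\<close> by simp
            then show ?thesis unfolding arc_set_def by blast
          next
            case False
            then have "c x = (c ^^ Suc i) q" "Suc i < Suc l" using i by auto
            then show ?thesis unfolding arc_set_def by blast
          qed
        qed
        have "(c ^^ k) q \<in> arc_set q (Suc l)" for k
        proof (induction k)
          case 0
          have "(c ^^ 0) q \<in> arc_set q (Suc l)" unfolding arc_set_def by blast
          then show ?case .
        qed (simp add: cl)
        then have all: "orb q \<subseteq> arc_set q (Suc l)" by (auto simp: orb_def)
        obtain z where z: "z \<in> orb q" "a z = 0" using az[OF qP] by blast
        then have "z \<in> arc_set q (Suc l)" using all by blast
        moreover have "z \<noteq> p" using z ap(1) by auto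
        ultimately have "z \<in> arc_set q l" using True by (auto simp: arc_set_def less_Suc_eq)
        moreover have "z \<in> PI" using z(1) orb_PI[OF qP] by (rule subsetD[rotated])
        ultimately have "a' z = 1" by (simp add: ind)
        then show False using z(2) \<open>z \<noteq> p\<close> by (simp add: a'_def)
      qed
      have "c p \<noteq> (c ^^ l) q" using True cnp by simp
      then have m1: "m = 1" using mval True pq cpq by simp
      have "b = arc q (Suc l)" unfolding beq m1 arc_def using True by simp
      moreover have "proper q (Suc l)" unfolding proper_def
      proof (intro conjI allI impI)
        fix i j assume ij: "i < j" "j \<le> Suc l"
        show "(c ^^ i) q \<noteq> (c ^^ j) q"
        proof (cases "j = Suc l")
          case True
          show ?thesis
          proof (cases i)
            case 0
            then show ?thesis using cpq cpl True by auto
          next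
            case (Suc i')
            then show ?thesis using inj[of i' l] ij True by (auto simp: c_inj)
          qed
        next
          case False
          then show ?thesis using inj[of i j] ij by auto
        qed
      qed (use qP in auto)
      ultimately show ?thesis by blast
    next
      case False
      then have cpq: "c p = q" using cs by blast
      have "p \<noteq> q" using cpq cnp by auto
      moreover have "c p \<noteq> (c ^^ l) q" using cpq inj[of 0 l] l1 by auto
      ultimately have m1: "m = 1" using mval False cpq by simp
      have sh: "(c ^^ Suc i) p = (c ^^ i) q" for i using cpq by (simp add: funpow_swap1)
      have "arc p (Suc l) = p + arc q l"
        unfolding arc_def sum.lessThan_Suc_shift using sh by simp
      then have "b = arc p (Suc l)" unfolding beq m1 by simp
      moreover have "proper p (Suc l)" unfolding proper_def
      proof (intro conjI allI impI)
        fix i j assume ij: "i < j" "j \<le> Suc l"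
        obtain j' where j': "j = Suc j'" using ij by (cases j) auto
        show "(c ^^ i) p \<noteq> (c ^^ j) p"
        proof (cases i)
          case 0
          show ?thesis
          proof
            assume "(c ^^ i) p = (c ^^ j) p"
            then have pj: "p = (c ^^ j') q" using 0 j' sh by simp
            then have "j' < l" using False ij j' by (cases "j' = l") auto
            moreover have "(c ^^ Suc j') q = (c ^^ 0) q" using pj cpq by simp
            ultimately show False using inj[of "Suc j'" 0] by simp
          qed
        next
          case (Suc i')
          then show ?thesis using inj[of i' j'] ij j' sh by auto
        qed
      qed (use p in auto)
      ultimately show ?thesis by blast
    qed
  qed
qed

section \<open>Tube supports of arcs\<close>

lemma arc_c: "c (arc q l) = arc (c q) l"
  unfolding arc_def linv_sum[OF linv_c(1)] by (simp add: funpow_swap1)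

lemma proper_c: assumes "proper q l" shows "proper (c q) l"
proof -
  have "(c ^^ i) (c q) = (c ^^ j) (c q) \<longleftrightarrow> (c ^^ i) q = (c ^^ j) q" for i j
    using c_inj by (metis funpow_swap1)
  then show ?thesis using assms c_PI unfolding proper_def by simp
qed

lemma tsupp_arc_in: assumes af: "af < n" and "proper q l" "x \<in> arc_set q l"
  shows "x \<in> tsupp n A d af (arc q l)"
proof -
  have q: "q \<in> PI" using assms proper_PI by blast
  have "arc q l = lin_comb (orb q) (\<lambda>x. if x \<in> arc_set q l then 1 else 0)"
    by (rule arc_comb[OF assms(2) arc_set_orb finite_orb[OF q]])
  moreover have "(if x \<in> arc_set q l then 1 else (0::real)) \<noteq> 0" using assms(3) by simp
  ultimately have "\<exists>f. arc q l = lin_comb (orb q) f \<and> f x \<noteq> 0" by blast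
  moreover have "x \<in> orb q" "x \<in> PI" using assms arc_set_orb arc_set_PI by blast+
  ultimately show ?thesis unfolding tsupp_def Pi_c_eq[OF af] using tube_comp_orb[OF af q] by blast
qed

text \<open>\<open>tsupp\<close> admits every expansion over a component, so uniqueness is needed. A
  second expansion differs from the arc by a relation; the jump of the coefficients at the end of
  the arc fixes the component, and the remaining constant vanishes because an orbit sum is
  nonzero.\<close>

lemma tsupp_arc_out: assumes af: "af < n" and pq: "proper q l" and x: "x \<in> tsupp n A d af (arc q l)"
  shows "x \<in> arc_set q l"
proof (rule ccontr)
  assume ns: "x \<notin> arc_set q l"
  have q: "q \<in> PI" and l1: "l \<ge> 1" using pq by (auto simp: proper_def)
  obtain C f where h: "x \<in> PI" "tube_component n A d af C" "x \<in> C" "arc q l = lin_comb C f" "f x \<noteq> 0"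
    using x unfolding tsupp_def Pi_c_eq[OF af] by blast
  have C: "C = orb x" using tube_comp_unique[OF af h(2,3)] .
  define f' where "f' y = (if y \<in> orb x then f y else 0)" for y
  define i where "i y = (if y \<in> arc_set q l then 1 else (0::real))" for y
  have "lin_comb PI f' = arc q l" unfolding h(4) C f'_def
    by (rule lin_comb_mono[symmetric, OF finite_PI orb_PI[OF h(1)]])
  moreover have "lin_comb PI i = arc q l"
    unfolding i_def by (rule arc_comb[symmetric, OF pq arc_set_PI[OF pq] finite_PI])
  ultimately have rel: "lin_comb PI (\<lambda>y. f' y - i y) = 0" by (simp add: lin_comb_diff[symmetric])
  have qs: "q \<in> arc_set q l" unfolding arc_set_def using l1 by (intro image_eqI[of _ _ 0]) auto
  have lq: "(c ^^ l) q \<in> orb q" by (rule orbI[OF HOL.refl])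
  have "f' ((c ^^ l) q) - i ((c ^^ l) q) = f' q - i q" using PI_relation[OF rel q lq] .
  then have e1: "f' ((c ^^ l) q) = f' q - 1" using proper_end[OF pq] qs by (simp add: i_def)
  have qx: "orb x = orb q"
  proof (rule ccontr)
    assume ne: "orb x \<noteq> orb q"
    have "y \<notin> orb x" if "y \<in> orb q" for y using ne orb_eq[OF h(1), of y] orb_eq[OF q that] by metis
    then have "f' q = 0" "f' ((c ^^ l) q) = 0" using lq orb_self by (auto simp: f'_def)
    then show False using e1 by simp
  qed
  define k where "k = f' q - i q"
  have const: "f' y - i y = (if y \<in> orb q then k else 0)" if "y \<in> PI" for y
  proof (cases "y \<in> orb q")
    case True
    then show ?thesis using PI_relation[OF rel q True] by (simp add: k_def)
  next
    case False
    then show ?thesis using qx arc_set_orb by (auto simp: f'_def i_def)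
  qed
  have "lin_comb PI (\<lambda>y. f' y - i y) = lin_comb PI (\<lambda>y. if y \<in> orb q then k else 0)"
    unfolding lin_comb_eq by (rule sum.cong) (simp_all add: const)
  also have "\<dots> = lin_comb (orb q) (\<lambda>_. k)" by (rule lin_comb_mono[symmetric, OF finite_PI orb_PI[OF q]])
  also have "\<dots> = k *s lin_comb (orb q) (\<lambda>_. 1)" unfolding lin_comb_smul by simp
  also have "lin_comb (orb q) (\<lambda>_. 1) = (\<Sum>y\<in>orb q. y)" by (simp add: lin_comb_eq)
  finally have ks: "k *s (\<Sum>y\<in>orb q. y) = 0" using rel by simp
  obtain m where m: "m > 0" "(\<Sum>y\<in>orb q. y) = m *s dl" using orb_sum[OF q] by blast
  have "(k * m) * dl 0 = 0" using arg_cong[OF ks[unfolded m(2)], of "\<lambda>v. v 0"] by (simp add: vs)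
  then have "k = 0" using m(1) dl0 by simp
  then have "f' x - i x = 0" unfolding const[OF h(1)] by (simp only: if_cancel)
  then have "f' x = i x" by linarith
  then show False using ns h(5) orb_self by (simp add: f'_def i_def)
qed

section \<open>Compatible sets of arcs\<close>

lemma funpow_linv: "linv T \<Longrightarrow> (T ^^ k) (lin_comb X a) = (\<Sum>q\<in>X. a q *s (T ^^ k) q)"
  unfolding lin_comb_eq by (simp add: linv_sum[OF linv_funpow] linv_smul[OF linv_funpow])

lemma Ups_re_D: assumes "af < n" "b \<in> Ups_re n A d af" shows "b \<in> Ups"
  using assms(2) unfolding Ups_re_def Ups_def U_c_eq[OF assms(1)] by auto

text \<open>Some power of \<open>c\<close> kills the coordinate of \<open>b\<close> at
  \<open>af\<close>, so the coefficient of \<open>b\<close> is zero at any element that this power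
  makes positive at \<open>af\<close>. Every orbit contains such an element, and
  \<open>arc_ex\<close> applies.\<close>

lemma Ups_re_arc: assumes af: "af < n" and b: "b \<in> Ups_re n A d af"
  shows "\<exists>q l. proper q l \<and> b = arc q l"
proof -
  have bU: "b \<in> Ups" using Ups_re_D[OF af b] .
  obtain a where a: "\<And>q. a q \<ge> 0" "b = lin_comb PI a" using nonneg_span_finite[OF Ups_PI[OF bU] finite_PI] by metis
  obtain k where "cox_pow n A k b \<in> Phi_fin n A af" using b by (auto simp: Ups_re_def)
  then have "cox_pow n A k b af = 0" by (simp add: Phi_fin_def Vfin_def)
  \<comment> \<open>\<open>T\<close> is \<open>c\<close> or \<open>ci\<close> according to the sign
    of \<open>k\<close>, and \<open>S\<close> is its inverse.\<close>
  then obtain T S j where T: "(T ^^ j) b af = 0" "(T = c \<and> S = ci) \<or> (T = ci \<and> S = c)"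
    unfolding cox_pow_def by (cases "k \<ge> 0") auto
  have lT: "linv T" and TS: "\<And>v. T (S v) = v" and TP: "\<And>p. p \<in> PI \<Longrightarrow> T p \<in> PI"
    and SO: "\<And>p y. p \<in> PI \<Longrightarrow> y \<in> orb p \<Longrightarrow> S y \<in> orb p"
    using T(2) linv_c c_ci c_PI ci_PI orb_c orb_ci by auto
  have TSk: "(T ^^ j) ((S ^^ j) v) = v" for j v by (induction j arbitrary: v) (auto simp: TS funpow_swap1)
  have TPk: "(T ^^ j) p \<in> PI" if "p \<in> PI" for j p by (induction j) (auto simp: TP that)
  have SOk: "(S ^^ j) y \<in> orb p" if "p \<in> PI" "y \<in> orb p" for j p y by (induction j) (auto simp: SO that)
  have "(\<Sum>q\<in>PI. a q * (T ^^ j) q af) = 0"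
    using T(1) unfolding a(2) funpow_linv[OF lT] by (simp add: sum_vec_apply smul_apply)
  then have z: "\<forall>q\<in>PI. a q * (T ^^ j) q af = 0"
    using sum_nonneg_eq_0_iff[OF finite_PI, of "\<lambda>q. a q * (T ^^ j) q af"] a(1) PI_ge0[OF TPk] by simp
  have "\<exists>x\<in>orb p. a x = 0" if p: "p \<in> PI" for p
  proof -
    obtain y where y: "y \<in> orb p" "y af > 0" using out_exists[OF p af] by blast
    have x: "(S ^^ j) y \<in> orb p" using SOk[OF p y(1)] .
    then have "a ((S ^^ j) y) * (T ^^ j) ((S ^^ j) y) af = 0" using z orb_PI[OF p] by blast
    then show ?thesis using x y(2) by (auto simp: TSk)
  qed
  then show ?thesis using arc_ex[OF bU a(2,1)] by blast
qed

lemma compatible_arcs_miss: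
  assumes af: "af < n" and CU: "C \<subseteq> Ups_re n A d af"
    and comp: "\<And>a b. a \<in> C \<Longrightarrow> b \<in> C \<Longrightarrow> a \<noteq> b \<Longrightarrow> cdeg n A d af a b = 0"
    and ql: "\<And>b. b \<in> C \<Longrightarrow> proper (qq b) (ll b) \<and> b = arc (qq b) (ll b)"
    and p: "p \<in> PI"
  shows "\<exists>x\<in>orb p. \<forall>b\<in>C. x \<notin> arc_set (qq b) (ll b)"
proof (rule ccontr)
  assume "\<not> ?thesis"
  then have cov: "\<And>x. x \<in> orb p \<Longrightarrow> \<exists>b\<in>C. x \<in> arc_set (qq b) (ll b)" by blast
  let ?P = "\<lambda>b. b \<in> C \<and> arc_set (qq b) (ll b) \<inter> orb p \<noteq> {}"
  obtain b0 where b0: "?P b0" using cov[OF orb_self] orb_self by blast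
  have bnd: "\<forall>b. ?P b \<longrightarrow> ll b < Suc (card PI)"
  proof (intro allI impI)
    fix b assume "?P b"
    then have pr': "proper (qq b) (ll b)" using ql by blast
    have "inj_on (\<lambda>i. (c ^^ i) (qq b)) {..<ll b}" by (rule inj_onI) (use proper_inj[OF pr'] in auto)
    then have "card (arc_set (qq b) (ll b)) = ll b" unfolding arc_set_def by (simp add: card_image)
    then show "ll b < Suc (card PI)" using card_mono[OF finite_PI arc_set_PI[OF pr']] by simp
  qed
  obtain b where bb: "?P b \<and> (\<forall>y. ?P y \<longrightarrow> ll y \<le> ll b)"
    by (rule exE[OF ex_has_greatest_nat[of ?P, OF b0 bnd]])
  note b = bb[THEN conjunct1] and bmax = bb[THEN conjunct2, rule_format]
  define q l where "q = qq b" and "l = ll b"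
  have pr1: "proper q l" and b_eq: "b = arc q l" and bC: "b \<in> C" using ql b by (auto simp: q_def l_def)
  have q: "q \<in> PI" and l1: "l \<ge> 1" using pr1 by (auto simp: proper_def)
  obtain y where "y \<in> arc_set q l" "y \<in> orb p" using b by (auto simp: q_def l_def)
  then have oq: "orb q = orb p" using arc_set_orb orb_eq q p by blast
  define x where "x = (c ^^ l) q"
  have xo: "x \<in> orb p" using oq orbI[of x l q] by (simp add: x_def)
  have xP: "x \<in> PI" using xo orb_PI p by blast
  obtain b' where b': "b' \<in> C" "x \<in> arc_set (qq b') (ll b')" using cov[OF xo] by blast
  define q' l' where "q' = qq b'" and "l' = ll b'"
  have pr2: "proper q' l'" and b'_eq: "b' = arc q' l'" using ql b' by (auto simp: q'_def l'_def)
  have q': "q' \<in> PI" using pr2 proper_PI by blast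
  have xs': "x \<in> arc_set q' l'" using b' by (simp add: q'_def l'_def)
  have xns: "x \<notin> arc_set q l" using proper_end[OF pr1] by (simp add: x_def)
  have ne: "b \<noteq> b'" using xs' xns by (auto simp: q_def l_def q'_def l'_def)
  have ll: "l' \<le> l" using bmax[of b'] b' xo by (auto simp: l_def l'_def)
  have Ure: "b \<in> Ups_re n A d af" "b' \<in> Ups_re n A d af" using CU bC b' by blast+
  have c0: "cdeg n A d af b b' = 0" using comp bC b'(1) ne by blast
  show False
  proof (cases "component_full n A d af {b, b'}")
    case True
    \<comment> \<open>The successor \<open>x\<close> lies in the arcs \<open>c b\<close> and
      \<open>b'\<close> but not in \<open>b\<close>, so it is counted by \<open>adj\<close>.\<close>
    then have adj0: "adj n A d af b b' = 0" using c0 Ure by (simp add: cdeg_def)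
    let ?A = "{p \<in> tsupp n A d af b'. adjacent n A d af b p}"
    have "finite ?A"
      by (rule finite_subset[OF _ finite_PI]) (auto simp: tsupp_def Pi_c_eq[OF af])
    moreover have "x \<in> ?A"
    proof -
      have 1: "x \<in> tsupp n A d af b'" unfolding b'_eq by (rule tsupp_arc_in[OF af pr2 xs'])
      have "(c ^^ (l - 1)) (c q) = x" using l1 by (metis x_def Suc_diff_1 comp_apply funpow_Suc_right less_eq_Suc_le One_nat_def)
      then have "x \<in> arc_set (c q) l" unfolding arc_set_def using l1 by (intro image_eqI[of _ _ "l - 1"]) auto
      then have 2: "x \<in> tsupp n A d af (c b)" unfolding b_eq arc_c by (rule tsupp_arc_in[OF af proper_c[OF pr1]])
      have 3: "x \<notin> tsupp n A d af b" unfolding b_eq using tsupp_arc_out[OF af pr1] xns by blast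
      show ?thesis using 1 2 3 xP by (simp add: adjacent_def Pi_c_eq[OF af])
    qed
    ultimately have "card ?A > 0" by (auto simp: card_gt_0_iff)
    then show False using adj0 by (simp add: adj_def)
  next
    case False
    have bU: "b \<in> Ups" "b' \<in> Ups" using Ups_re_D[OF af] Ure by blast+
    have "max (cdeg_right n A d b b') (cdeg_left n A d b b') = 0" using c0 False by (simp add: cdeg_def)
    then have "cdeg_left n A d b b' \<le> 0" by linarith
    then have "- (2 / K b b) * E b' b \<le> 0"
      using cdeg_formula(2)[OF Ups_D(1,2)[OF bU(1)] Ups_D(2)[OF bU(2)]] by simp
    moreover have "2 / K b b > 0" using RR_norm_pos[OF Ups_D(1)[OF bU(1)]] by simp
    \<comment> \<open>In \<open>E b' b\<close> only the elements \<open>q\<close> and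
      \<open>x\<close> of \<open>b'\<close> contribute, with opposite signs. Nonnegativity forces
      \<open>b'\<close> to contain \<open>q\<close> as well as \<open>x\<close>.\<close>
    ultimately have Ege: "E b' b \<ge> 0" by (simp add: zero_le_mult_iff zero_le_divide_iff)
    have Esum: "E b' b = (\<Sum>i<l'. E q q * ((if (c ^^ i) q' = q then 1 else 0) - (if (c ^^ i) q' = x then 1 else 0)))"
    proof -
      have "E b' b = (\<Sum>i<l'. E ((c ^^ i) q') b)" unfolding b'_eq arc_def by (rule lin_sum[OF lin_EL1])
      also have "\<dots> = (\<Sum>i<l'. E q q * ((if (c ^^ i) q' = q then 1 else 0) - (if (c ^^ i) q' = x then 1 else 0)))"
        unfolding b_eq x_def using E_arc[OF cpow_PI[OF q'] q] by simp
      finally show ?thesis .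
    qed
    obtain i0 where i0: "i0 < l'" "(c ^^ i0) q' = x" using xs' by (auto simp: arc_set_def)
    have "\<exists>i1<l'. (c ^^ i1) q' = q"
    proof (rule ccontr)
      assume "\<not> ?thesis"
      then have no: "\<And>i. i < l' \<Longrightarrow> (c ^^ i) q' \<noteq> q" by blast
      have "(\<Sum>i<l'. E q q * ((if (c ^^ i) q' = q then 1 else 0) - (if (c ^^ i) q' = x then 1 else 0)))
          < (\<Sum>i<l'. 0)"
      proof (rule sum_strict_mono_ex1)
        show "\<forall>i\<in>{..<l'}. E q q * ((if (c ^^ i) q' = q then 1 else 0) - (if (c ^^ i) q' = x then 1 else 0)) \<le> 0"
          using no E_self_pos[OF q] by auto
        show "\<exists>i\<in>{..<l'}. E q q * ((if (c ^^ i) q' = q then 1 else 0) - (if (c ^^ i) q' = x then 1 else 0)) < 0"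
          using no i0 E_self_pos[OF q] by (intro bexI[of _ i0]) auto
      qed simp
      then show False using Ege Esum by simp
    qed
    then obtain i1 where i1: "i1 < l'" "(c ^^ i1) q' = q" by blast
    consider "i0 < i1" | "i0 = i1" | "i1 < i0" by linarith
    then show False
    proof cases
      case 1
      \<comment> \<open>The stretch of \<open>b'\<close> from \<open>x\<close> to \<open>q\<close>
        closes the circle with \<open>b\<close>, so the pair is component-full after all.\<close>
      let ?S = "arc_set q l \<union> (\<lambda>i. (c ^^ i) q') ` {i0..i1}"
      have qs: "q \<in> ?S" using i1 1 by (auto intro!: image_eqI[of _ _ i1])
      have cl: "c z \<in> ?S" if z: "z \<in> ?S" for z
      proof -
        consider i where "i < l" "z = (c ^^ i) q" | i where "i0 \<le> i" "i \<le> i1" "z = (c ^^ i) q'"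
          using z by (auto simp: arc_set_def)
        then show ?thesis
        proof cases
          case (1 i)
          then have cz: "c z = (c ^^ Suc i) q" by simp
          show ?thesis
          proof (cases "Suc i = l")
            case True
            then have "c z = (c ^^ i0) q'" using cz i0 by (simp add: x_def)
            then show ?thesis using \<open>i0 < i1\<close> by (auto intro!: image_eqI[of _ _ i0])
          next
            case False
            then have "c z \<in> arc_set q l" unfolding arc_set_def cz using 1 by (intro image_eqI[of _ _ "Suc i"]) auto
            then show ?thesis by blast
          qed
        next
          case (2 i)
          show ?thesis
          proof (cases "i = i1")
            case True
            then have cz: "c z = (c ^^ 1) q" using 2 i1 by simp
            show ?thesis
            proof (cases "l = 1")
              case True
              then have "c z = (c ^^ i0) q'" using cz i0 by (simp add: x_def)
              then show ?thesis using \<open>i0 < i1\<close> by (auto intro!: image_eqI[of _ _ i0])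
            next
              case False
              then have "c z \<in> arc_set q l" unfolding arc_set_def cz using l1 by (intro image_eqI[of _ _ 1]) auto
              then show ?thesis by blast
            qed
          next
            case False
            then have "c z = (c ^^ Suc i) q'" "Suc i \<in> {i0..i1}" using 2 by auto
            then show ?thesis by blast
          qed
        qed
      qed
      have "(c ^^ k) q \<in> ?S" for k
      proof (induction k)
        case 0
        show ?case using qs by simp
      next
        case (Suc k)
        then show ?case using cl by simp
      qed
      then have "orb q \<subseteq> ?S" by (auto simp only: orb_def image_subset_iff)
      moreover have "(\<lambda>i. (c ^^ i) q') ` {i0..i1} \<subseteq> arc_set q' l'" using i1 by (auto simp: arc_set_def)
      ultimately have sub: "orb q \<subseteq> arc_set q l \<union> arc_set q' l'" by (meson Un_mono order_refl subset_trans)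
      have "arc_set q l \<subseteq> tsupp n A d af b" "arc_set q' l' \<subseteq> tsupp n A d af b'"
        unfolding b_eq b'_eq
        by (rule subsetI, rule tsupp_arc_in[OF af pr1], assumption)
          (rule subsetI, rule tsupp_arc_in[OF af pr2], assumption)
      then have "orb q \<subseteq> tsupp_set n A d af {b, b'}"
        unfolding tsupp_set_def using sub by simp (meson Un_mono subset_trans)
      then have "component_full n A d af {b, b'}" unfolding component_full_def using tube_comp_orb[OF af q] by blast
      then show False using False by blast
    next
      case 2
      then have "(c ^^ l) q = (c ^^ 0) q" using i0 i1 by (simp add: x_def)
      then show False using proper_inj[OF pr1, of l 0] l1 by simp
    next
      case 3
      \<comment> \<open>Here \<open>q\<close> precedes \<open>x\<close> in \<open>b'\<close>, so
        \<open>x\<close> is reached from \<open>q\<close> in fewer than \<open>l'\<close> steps; but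
        \<open>l' \<le> l\<close>, and \<open>x\<close> is first reached after \<open>l\<close>
        steps.\<close>
      have "(c ^^ i0) q' = (c ^^ (i0 - i1)) ((c ^^ i1) q')" using 3 funpow_add[of "i0 - i1" i1 c] by simp
      then have "(c ^^ l) q = (c ^^ (i0 - i1)) q" using i0 i1 by (simp add: x_def)
      then show False using proper_inj[OF pr1, of l "i0 - i1"] i0(1) ll 3 by linarith
    qed
  qed
qed

lemma compatible_transjective_root:
  assumes af: "af < n" and CU: "C \<subseteq> Ups_re n A d af"
    and comp: "\<And>a b. a \<in> C \<Longrightarrow> b \<in> C \<Longrightarrow> a \<noteq> b \<Longrightarrow> cdeg n A d af a b = 0"
  shows "\<exists>x. x \<in> RR \<and> pos x \<and> E x dl > 0 \<and> (\<forall>b\<in>C. E b x = 0 \<and> E x b \<ge> 0)"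
proof -
  have "\<forall>b\<in>C. \<exists>q l. proper q l \<and> b = arc q l" using Ups_re_arc[OF af] CU by blast
  then obtain qq ll where ql: "\<And>b. b \<in> C \<Longrightarrow> proper (qq b) (ll b) \<and> b = arc (qq b) (ll b)" by metis
  define M where "M = {x. \<forall>b\<in>C. x \<notin> arc_set (qq b) (ll b)}"
  have "\<exists>x\<in>orb p. x \<in> M" if "p \<in> PI" for p
    unfolding M_def using compatible_arcs_miss[OF af CU comp ql that] by blast
  then obtain x where x: "good x" "nonorth x \<subseteq> M" using good_reach[of M] by blast
  have "E b x = 0 \<and> E x b \<ge> 0" if b: "b \<in> C" for b
  proof -
    have pr': "proper (qq b) (ll b)" and beq: "b = arc (qq b) (ll b)" using ql[OF b] by blast+
    let ?a = "\<lambda>x. if x \<in> arc_set (qq b) (ll b) then 1 else (0::real)"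
    have "b = lin_comb PI ?a" by (subst beq) (rule arc_comb[OF pr' arc_set_PI[OF pr'] finite_PI])
    moreover have "?a p = 0" if "p \<in> nonorth x" for p using that x(2) b unfolding M_def by auto
    ultimately show ?thesis using good_compat[OF x(1), of b ?a] by auto
  qed
  then show ?thesis using x(1) unfolding good_def by blast
qed

end

section \<open>From the tubes to maximality\<close>

context affine begin

lemma pos_roots_cases: assumes "v \<in> pos_roots n A" shows "v \<in> RR \<and> pos v \<or> E dl v = 0"
proof -
  have im: "E dl w = 0" if "w \<in> pos_imag_roots n A" for w
    using that dl_char(2)[of w] by (auto simp: pos_imag_eq EL_lin E_dl_dl)
  show ?thesis using assms im unfolding pos_roots_def roots_def by (auto simp: vneg_eq EL_lin)
qed

lemma delta_not_maximal:
  assumes af: "af < n"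
    and mx: "maximal_compatible_in n A d af (Phi_c n A d af - {dl}) C"
    and pw: "pairwise_compatible n A d af (insert dl C)"
  shows False
proof (cases "C = {}")
  case True
  \<comment> \<open>An empty \<open>C\<close> provides no root of the tubes to work with; a negative
    simple root already extends it.\<close>
  let ?v = "vneg (simple 0)"
  have "?v 0 < 0" by (simp add: vneg_def)
  then have "?v \<noteq> dl" using dl0 by auto
  moreover have "?v \<in> Phi_c n A d af" using n_pos by (auto simp: Phi_c_def simples_def)
  ultimately have "C \<subset> {?v} \<and> {?v} \<subseteq> Phi_c n A d af - {dl}" using True by auto
  moreover have "pairwise_compatible n A d af {?v}" by (simp add: pairwise_compatible_def)
  ultimately show False using mx unfolding maximal_compatible_in_def by blast
next
  case False
  have CG: "C \<subseteq> Phi_c n A d af - {dl}" using mx unfolding maximal_compatible_in_def by blast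
  have cc: "c_compatible n A d af a b" if "a \<in> insert dl C" "b \<in> insert dl C" "a \<noteq> b" for a b
    using pw that unfolding pairwise_compatible_def by blast
  have dlU: "dl \<notin> Ups_re n A d af" using dl_not_RR[of 1] by (auto simp: Ups_re_def)
  have posdl: "pos dl" using dl_pos by (auto simp: positive_def intro: less_imp_le)
  have CU: "C \<subseteq> Ups_re n A d af"
  proof
    fix b assume b: "b \<in> C"
    have bne: "b \<noteq> dl" and bP: "b \<in> Phi_c n A d af" using b CG by auto
    have "cdeg n A d af b dl = 0" using cc[of b dl] b bne by (simp add: c_compatible_def)
    then have mx0: "max (cdeg_right n A d b dl) (cdeg_left n A d b dl) = 0" using dlU by (simp add: cdeg_def)
    consider i where "i < n" "b = vneg (simple i)" | "b \<in> pos_roots n A - U_c n A d af" | "b \<in> Ups_re n A d af"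
      using bP bne unfolding Phi_c_def simples_def by blast
    then show "b \<in> Ups_re n A d af"
    proof cases
      \<comment> \<open>The degree of a negative simple root with \<delta> is at least
        \<open>dl i > 0\<close>.\<close>
      case (1 i)
      have bR: "b \<in> RR" unfolding 1(2) vneg_eq using RR_neg[OF RR_simple[OF 1(1)]] .
      have Kb: "K b b = 2 * d i" unfolding 1(2) vneg_eq by (simp add: K_lin K_simple_simple[OF 1(1)])
      have cco: "ccoord n A d b j = (if j = i then -1 else 0)" for j
        using bR d_pos[OF 1(1)] by (simp add: ccoord_def Kb) (simp add: 1(2) vneg_def simple_def)
      then have "pos_part (ccoord n A d b j) = 0" for j by (simp add: pos_part_def)
      then have "cdeg_right n A d b dl = - (\<Sum>j<n. ccoord n A d b j * dl j)" by (simp add: cdeg_right_def)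
      also have "(\<Sum>j<n. ccoord n A d b j * dl j) = (\<Sum>j<n. if j = i then - dl j else 0)"
        by (rule sum.cong) (auto simp: cco)
      also have "\<dots> = - dl i" using 1(1) by simp
      finally have "cdeg_right n A d b dl > 0" using dl_pos[OF 1(1)] by simp
      then show ?thesis using mx0 by linarith
    next
      case 2
      have nz: "E dl b \<noteq> 0" using 2 U_c_eq[OF af] by blast
      then have bR: "b \<in> RR" "pos b" using pos_roots_cases 2 by blast+
      have k: "2 / K b b > 0" using RR_norm_pos[OF bR(1)] by simp
      \<comment> \<open>The two degrees are opposite numbers with maximum 0, so both vanish, against
        nonzero \<open>E dl b\<close>.\<close>
      have "cdeg_right n A d b dl = (2 / K b b) * E dl b" "cdeg_left n A d b dl = - (2 / K b b) * E dl b"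
        using cdeg_formula[OF bR posdl] E_dl_anti[of b] by simp_all
      then have "(2 / K b b) * E dl b \<le> 0" "- (2 / K b b) * E dl b \<le> 0" using mx0 by linarith+
      then have "(2 / K b b) * E dl b = 0" by linarith
      then show ?thesis using k nz by simp
    qed
  qed
  obtain e where e: "e < n" "\<And>r. r \<in> RR \<Longrightarrow> \<exists>r'\<in>RR. r' e = 0 \<and> par r r'" by (rule special_node) blast
  interpret affine_sp n A d e by unfold_locales (use e in blast)+
  have "Ups \<noteq> {}"
  proof -
    obtain b where "b \<in> C" using False by blast
    then have "b \<in> Ups_re n A d af" using CU by blast
    then have "b \<in> Ups" unfolding Ups_re_def Ups_def U_c_eq[OF af] by auto
    then show ?thesis by blast
  qed
  then interpret affine_tube n A d e by unfold_locales
  have comp: "cdeg n A d af a b = 0" if "a \<in> C" "b \<in> C" "a \<noteq> b" for a b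
    using cc[of a b] that by (simp add: c_compatible_def)
  obtain x where x: "x \<in> RR" "pos x" "E x dl > 0" "\<And>b. b \<in> C \<Longrightarrow> E b x = 0 \<and> E x b \<ge> 0"
    using compatible_transjective_root[OF af CU comp] by blast
  have xU: "x \<notin> U_c n A d af" using x(3) E_dl_anti[of x] unfolding U_c_eq[OF af] by simp
  have xP: "x \<in> Phi_c n A d af" using x xU by (auto simp: Phi_c_def pos_roots_def roots_def)
  have xre: "x \<notin> Ups_re n A d af" using xU by (auto simp: Ups_re_def)
  have "x \<noteq> dl" using x(1) dl_not_RR[of 1] by auto
  have xC: "x \<notin> C" using xre CU by blast
  have cx: "c_compatible n A d af x b \<and> c_compatible n A d af b x" if b: "b \<in> C" for b
  proof -
    have bU: "b \<in> Ups" using Ups_re_D[OF af] CU b by blast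
    have k: "2 / K x x > 0" "2 / K b b > 0" using RR_norm_pos x(1) Ups_D(1)[OF bU] by simp_all
    have 1: "cdeg n A d af x b = 0"
      using cdeg_formula[OF x(1,2) Ups_D(2)[OF bU]] x(4)[OF b] k xre by (simp add: cdeg_def max_def mult_nonneg_nonneg)
    have 2: "cdeg n A d af b x = 0"
      using cdeg_formula[OF Ups_D(1,2)[OF bU] x(2)] x(4)[OF b] k xre
      by (simp add: cdeg_def max_def mult_nonneg_nonneg divide_le_0_iff)
    have "b \<in> Phi_c n A d af" "x \<noteq> b" using b CG xC by auto
    then show ?thesis using 1 2 xP by (simp add: c_compatible_def)
  qed
  have "pairwise_compatible n A d af (insert x C)"
    unfolding pairwise_compatible_def using cx cc by blast
  moreover have "C \<subset> insert x C" "insert x C \<subseteq> Phi_c n A d af - {dl}" using xC xP \<open>x \<noteq> dl\<close> CG by auto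
  ultimately show False using mx unfolding maximal_compatible_in_def by blast
qed

end

theorem theorem5p5:
  fixes n :: nat and A :: cmat and d :: "nat \<Rightarrow> real" and aff :: nat and C :: "vec set"
  assumes "affine_type n A"
    and "symmetrizer n A d"
    and "aff < n"
    and "delta n A aff = 1"
    and "C \<subseteq> Phi_c n A d aff"
  shows "real_c_cluster n A d aff C \<longleftrightarrow>
         maximal_compatible_in n A d aff (Phi_c n A d aff - {delta n A}) C"
proof
  interpret affine n A d by unfold_locales (use assms in auto)
  let ?P = "Phi_c n A d aff"
  {
    assume "real_c_cluster n A d aff C"
    then show "maximal_compatible_in n A d aff (?P - {dl}) C"
      unfolding real_c_cluster_def c_cluster_def maximal_compatible_in_def by blast
  next
    assume mx: "maximal_compatible_in n A d aff (?P - {dl}) C"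
    then have C: "C \<subseteq> ?P - {dl}" "pairwise_compatible n A d aff C"
      and mxC: "\<And>T. C \<subset> T \<Longrightarrow> T \<subseteq> ?P - {dl} \<Longrightarrow> \<not> pairwise_compatible n A d aff T"
      unfolding maximal_compatible_in_def by blast+
    have "\<not> pairwise_compatible n A d aff T" if T: "C \<subset> T" "T \<subseteq> ?P" for T
    proof
      assume pw: "pairwise_compatible n A d aff T"
      then have sub: "pairwise_compatible n A d aff S" if "S \<subseteq> T" for S
        using that unfolding pairwise_compatible_def by blast
      \<comment> \<open>A larger compatible set must contain \<delta>, and removing \<delta> gives
        back \<open>C\<close> by maximality; so \<delta> would be compatible with all of
        \<open>C\<close>.\<close>
      have "dl \<in> T" using mxC[of T] T pw by blast
      have "T - {dl} = C"
      proof (rule ccontr)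
        assume "T - {dl} \<noteq> C"
        then have "C \<subset> T - {dl}" using T C by blast
        then show False using mxC[of "T - {dl}"] T sub[of "T - {dl}"] by blast
      qed
      then have "pairwise_compatible n A d aff (insert dl C)" using sub[of "insert dl C"] \<open>dl \<in> T\<close> by blast
      then show False using delta_not_maximal[OF assms(3) mx] by blast
    qed
    then show "real_c_cluster n A d aff C"
      unfolding real_c_cluster_def c_cluster_def maximal_compatible_in_def using C by blast
  }
qed

end
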